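(* Consider the contaminated AR($p$) model described in the context, and suppose that the local alternative $H_{1n}(\rho)$ holds, i.e. for sample size $n$ the innovations have distribution function $A_n(x)=(1-\rho_n)\Phi(x/\theta_0)+\rho_n H(x)$ with $\rho_n=\min(1,\rho n^{-1/2})$. Assume that (i) a random variable with distribution function $H$ has zero mean and finite variance, and (ii) $H$ is twice differentiable with bounded second derivative. Let $\hat\mu_n$ and $\hat{\boldsymbol\beta}_n=(\hat\beta_{1n},\dots,\hat\beta_{pn})^T$ be any sequences such that, under $H_{1n}(\rho)$, for any finite $\Gamma,R\ge 0$, $n^{1/2}(\hat\mu_n-\mu)=O_P(1)$ and $n^{1/2}(\hat{\boldsymbol\beta}_n-\boldsymbol\beta)=O_P(1)$ as $n\to\infty$, uniformly in $\rho\le R$, $\gamma\le\Gamma$. Then for any finite $\Gamma\ge0$, $R\ge0$, any $x\in\mathbb{R}$ and any $\delta>0$, $$\sup_{\rho\le R,\;\gamma\le\Gamma}P\big(\big|n^{1/2}[\hat S_n(x)-S_n(x)]-\gamma\Delta_S(x,\Pi)\big|>\delta\big)\to0,\quad n\to\infty,$$ where $$\hat S_n(x)=\frac{\hat G_n(x)+1-\hat G_n(-x)}{2},\quad S_n(x)=\frac{G_n(x)+1-G_n(-x)}{2},\quad \Delta_S(x,\Pi)=\frac{\Delta_0(x,\Pi)-\Delta_0(-x,\Pi)}{2},$$ and $\Delta_0(x,\Pi)=\sum_{j=0}^p[E\,G_0(x+\beta_j\xi_1)-G_0(x)]$ with $\beta_0=-1$, $G_0(x)=\Phi(x/\theta_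0)$.
   Context: Model. $\{v_t\}_{t\in\mathbb{Z}}$ is the stationary solution of $v_t=\beta_1v_{t-1}+\dots+\beta_pv_{t-p}+\nu+\varepsilon_t$, $t\in\mathbb{Z}$, where $\{\varepsilon_t\}$ are i.i.d. with unknown distribution function $G$, $E\varepsilon_1=0$, $0<E\varepsilon_1^2<\infty$; $\boldsymbol\beta=(\beta_1,\dots,\beta_p)^T\in\mathbb{R}^p$ is an unknown vector such that all roots of the corresponding characteristic equation are less than one in modulus; $\nu\in\mathbb{R}$ is unknown. The constant $\mu$ is defined by $\nu=(1-\beta_1-\dots-\beta_p)\mu$. Observations. One observes $y_t=v_t+z_t^{\gamma_n}\xi_t$, $t=1-p,\dots,n$, where $\{z_t^{\gamma_n}\}$ are i.i.d. Bernoulli variables (values $0,1$) with $P(z_t^{\gamma_n}=1)=\gamma_n=\min(1,\gamma n^{-1/2})$, $\gamma\ge0$ unknown, and $\{\xi_t\}$ are i.i.d. with an arbitrary unknown distribution $\Pi$. Local alternative. $\Phi$ is the standard normal distribution function, $\theta_0>0$ is the unknown true value of the scale parameter $\theta$ under the normality hypothesis $G\in\{\Phi(x/\theta),\theta>0\}$, $H$ is a distribution function, and $\rho\ge0$. $H_{1n}(\rho)$ is the assumption that $G(x)=A_n(x):=(1-\rho_n)\Phi(x/\theta_0)+\rho_nH(x)$, $\rho_n=\min(1,\rho n^{-1/2})$. Residuals and empirical distribution functions. $\hat u_t=y_t-\hat\mu_n$ for $t=1-p,\dots,n$; the residuals are $\hat\varepsilon_t=\hat u_t-\hat\beta_{1n}\hat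 u_{t-1}-\dots-\hat\beta_{pn}\hat u_{t-p}$, $t=1,\dots,n$. With $I(\cdot)$ the indicator, $\hat G_n(x)=n^{-1}\sum_{t=1}^nI(\hat\varepsilon_t\le x)$ and $G_n(x)=n^{-1}\sum_{t=1}^nI(\varepsilon_t\le x)$.
   Formalization: The three sequences of innovations, Bernoulli variables and outliers are assumed mutually independent, which the description leaves unsaid; without it the claim fails, e.g. for outliers equal to minus the innovations. *)

theory Defs
  imports "HOL-Probability.Probability"
begin

definition std_normal_cdf :: "real \<Rightarrow> real" where
  "std_normal_cdf = cdf std_normal_distribution"

text \<open>Stability: every complex root of
  \<open>w ^ p = \<beta> 1 * w ^ (p - 1) + \<dots> + \<beta> p\<close> lies in the open unit disc. Coefficient vectors
  are functions on \<^typ>\<open>nat\<close> of which only the values at \<open>1, \<dots>, p\<close> are used.\<close>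

definition char_roots_in_unit_disc :: "nat \<Rightarrow> (nat \<Rightarrow> real) \<Rightarrow> bool" where
  "char_roots_in_unit_disc p \<beta> \<longleftrightarrow>
     (\<forall>w::complex. w ^ p = (\<Sum>j=1..p. of_real (\<beta> j) * w ^ (p - j)) \<longrightarrow> cmod w < 1)"

definition strictly_stationary :: "'a measure \<Rightarrow> (int \<Rightarrow> 'a \<Rightarrow> real) \<Rightarrow> bool" where
  "strictly_stationary M v \<longleftrightarrow>
     (\<forall>k. distr M (\<Pi>\<^sub>M t\<in>UNIV. borel) (\<lambda>\<omega> t. v (t + k) \<omega>) =
          distr M (\<Pi>\<^sub>M t\<in>UNIV. borel) (\<lambda>\<omega> t. v t \<omega>))"

text \<open>In the following locale \<open>G\<close> is the distribution function of the innovations, \<open>q\<close> the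
  contamination probability and \<open>\<xi>_law\<close> the law of the outliers. The assumption \<open>indep\<close> says that
  all the variables \<open>\<epsilon> t\<close>, \<open>z t\<close>, \<open>\<xi> t\<close> are jointly independent, i.e. that each of the three
  sequences is independent and that the sequences are independent of one another.\<close>

locale contaminated_ar = prob_space M
  for M :: "'a measure" +
  fixes p :: nat and \<beta> :: "nat \<Rightarrow> real" and \<nu> :: real
    and G :: "real \<Rightarrow> real" and q :: real and \<xi>_law :: "real measure"
    and \<epsilon> v z \<xi> :: "int \<Rightarrow> 'a \<Rightarrow> real"
  assumes indep: "indep_vars (\<lambda>_. borel) (case_sum \<epsilon> (case_sum z \<xi>)) UNIV"
    and innovation_cdf: "cdf (distr M borel (\<epsilon> t)) = G"
    and innovation_integrable: "integrable M (\<epsilon> 1)"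
    and innovation_mean: "expectation (\<epsilon> 1) = 0"
    and innovation_square_integrable: "integrable M (\<lambda>\<omega>. (\<epsilon> 1 \<omega>)\<^sup>2)"
    and innovation_nondegenerate: "0 < expectation (\<lambda>\<omega>. (\<epsilon> 1 \<omega>)\<^sup>2)"
    and ar_measurable: "random_variable borel (v t)"
    and ar_stationary: "strictly_stationary M v"
    and ar_recursion: "AE \<omega> in M. v t \<omega> = (\<Sum>j=1..p. \<beta> j * v (t - int j) \<omega>) + \<nu> + \<epsilon> t \<omega>"
    and bernoulli_values: "AE \<omega> in M. z t \<omega> = 0 \<or> z t \<omega> = 1"
    and bernoulli_prob: "prob {\<omega> \<in> space M. z t \<omega> = 1} = q"
    and outlier_law: "distr M borel (\<xi> t) = \<xi>_law"

definition contaminated_obs ::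
    "(int \<Rightarrow> 'a \<Rightarrow> real) \<Rightarrow> (int \<Rightarrow> 'a \<Rightarrow> real) \<Rightarrow> (int \<Rightarrow> 'a \<Rightarrow> real) \<Rightarrow> 'a \<Rightarrow> int \<Rightarrow> real" where
  "contaminated_obs v z \<xi> \<omega> t = v t \<omega> + z t \<omega> * \<xi> t \<omega>"

definition residual :: "nat \<Rightarrow> real \<Rightarrow> (nat \<Rightarrow> real) \<Rightarrow> (int \<Rightarrow> real) \<Rightarrow> int \<Rightarrow> real" where
  "residual p m b y t = (y t - m) - (\<Sum>j=1..p. b j * (y (t - int j) - m))"

definition empirical_cdf :: "nat \<Rightarrow> (int \<Rightarrow> real) \<Rightarrow> real \<Rightarrow> real" where
  "empirical_cdf n e x = (\<Sum>t=1..int n. of_bool (e t \<le> x)) / real n"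

definition symmetrize :: "(real \<Rightarrow> real) \<Rightarrow> real \<Rightarrow> real" where
  "symmetrize F x = (F x + 1 - F (- x)) / 2"

definition root_n_rate :: "nat \<Rightarrow> real \<Rightarrow> real" where
  "root_n_rate n a = min 1 (a / sqrt (real n))"

definition local_alternative_cdf ::
    "real \<Rightarrow> (real \<Rightarrow> real) \<Rightarrow> real \<Rightarrow> nat \<Rightarrow> real \<Rightarrow> real" where
  "local_alternative_cdf \<theta>\<^sub>0 H \<rho> n x =
     (1 - root_n_rate n \<rho>) * std_normal_cdf (x / \<theta>\<^sub>0) + root_n_rate n \<rho> * H x"

text \<open>The update \<open>\<beta>(0 := -1)\<close> is the convention that the coefficient with index 0 is \<open>-1\<close>.\<close>

definition Delta0 ::
    "nat \<Rightarrow> (nat \<Rightarrow> real) \<Rightarrow> real \<Rightarrow> real measure \<Rightarrow> real \<Rightarrow> real" where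
  "Delta0 p \<beta> \<theta>\<^sub>0 \<xi>_law x =
     (\<Sum>j=0..p. (\<integral>u. std_normal_cdf ((x + (\<beta>(0 := -1)) j * u) / \<theta>\<^sub>0) \<partial>\<xi>_law)
                - std_normal_cdf (x / \<theta>\<^sub>0))"

definition DeltaS ::
    "nat \<Rightarrow> (nat \<Rightarrow> real) \<Rightarrow> real \<Rightarrow> real measure \<Rightarrow> real \<Rightarrow> real" where
  "DeltaS p \<beta> \<theta>\<^sub>0 \<xi>_law x =
     (Delta0 p \<beta> \<theta>\<^sub>0 \<xi>_law x - Delta0 p \<beta> \<theta>\<^sub>0 \<xi>_law (- x)) / 2"

text \<open>\<open>X n \<rho> \<gamma> = O\<^sub>P(1)\<close> as \<open>n \<rightarrow> \<infinity>\<close>, uniformly in \<open>0 \<le> \<rho> \<le> R\<close> and \<open>0 \<le> \<gamma> \<le> \<Gamma>\<close>, where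
  \<open>X n \<rho> \<gamma>\<close> is a random variable on its own probability space \<open>M n \<rho> \<gamma>\<close>.\<close>

definition uniform_OP1 ::
    "(nat \<Rightarrow> real \<Rightarrow> real \<Rightarrow> 'a measure) \<Rightarrow> real \<Rightarrow> real \<Rightarrow>
     (nat \<Rightarrow> real \<Rightarrow> real \<Rightarrow> 'a \<Rightarrow> real) \<Rightarrow> bool" where
  "uniform_OP1 M R \<Gamma> X \<longleftrightarrow>
     (\<forall>\<eta>>0. \<exists>C. \<forall>\<^sub>F n in sequentially. \<forall>\<rho>\<in>{0..R}. \<forall>\<gamma>\<in>{0..\<Gamma>}.
        measure (M n \<rho> \<gamma>) {\<omega> \<in> space (M n \<rho> \<gamma>). \<bar>X n \<rho> \<gamma> \<omega>\<bar> > C} \<le> \<eta>)"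

end

theory Submission
  imports Defs "HOL-Complex_Analysis.Cauchy_Integral_Formula" "HOL-Real_Asymp.Real_Asymp"
begin

text \<open>
  Let \<open>w\<^sub>t = z\<^sub>t \<xi>\<^sub>t\<close> be the contamination and \<open>u\<^sub>t = v\<^sub>t - \<mu>\<close>. Inserting the autoregression into
  the residual shows that \<open>residual\<^sub>t \<le> x\<close> holds exactly when
  \<open>\<epsilon>\<^sub>t \<le> x + J\<^sub>t + n\<^sup>-\<^sup>1\<^sup>/\<^sup>2 \<Sum>\<^sub>j \<tau>\<^sub>j Y\<^sub>t\<^sub>,\<^sub>j\<close>, where \<open>J\<^sub>t = \<Sum>\<^sub>j\<^sub>\<ge>\<^sub>0 \<beta>\<^sub>j w\<^sub>t\<^sub>-\<^sub>j\<close> with \<open>\<beta>\<^sub>0 = -1\<close> is the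
  jump caused by outliers, \<open>Y\<^sub>t\<^sub>,\<^sub>0 = 1\<close>, \<open>Y\<^sub>t\<^sub>,\<^sub>j = u\<^sub>t\<^sub>-\<^sub>j + w\<^sub>t\<^sub>-\<^sub>j\<close> for \<open>j \<ge> 1\<close>, and \<open>\<tau>\<close> collects the
  estimation errors scaled by the root of \<open>n\<close> (\<open>residual_eq\<close>). The theorem is thus about an
  empirical process with perturbed thresholds.

  For a deterministic vector \<open>\<tau>\<close> the threshold at time \<open>t\<close> is a function of earlier innovations and
  of the contamination, because the stationary solution is the causal moving average of the
  innovations (\<open>causal_representation\<close>). The compensated indicators are therefore martingale
  differences, and the second moment of their normalised sum is at most the mean effect of the
  perturbation on the distribution function, which tends to 0 (\<open>compensated_sum_bound\<close>). In the
  compensator, the smooth perturbation acts linearly. The averages of the \<open>u\<^sub>t\<^sub>-\<^sub>j\<close> vanish, so that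
  the estimation of \<open>\<beta>\<close> has no first-order effect and only \<open>g\<^sub>0(x) \<tau>\<^sub>0\<close> remains, which stems from the
  estimation of \<open>\<mu>\<close>. Outliers have probability of order \<open>n\<^sup>-\<^sup>1\<^sup>/\<^sup>2\<close>, and two of them in one window of
  \<open>p + 1\<close> times have probability of order \<open>n\<^sup>-\<^sup>1\<close>; hence the effects of single outliers add up over
  the lags and give \<open>\<gamma> \<Delta>\<^sub>0(x)\<close>. The innovation law differs from the normal law by \<open>n\<^sup>-\<^sup>1\<^sup>/\<^sup>2\<close>, which
  alters these terms only at the next order. All this is one inequality in mean with explicit
  constants, \<open>process_approximation\<close>. The probability of outliers and the weight of the alternative
  enter it monotonically, so they may be replaced by their bounds in terms of \<open>\<Gamma>\<close> and \<open>R\<close>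
  (\<open>process_error_le\<close>), which gives the uniformity in \<open>\<rho>\<close> and \<open>\<gamma>\<close>.

  The actual \<open>\<tau>\<close> is random and depends on the whole sample, but it stays in a compact set with high
  probability. The indicators are monotone in the threshold, so the process at \<open>\<tau>\<close> lies between two
  processes at a nearby point of a finite grid whose thresholds are lowered and raised by
  \<open>n\<^sup>-\<^sup>1\<^sup>/\<^sup>2 \<eta> \<Sum>\<^sub>j \<bar>Y\<^sub>t\<^sub>,\<^sub>j\<bar>\<close> (\<open>process_mono\<close>, \<open>symmetrized_deviation\<close>). Finally, the normal
  density is even: subtracting the expansions at \<open>x\<close> and \<open>-x\<close> cancels \<open>g\<^sub>0(x) \<tau>\<^sub>0\<close> and leaves
  \<open>\<gamma> \<Delta>\<^sub>S(x)\<close>.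
\<close>

section \<open>The moving-average coefficients of a stable autoregression\<close>

text \<open>The reciprocals of the zeros of \<open>1 - \<Sum> \<beta>\<^sub>j z\<^sup>j\<close> are characteristic roots, so the zeros lie
outside the closed unit disc; there are finitely many of them, which leaves a margin.\<close>

lemma ar_polynomial_nonzero_on_larger_disc:
  fixes \<beta> :: "nat \<Rightarrow> real"
  assumes "char_roots_in_unit_disc p \<beta>"
  shows "\<exists>r>1. \<forall>z::complex. norm z < r \<longrightarrow> (1 - (\<Sum>j=1..p. of_real (\<beta> j) * z ^ j)) \<noteq> 0"
proof -
  define P :: "complex poly" where "P = 1 - (\<Sum>j=1..p. monom (of_real (\<beta> j)) j)"
  have poly_P: "poly P z = 1 - (\<Sum>j=1..p. of_real (\<beta> j) * z ^ j)" for z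
    by (simp add: P_def poly_sum poly_monom)
  have "poly P 0 = 1"
    by (simp add: poly_P sum.neutral)
  hence "P \<noteq> 0" by auto
  hence fin: "finite {z. poly P z = 0}" by (rule poly_roots_finite)
  have root: "norm z > 1" if "poly P z = 0" for z
  proof -
    have z0: "z \<noteq> 0" using that \<open>poly P 0 = 1\<close> by auto
    have "(inverse z) ^ p = (\<Sum>j=1..p. of_real (\<beta> j) * (inverse z) ^ (p - j))"
    proof -
      have "(inverse z) ^ p = (inverse z) ^ p * (\<Sum>j=1..p. of_real (\<beta> j) * z ^ j)"
        using that by (simp add: poly_P)
      also have "\<dots> = (\<Sum>j=1..p. of_real (\<beta> j) * ((inverse z) ^ p * z ^ j))"
        by (simp add: sum_distrib_left algebra_simps)
      also have "\<dots> = (\<Sum>j=1..p. of_real (\<beta> j) * (inverse z) ^ (p - j))"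
      proof (intro sum.cong refl)
        fix j assume "j \<in> {1..p}"
        hence "(inverse z) ^ p = (inverse z) ^ (p - j) * (inverse z) ^ j"
          by (simp flip: power_add)
        thus "of_real (\<beta> j) * ((inverse z) ^ p * z ^ j) = of_real (\<beta> j) * (inverse z) ^ (p - j)"
          using z0 by (simp add: field_simps)
      qed
      finally show ?thesis .
    qed
    hence "norm (inverse z) < 1"
      using assms unfolding char_roots_in_unit_disc_def by blast
    thus ?thesis using z0 by (simp add: norm_inverse inverse_less_1_iff)
  qed
  \<comment> \<open>2 is inserted because \<open>P\<close> may have no zero\<close>
  define r where "r = Min (insert 2 (norm ` {z. poly P z = 0}))"
  have "r > 1" using fin root by (auto simp: r_def)
  moreover have "poly P z \<noteq> 0" if "norm z < r" for z
    using that fin by (auto simp: r_def)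
  ultimately show ?thesis unfolding poly_P by blast
qed

text \<open>The coefficients are those of the power series \<open>1 / (1 - \<Sum> \<beta>\<^sub>j z\<^sup>j)\<close>. Its radius of convergence
exceeds 1 because the denominator has no zero in a disc larger than the unit disc.\<close>

lemma ex_summable_ma_coefficients:
  fixes \<beta> :: "nat \<Rightarrow> real"
  assumes "char_roots_in_unit_disc p \<beta>"
  shows "\<exists>\<psi>::nat \<Rightarrow> real. \<psi> 0 = 1 \<and>
      (\<forall>m>0. \<psi> m = (\<Sum>j=1..p. if j \<le> m then \<beta> j * \<psi> (m - j) else 0)) \<and>
      summable (\<lambda>k. \<bar>\<psi> k\<bar>)"
proof -
  define b :: "nat \<Rightarrow> complex" where "b j = (if 1 \<le> j \<and> j \<le> p then of_real (\<beta> j) else 0)" for j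
  define F :: "complex fps" where "F = 1 - Abs_fps b"
  have F_nth: "fps_nth F j = (if j = 0 then 1 else - b j)" for j
    by (auto simp: F_def b_def)
  have F_poly: "F = fps_of_poly (1 - (\<Sum>j=1..p. monom (of_real (\<beta> j)) j))"
    by (rule fps_ext) (auto simp: F_nth b_def coeff_sum if_distrib sum.delta' cong: if_cong)
  obtain r where r: "r > 1"
    and nz: "\<And>z::complex. norm z < r \<Longrightarrow> (1 - (\<Sum>j=1..p. of_real (\<beta> j) * z ^ j)) \<noteq> 0"
    using ar_polynomial_nonzero_on_larger_disc[OF assms] by blast
  have radF: "fps_conv_radius F = \<infinity>"
    unfolding F_poly by simp
  have evalF: "eval_fps F z = 1 - (\<Sum>j=1..p. of_real (\<beta> j) * z ^ j)" for z
    unfolding F_poly eval_fps_of_poly by (simp add: poly_sum poly_monom)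
  have "fps_conv_radius (inverse F) \<ge> min (ereal r) (fps_conv_radius F)"
    by (rule fps_conv_radius_inverse) (use r nz in \<open>auto simp: evalF eball_def zero_ereal_def\<close>)
  hence rad: "fps_conv_radius (inverse F) \<ge> ereal r" by (simp add: radF)
  define \<phi> where "\<phi> = fps_nth (inverse F)"
  define \<psi> where "\<psi> k = Re (\<phi> k)" for k
  have prod: "F * inverse F = 1"
    by (rule inverse_mult_eq_1') (simp add: F_nth)
  have \<phi>0: "\<phi> 0 = 1" by (simp add: \<phi>_def F_nth)
  have \<phi>_rec: "\<phi> m = (\<Sum>j=1..p. if j \<le> m then of_real (\<beta> j) * \<phi> (m - j) else 0)" if "m > 0" for m
  proof -
    have "0 = fps_nth (F * inverse F) m" using that by (simp add: prod)
    also have "\<dots> = (\<Sum>j=0..m. fps_nth F j * \<phi> (m - j))"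
      by (simp add: fps_mult_nth \<phi>_def)
    also have "\<dots> = \<phi> m + (\<Sum>j=1..m. - b j * \<phi> (m - j))"
    proof -
      have "{0..m} = insert 0 {1..m}" by auto
      thus ?thesis by (simp add: F_nth)
    qed
    also have "(\<Sum>j=1..m. - b j * \<phi> (m - j)) = - (\<Sum>j=1..m. b j * \<phi> (m - j))"
      by (simp add: sum_negf)
    finally have "\<phi> m = (\<Sum>j=1..m. b j * \<phi> (m - j))" by simp
    also have "\<dots> = (\<Sum>j\<in>{1..m} \<inter> {1..p}. of_real (\<beta> j) * \<phi> (m - j))"
      by (rule sum.mono_neutral_cong_right) (auto simp: b_def)
    also have "\<dots> = (\<Sum>j=1..p. if j \<le> m then of_real (\<beta> j) * \<phi> (m - j) else 0)"
      by (rule sum.mono_neutral_cong_left) auto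
    finally show ?thesis .
  qed
  have "summable (\<lambda>k. norm (\<phi> k))"
  proof -
    have "summable (\<lambda>k. norm (\<phi> k * 1 ^ k))"
      unfolding \<phi>_def
      by (rule abs_summable_in_conv_radius)
         (use r rad in \<open>auto simp: fps_conv_radius_def intro: less_le_trans[of _ "ereal r"]\<close>)
    thus ?thesis by simp
  qed
  hence "summable (\<lambda>k. \<bar>\<psi> k\<bar>)"
    by (rule summable_comparison_test'[where N = 0]) (simp add: \<psi>_def abs_Re_le_cmod)
  moreover have "\<psi> 0 = 1" by (simp add: \<psi>_def \<phi>0)
  moreover have "\<psi> m = (\<Sum>j=1..p. if j \<le> m then \<beta> j * \<psi> (m - j) else 0)" if "m > 0" for m
    unfolding \<psi>_def by (subst \<phi>_rec[OF that]) (auto intro!: sum.cong simp: Re_sum)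
  ultimately show ?thesis by blast
qed

section \<open>The normal distribution function and its mixtures\<close>

text \<open>A law whose distribution function is a mixture is the law obtained by first tossing a coin and then
drawing from one of the components. Realising it as a Giry bind makes the integral formula available.\<close>

lemma nn_integral_of_cdf_mixture:
  fixes L N K :: "real measure" and r :: real
  assumes L: "real_distribution L" and N: "real_distribution N" and K: "real_distribution K"
    and r: "0 \<le> r" "r \<le> 1"
    and mix: "\<And>x. cdf L x = (1 - r) * cdf N x + r * cdf K x"
    and f: "f \<in> borel_measurable borel"
  shows "(\<integral>\<^sup>+x. f x \<partial>L) = ennreal (1 - r) * (\<integral>\<^sup>+x. f x \<partial>N) + ennreal r * (\<integral>\<^sup>+x. f x \<partial>K)"
proof -
  interpret L: real_distribution L by fact
  interpret N: real_distribution N by fact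
  interpret K: real_distribution K by fact
  define Q where "Q = measure_pmf (bernoulli_pmf r) \<bind> (\<lambda>b. if b then K else N)"
  have kernel: "(\<lambda>b. if b then K else N) \<in> measurable (measure_pmf (bernoulli_pmf r)) (subprob_algebra borel)"
    by (auto simp: space_subprob_algebra K.prob_space_axioms N.prob_space_axioms
        intro: prob_space_imp_subprob_space split: if_splits)
  have nn: "(\<integral>\<^sup>+x. g x \<partial>Q) = ennreal (1 - r) * (\<integral>\<^sup>+x. g x \<partial>N) + ennreal r * (\<integral>\<^sup>+x. g x \<partial>K)"
    if "g \<in> borel_measurable borel" for g
    unfolding Q_def using r
    by (subst nn_integral_bind[OF that kernel])
       (auto simp: add.commute mult.commute)
  have setsQ: "sets Q = sets borel"
    unfolding Q_def by (rule sets_bind) (auto split: if_splits)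
  have emQ: "emeasure Q A = ennreal (1 - r) * emeasure N A + ennreal r * emeasure K A"
    if "A \<in> sets borel" for A
    using nn[of "indicator A"] that setsQ by simp
  have probQ: "prob_space Q"
    using setsQ r by (intro prob_spaceI)
      (auto simp: emQ sets_eq_imp_space_eq[OF setsQ] N.emeasure_space_1[simplified] K.emeasure_space_1[simplified] 
         simp flip: ennreal_plus)
  have "real_distribution Q"
    using probQ setsQ by (simp add: real_distribution_def real_distribution_axioms_def)
  moreover have "cdf L = cdf Q"
  proof
    fix x
    have "emeasure Q {..x} = ennreal ((1 - r) * cdf N x + r * cdf K x)"
      using r by (simp add: emQ N.emeasure_eq_measure K.emeasure_eq_measure cdf_def ennreal_mult ennreal_plus)
    hence "measure Q {..x} = enn2real (ennreal ((1 - r) * cdf N x + r * cdf K x))"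
      unfolding measure_def by (rule arg_cong)
    also have "\<dots> = (1 - r) * cdf N x + r * cdf K x"
      using r N.cdf_nonneg[of x] K.cdf_nonneg[of x] by (intro enn2real_ennreal) auto
    finally show "cdf L x = cdf Q x"
      by (simp add: mix cdf_def[of Q])
  qed
  ultimately have "L = Q" using L by (intro cdf_unique) auto
  thus ?thesis using nn[OF f] by simp
qed

lemma cdf_scaled_normal:
  assumes "\<theta> > 0"
  shows "cdf (distr std_normal_distribution borel (\<lambda>x. \<theta> * x)) x = std_normal_cdf (x / \<theta>)"
  using assms by (simp add: cdf_def std_normal_cdf_def measure_distr vimage_def field_simps atMost_def)

lemma real_distribution_scaled_normal:
  "real_distribution (distr std_normal_distribution borel (\<lambda>x. \<theta> * x))"
proof -
  interpret real_distribution std_normal_distribution by (rule real_dist_normal_dist)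
  show ?thesis by (rule real_distribution_distr) simp
qed

text \<open>The bound does not depend on the mixing weight, so it serves all sample sizes and all \<open>\<rho>\<close> at once.\<close>

lemma second_moment_local_alternative_le:
  assumes L: "real_distribution L" and K: "real_distribution K" and r: "0 \<le> r" "r \<le> 1"
    and \<theta>: "\<theta> > 0"
    and cdf: "\<And>x. cdf L x = (1 - r) * std_normal_cdf (x / \<theta>) + r * cdf K x"
    and K2: "integrable K (\<lambda>x. x\<^sup>2)"
  shows "(\<integral>\<^sup>+x. ennreal (x\<^sup>2) \<partial>L) \<le> ennreal (\<theta>\<^sup>2 + (\<integral>x. x\<^sup>2 \<partial>K))"
proof -
  let ?N = "distr std_normal_distribution borel (\<lambda>x. \<theta> * x)"
  have "(\<integral>\<^sup>+x. ennreal (x\<^sup>2) \<partial>?N) = (\<integral>\<^sup>+x. ennreal (\<theta>\<^sup>2) * ennreal (x\<^sup>2) \<partial>std_normal_distribution)"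
    by (subst nn_integral_distr) (auto simp: power_mult_distrib ennreal_mult)
  also have "\<dots> = ennreal (\<theta>\<^sup>2) * (\<integral>\<^sup>+x. ennreal (x\<^sup>2) \<partial>std_normal_distribution)"
    by (rule nn_integral_cmult) simp
  also have "(\<integral>\<^sup>+x. ennreal (x\<^sup>2) \<partial>std_normal_distribution) = 1"
    using std_normal_distribution_even_moments[of 1]
    by (subst nn_integral_eq_integral) (auto simp: numeral_2_eq_2)
  finally have N: "(\<integral>\<^sup>+x. ennreal (x\<^sup>2) \<partial>?N) = ennreal (\<theta>\<^sup>2)" by simp
  have Ke: "(\<integral>\<^sup>+x. ennreal (x\<^sup>2) \<partial>K) = ennreal (\<integral>x. x\<^sup>2 \<partial>K)"
    by (rule nn_integral_eq_integral[OF K2]) simp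
  have "(\<integral>\<^sup>+x. ennreal (x\<^sup>2) \<partial>L) = ennreal (1 - r) * ennreal (\<theta>\<^sup>2) + ennreal r * ennreal (\<integral>x. x\<^sup>2 \<partial>K)"
    using nn_integral_of_cdf_mixture[OF L real_distribution_scaled_normal K r, of \<theta> "\<lambda>x. ennreal (x\<^sup>2)"]
      cdf cdf_scaled_normal[OF \<theta>] by (simp add: N Ke)
  also have "\<dots> \<le> 1 * ennreal (\<theta>\<^sup>2) + 1 * ennreal (\<integral>x. x\<^sup>2 \<partial>K)"
    using r by (intro add_mono mult_right_mono) auto
  also have "\<dots> = ennreal (\<theta>\<^sup>2 + (\<integral>x. x\<^sup>2 \<partial>K))"
    by (simp add: ennreal_plus)
  finally show ?thesis .
qed

lemma std_normal_cdf_has_derivative: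
  "(std_normal_cdf has_real_derivative std_normal_density x) (at x)"
proof -
  interpret real_distribution std_normal_distribution by (rule real_dist_normal_dist)
  define a b where "a = x - 1" and "b = x + 1"
  have "continuous_on {x-2..x+2} std_normal_density"
    unfolding std_normal_density_def by (intro continuous_intros) auto
  then obtain g where g: "\<And>y. y \<in> {x-2..x+2} \<Longrightarrow>
      (g has_vector_derivative std_normal_density y) (at y within {x-2..x+2})"
    using antiderivative_continuous by blast
  have g: "(g has_real_derivative std_normal_density y) (at y)" if "a \<le> y" "y \<le> b" for y
    using g[of y] that
    by (simp add: a_def b_def at_within_Icc_at has_real_derivative_iff_has_vector_derivative)
  have eq: "std_normal_cdf y = std_normal_cdf a + (g y - g a)" if y: "a < y" "y < b" for y
  proof -
    have "emeasure std_normal_distribution {a<..y} =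
        (\<integral>\<^sup>+z. ennreal (std_normal_density z) * indicator {a<..y} z \<partial>lborel)"
      by (subst emeasure_density) auto
    also have "\<dots> = (\<integral>\<^sup>+z. ennreal (std_normal_density z) * indicator {a..y} z \<partial>lborel)"
      by (intro nn_integral_cong_AE, rule AE_mp[OF AE_lborel_singleton[of a]])
         (auto simp: indicator_def)
    also have "\<dots> = ennreal (g y - g a)"
      using y g by (intro nn_integral_FTC_Icc) auto
    finally have "emeasure std_normal_distribution {a<..y} = ennreal (g y - g a)" .
    moreover have "g a \<le> g y"
    proof (rule DERIV_nonneg_imp_nondecreasing[of a y g])
      fix z assume "a \<le> z" "z \<le> y"
      thus "\<exists>d. (g has_real_derivative d) (at z) \<and> d \<ge> 0"
        using y by (intro exI[of _ "std_normal_density z"] conjI g) auto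
    next
      show "a \<le> y" using y by simp
    qed
    ultimately have "measure std_normal_distribution {a<..y} = g y - g a"
      by (simp add: measure_def)
    thus ?thesis
      using cdf_diff_eq[of a y] y by (simp add: std_normal_cdf_def)
  qed
  have "(g has_real_derivative std_normal_density x) (at x)"
    using g[of x] by (simp add: a_def b_def)
  hence "((\<lambda>y. std_normal_cdf a + (g y - g a)) has_real_derivative std_normal_density x) (at x)"
    by (auto intro!: derivative_eq_intros)
  thus ?thesis
    by (rule has_field_derivative_transform_within_open[of _ _ _ "{a<..<b}"])
       (use eq in \<open>auto simp: a_def b_def\<close>)
qed

lemma scaled_normal_cdf_has_derivative:
  assumes "\<theta> > 0"
  shows "((\<lambda>x. std_normal_cdf (x / \<theta>)) has_real_derivative std_normal_density (x / \<theta>) / \<theta>) (at x)"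
proof -
  have "((\<lambda>x. std_normal_cdf (x / \<theta>)) has_real_derivative std_normal_density (x / \<theta>) * (1 / \<theta>)) (at x)"
    by (rule DERIV_chain2[OF std_normal_cdf_has_derivative])
       (use assms in \<open>auto intro!: derivative_eq_intros\<close>)
  thus ?thesis by simp
qed

lemma scaled_normal_density_has_derivative:
  assumes "\<theta> > 0"
  shows "((\<lambda>x. std_normal_density (x / \<theta>) / \<theta>) has_real_derivative
            - (x / \<theta>) * std_normal_density (x / \<theta>) / \<theta>\<^sup>2) (at x)"
  unfolding std_normal_density_def using assms
  by (auto intro!: derivative_eq_intros simp: field_simps power2_eq_square)

lemma std_normal_density_le_1: "std_normal_density x \<le> 1"
proof -
  have "1 \<le> sqrt (2 * pi)" using pi_gt3 by simp
  moreover have "exp (- x\<^sup>2 / 2) \<le> 1" by simp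
  ultimately have "exp (- x\<^sup>2 / 2) \<le> sqrt (2 * pi)" by linarith
  thus ?thesis
    unfolding std_normal_density_def
    by (simp add: divide_le_eq)
qed

lemma abs_mult_std_normal_density_le_1: "\<bar>x * std_normal_density x\<bar> \<le> 1"
proof -
  have "2 * \<bar>x\<bar> \<le> 1 + x\<^sup>2" using sum_squares_bound[of 1 "\<bar>x\<bar>"] by simp
  hence "\<bar>x\<bar> \<le> 1 + x\<^sup>2 / 2" by simp
  also have "\<dots> \<le> exp (x\<^sup>2 / 2)" by (rule exp_ge_add_one_self)
  finally have "\<bar>x\<bar> * exp (- x\<^sup>2 / 2) \<le> 1"
    by (simp add: exp_minus field_simps)
  moreover have "1 \<le> sqrt (2 * pi)" using pi_gt3 by simp
  ultimately have "\<bar>x\<bar> * exp (- x\<^sup>2 / 2) \<le> sqrt (2 * pi)" by linarith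
  thus ?thesis
    unfolding std_normal_density_def by (simp add: abs_mult divide_le_eq)
qed

lemma std_normal_cdf_bounds: "0 \<le> std_normal_cdf x" "std_normal_cdf x \<le> 1"
proof -
  interpret real_distribution std_normal_distribution by (rule real_dist_normal_dist)
  show "0 \<le> std_normal_cdf x" "std_normal_cdf x \<le> 1"
    unfolding std_normal_cdf_def by (auto intro: cdf_nonneg cdf_bounded_prob)
qed

lemma std_normal_cdf_measurable [measurable]: "std_normal_cdf \<in> borel_measurable borel"
proof -
  interpret real_distribution std_normal_distribution by (rule real_dist_normal_dist)
  show ?thesis
    unfolding std_normal_cdf_def by (rule borel_measurable_mono) (simp add: mono_def cdf_nondecreasing)
qed

lemma scaled_normal_cdf_Lipschitz:
  assumes "\<theta> > 0"
  shows "\<bar>std_normal_cdf (a / \<theta>) - std_normal_cdf (b / \<theta>)\<bar> \<le> \<bar>a - b\<bar> / \<theta>"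
proof -
  have "norm (std_normal_cdf (a / \<theta>) - std_normal_cdf (b / \<theta>)) \<le> (1 / \<theta>) * norm (a - b)"
  proof (rule field_differentiable_bound[of UNIV])
    fix y
    show "((\<lambda>x. std_normal_cdf (x / \<theta>)) has_field_derivative std_normal_density (y / \<theta>) / \<theta>) (at y within UNIV)"
      using scaled_normal_cdf_has_derivative[OF assms] by simp
    show "norm (std_normal_density (y / \<theta>) / \<theta>) \<le> 1 / \<theta>"
      using assms std_normal_density_le_1[of "y / \<theta>"] by (simp add: divide_right_mono)
  qed auto
  thus ?thesis by simp
qed

lemma second_order_Taylor_bound:
  fixes f f' f'' :: "real \<Rightarrow> real"
  assumes f: "\<And>x. (f has_real_derivative f' x) (at x)"
    and f': "\<And>x. (f' has_real_derivative f'' x) (at x)"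
    and B: "\<And>x. \<bar>f'' x\<bar> \<le> B"
  shows "\<bar>f (x + h) - f x - f' x * h\<bar> \<le> B * h\<^sup>2"
proof -
  have lip: "\<bar>f' y - f' x\<bar> \<le> B * \<bar>y - x\<bar>" for y
    using field_differentiable_bound[of UNIV f' f'' B y x] f' B by auto
  have "\<bar>(f (x + h) - f' x * (x + h)) - (f x - f' x * x)\<bar> \<le> (B * \<bar>h\<bar>) * \<bar>(x + h) - x\<bar>"
  proof (rule field_differentiable_bound[of "cball x \<bar>h\<bar>" "\<lambda>y. f y - f' x * y" "\<lambda>y. f' y - f' x", simplified real_norm_def])
    fix y assume y: "y \<in> cball x \<bar>h\<bar>"
    show "((\<lambda>y. f y - f' x * y) has_field_derivative f' y - f' x) (at y within cball x \<bar>h\<bar>)"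
      by (auto intro!: derivative_eq_intros f[THEN has_field_derivative_at_within])
    have "B \<ge> 0" using B[of 0] by linarith
    thus "\<bar>f' y - f' x\<bar> \<le> B * \<bar>h\<bar>"
      using lip[of y] y by (intro order_trans[OF lip] mult_left_mono) (auto simp: dist_real_def)
  qed (auto simp: dist_real_def)
  also have "(f (x + h) - f' x * (x + h)) - (f x - f' x * x) = f (x + h) - f x - f' x * h"
    by (simp add: algebra_simps)
  finally show ?thesis by (simp add: power2_eq_square mult_ac)
qed

section \<open>Moment inequalities\<close>

lemmas integrable_closure =
  Bochner_Integration.integrable_add Bochner_Integration.integrable_diff Bochner_Integration.integrable_sum
  Bochner_Integration.integrable_divide integrable_mult_right integrable_abs

text \<open>Cauchy--Schwarz after splitting each weight into two square roots.\<close>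

lemma weighted_Cauchy_Schwarz:
  fixes a x :: "'i \<Rightarrow> real"
  assumes "\<And>i. i \<in> I \<Longrightarrow> 0 \<le> a i"
  shows "(\<Sum>i\<in>I. a i * x i)\<^sup>2 \<le> (\<Sum>i\<in>I. a i) * (\<Sum>i\<in>I. a i * (x i)\<^sup>2)"
proof -
  have "(\<Sum>i\<in>I. a i * x i) = (\<Sum>i\<in>I. sqrt (a i) * (sqrt (a i) * x i))"
    by (intro sum.cong refl) (simp add: assms flip: mult.assoc)
  also have "\<dots>\<^sup>2 \<le> (\<Sum>i\<in>I. (sqrt (a i))\<^sup>2) * (\<Sum>i\<in>I. (sqrt (a i) * x i)\<^sup>2)"
    by (rule Cauchy_Schwarz_ineq_sum)
  also have "\<dots> = (\<Sum>i\<in>I. a i) * (\<Sum>i\<in>I. a i * (x i)\<^sup>2)"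
    by (intro arg_cong2[where f = "(*)"] sum.cong refl) (simp_all add: assms power_mult_distrib)
  finally show ?thesis .
qed

context prob_space
begin

lemma expectation_abs_le_sqrt:
  fixes f :: "'a \<Rightarrow> real"
  assumes [measurable]: "f \<in> borel_measurable M"
    and sq: "integrable M (\<lambda>\<omega>. (f \<omega>)\<^sup>2)" and b: "expectation (\<lambda>\<omega>. (f \<omega>)\<^sup>2) \<le> b"
  shows "expectation (\<lambda>\<omega>. \<bar>f \<omega>\<bar>) \<le> sqrt b"
proof -
  have int: "integrable M (\<lambda>\<omega>. \<bar>f \<omega>\<bar>)"
    using square_integrable_imp_integrable[OF _ sq] by simp
  have "variance (\<lambda>\<omega>. \<bar>f \<omega>\<bar>) = expectation (\<lambda>\<omega>. (f \<omega>)\<^sup>2) - (expectation (\<lambda>\<omega>. \<bar>f \<omega>\<bar>))\<^sup>2"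
    using variance_eq[OF int] sq by simp
  moreover have "variance (\<lambda>\<omega>. \<bar>f \<omega>\<bar>) \<ge> 0" by (rule variance_positive)
  ultimately have "(expectation (\<lambda>\<omega>. \<bar>f \<omega>\<bar>))\<^sup>2 \<le> b" using b by linarith
  thus ?thesis by (rule real_le_rsqrt)
qed

lemma square_integrable_imp_product_integrable:
  fixes f g :: "'a \<Rightarrow> real"
  assumes [measurable]: "f \<in> borel_measurable M" "g \<in> borel_measurable M"
    and "integrable M (\<lambda>\<omega>. (f \<omega>)\<^sup>2)" "integrable M (\<lambda>\<omega>. (g \<omega>)\<^sup>2)"
  shows "integrable M (\<lambda>\<omega>. f \<omega> * g \<omega>)"
proof (rule Bochner_Integration.integrable_bound)
  show "integrable M (\<lambda>\<omega>. (f \<omega>)\<^sup>2 + (g \<omega>)\<^sup>2)" using assms by auto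
  have "norm (f \<omega> * g \<omega>) \<le> norm ((f \<omega>)\<^sup>2 + (g \<omega>)\<^sup>2)" for \<omega>
  proof -
    have "2 * (\<bar>f \<omega>\<bar> * \<bar>g \<omega>\<bar>) \<le> (f \<omega>)\<^sup>2 + (g \<omega>)\<^sup>2"
      using sum_squares_bound[of "\<bar>f \<omega>\<bar>" "\<bar>g \<omega>\<bar>"] by simp
    moreover have "0 \<le> \<bar>f \<omega>\<bar> * \<bar>g \<omega>\<bar>" by simp
    ultimately have "\<bar>f \<omega>\<bar> * \<bar>g \<omega>\<bar> \<le> (f \<omega>)\<^sup>2 + (g \<omega>)\<^sup>2" by linarith
    thus ?thesis by (simp add: abs_mult)
  qed
  thus "AE \<omega> in M. norm (f \<omega> * g \<omega>) \<le> norm ((f \<omega>)\<^sup>2 + (g \<omega>)\<^sup>2)" by simp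
qed simp

text \<open>Orthogonality removes the mixed terms of the squared sum, and the norm in \<open>L\<^sup>1\<close> is at most the one in
\<open>L\<^sup>2\<close>. It is applied to the innovations, to the compensated indicators and to the single jumps.\<close>

lemma normalised_orthogonal_sum_bound:
  fixes X :: "int \<Rightarrow> 'a \<Rightarrow> real" and n :: nat
  assumes n: "n \<ge> 1"
    and meas [measurable]: "\<And>t. t \<in> {1..int n} \<Longrightarrow> X t \<in> borel_measurable M"
    and sq: "\<And>t. t \<in> {1..int n} \<Longrightarrow> integrable M (\<lambda>\<omega>. (X t \<omega>)\<^sup>2)"
    and orth: "\<And>s t. 1 \<le> s \<Longrightarrow> s < t \<Longrightarrow> t \<le> int n \<Longrightarrow> expectation (\<lambda>\<omega>. X s \<omega> * X t \<omega>) = 0"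
    and b: "\<And>t. t \<in> {1..int n} \<Longrightarrow> expectation (\<lambda>\<omega>. (X t \<omega>)\<^sup>2) \<le> b"
  shows "expectation (\<lambda>\<omega>. \<bar>(\<Sum>t=1..int n. X t \<omega>) / sqrt (real n)\<bar>) \<le> sqrt b"
proof (rule expectation_abs_le_sqrt)
  let ?I = "{1..int n}"
  have prod: "integrable M (\<lambda>\<omega>. X s \<omega> * X t \<omega>)" if "s \<in> ?I" "t \<in> ?I" for s t
    by (intro square_integrable_imp_product_integrable meas sq that)
  have expand: "((\<Sum>t\<in>?I. X t \<omega>) / sqrt (real n))\<^sup>2 = (\<Sum>s\<in>?I. \<Sum>t\<in>?I. X s \<omega> * X t \<omega>) / real n" for \<omega>
    by (simp add: power_divide power2_eq_square sum_product)
  show "(\<lambda>\<omega>. (\<Sum>t\<in>?I. X t \<omega>) / sqrt (real n)) \<in> borel_measurable M"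
    by (intro borel_measurable_divide borel_measurable_sum meas) auto
  have int: "integrable M (\<lambda>\<omega>. \<Sum>s\<in>?I. \<Sum>t\<in>?I. X s \<omega> * X t \<omega>)"
    by (intro integrable_closure prod)
  thus "integrable M (\<lambda>\<omega>. ((\<Sum>t\<in>?I. X t \<omega>) / sqrt (real n))\<^sup>2)"
    unfolding expand by simp
  have "expectation (\<lambda>\<omega>. \<Sum>s\<in>?I. \<Sum>t\<in>?I. X s \<omega> * X t \<omega>)
      = (\<Sum>s\<in>?I. expectation (\<lambda>\<omega>. \<Sum>t\<in>?I. X s \<omega> * X t \<omega>))"
    by (intro Bochner_Integration.integral_sum Bochner_Integration.integrable_sum prod)
  also have "\<dots> = (\<Sum>s\<in>?I. \<Sum>t\<in>?I. expectation (\<lambda>\<omega>. X s \<omega> * X t \<omega>))"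
    by (intro sum.cong refl Bochner_Integration.integral_sum prod)
  also have "\<dots> = (\<Sum>s\<in>?I. \<Sum>t\<in>?I. if t = s then expectation (\<lambda>\<omega>. (X t \<omega>)\<^sup>2) else 0)"
  proof (intro sum.cong refl)
    fix s t assume "s \<in> ?I" "t \<in> ?I"
    thus "expectation (\<lambda>\<omega>. X s \<omega> * X t \<omega>) = (if t = s then expectation (\<lambda>\<omega>. (X t \<omega>)\<^sup>2) else 0)"
      using orth[of s t] orth[of t s]
      by (cases s t rule: linorder_cases) (auto simp: power2_eq_square mult.commute)
  qed
  also have "\<dots> = (\<Sum>s\<in>?I. expectation (\<lambda>\<omega>. (X s \<omega>)\<^sup>2))" by simp
  also have "\<dots> \<le> (\<Sum>s\<in>?I. b)" by (intro sum_mono b)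
  also have "\<dots> = real n * b" by simp
  finally show "expectation (\<lambda>\<omega>. ((\<Sum>t\<in>?I. X t \<omega>) / sqrt (real n))\<^sup>2) \<le> b"
    using n unfolding expand by (simp add: field_simps)
qed

text \<open>Independence passes to functions of the two variables. Being such a function is expressed by
measurability with respect to the generated \<open>\<sigma>\<close>-algebra, so that it need not be written down.\<close>

lemma indep_var_of_generated:
  assumes ind: "indep_var N1 P1 N2 P2"
    and Y1: "Y1 \<in> measurable (vimage_algebra (space M) P1 N1) K1"
    and Y2: "Y2 \<in> measurable (vimage_algebra (space M) P2 N2) K2"
  shows "indep_var K1 Y1 K2 Y2"
proof -
  have rv: "random_variable N1 P1" "random_variable N2 P2"
    and set: "indep_set (sigma_sets (space M) {P1 -` A \<inter> space M |A. A \<in> sets N1})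
                        (sigma_sets (space M) {P2 -` A \<inter> space M |A. A \<in> sets N2})"
    using ind unfolding indep_var_eq by auto
  have gen: "Y \<in> measurable M K \<and> sigma_sets (space M) {Y -` A \<inter> space M |A. A \<in> sets K}
        \<subseteq> sigma_sets (space M) {P -` A \<inter> space M |A. A \<in> sets N}"
    if P: "random_variable N P" and Y: "Y \<in> measurable (vimage_algebra (space M) P N) K"
    for Y :: "'a \<Rightarrow> 'c" and K and P :: "'a \<Rightarrow> 'b" and N
  proof
    have P': "P \<in> space M \<rightarrow> space N" using measurable_space[OF P] by auto
    have "(\<lambda>\<omega>. \<omega>) \<in> measurable M (vimage_algebra (space M) P N)"
      using P by (intro measurable_vimage_algebra2) auto
    from measurable_compose[OF this Y] show "Y \<in> measurable M K" .
    show "sigma_sets (space M) {Y -` A \<inter> space M |A. A \<in> sets K}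
        \<subseteq> sigma_sets (space M) {P -` A \<inter> space M |A. A \<in> sets N}"
    proof (rule sigma_sets_mono, safe)
      fix A assume "A \<in> sets K"
      hence "Y -` A \<inter> space M \<in> sets (vimage_algebra (space M) P N)"
        using measurable_sets[OF Y] by simp
      also have "sets (vimage_algebra (space M) P N) = {P -` A \<inter> space M |A. A \<in> sets N}"
        by (rule sets_vimage_algebra2[OF P'])
      finally show "Y -` A \<inter> space M \<in> sigma_sets (space M) {P -` A \<inter> space M |A. A \<in> sets N}"
        by (rule sigma_sets.Basic)
    qed
  qed
  have "indep_set (sigma_sets (space M) {Y1 -` A \<inter> space M |A. A \<in> sets K1})
                  (sigma_sets (space M) {Y2 -` A \<inter> space M |A. A \<in> sets K2})"
    unfolding indep_set_def
    by (rule indep_sets_mono_sets[OF set[unfolded indep_set_def]])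
       (use gen[OF rv(1) Y1] gen[OF rv(2) Y2] in \<open>simp split: bool.split\<close>)
  thus ?thesis
    unfolding indep_var_eq using gen[OF rv(1) Y1] gen[OF rv(2) Y2] by blast
qed

lemma dominated_abs_expectation:
  fixes f g :: "'a \<Rightarrow> real"
  assumes f: "f \<in> borel_measurable M" and g: "integrable M g"
    and dom: "AE \<omega> in M. \<bar>f \<omega>\<bar> \<le> g \<omega>" and b: "expectation g \<le> b"
  shows "integrable M f" and "expectation (\<lambda>\<omega>. \<bar>f \<omega>\<bar>) \<le> b"
proof -
  show int: "integrable M f"
    by (rule Bochner_Integration.integrable_bound[OF g f]) (use dom in \<open>auto intro: order_trans[OF _ abs_ge_self]\<close>)
  have "expectation (\<lambda>\<omega>. \<bar>f \<omega>\<bar>) \<le> expectation g"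
    using int dom by (intro integral_mono_AE g) auto
  thus "expectation (\<lambda>\<omega>. \<bar>f \<omega>\<bar>) \<le> b" using b by linarith
qed

lemma normalised_sum_abs_expectation:
  fixes R :: "int \<Rightarrow> 'a \<Rightarrow> real"
  assumes "n \<ge> 1" and int: "\<And>t. integrable M (R t)" and e: "\<And>t. expectation (\<lambda>\<omega>. \<bar>R t \<omega>\<bar>) \<le> e"
  shows "integrable M (\<lambda>\<omega>. (\<Sum>t=1..int n. R t \<omega>) / sqrt (real n))"
    and "expectation (\<lambda>\<omega>. \<bar>(\<Sum>t=1..int n. R t \<omega>) / sqrt (real n)\<bar>) \<le> sqrt (real n) * e"
proof -
  let ?S = "\<lambda>\<omega>. (\<Sum>t=1..int n. \<bar>R t \<omega>\<bar>) / sqrt (real n)"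
  have S: "integrable M ?S" by (simp add: int)
  have "expectation ?S = (\<Sum>t=1..int n. expectation (\<lambda>\<omega>. \<bar>R t \<omega>\<bar>)) / sqrt (real n)"
    by (simp add: int)
  also have "\<dots> \<le> (\<Sum>t=1..int n. e) / sqrt (real n)"
    by (intro divide_right_mono sum_mono e) auto
  also have "\<dots> = sqrt (real n) * e"
    using \<open>n \<ge> 1\<close> by (simp add: field_simps flip: real_sqrt_mult)
  finally have ES: "expectation ?S \<le> sqrt (real n) * e" .
  have dom: "AE \<omega> in M. \<bar>(\<Sum>t=1..int n. R t \<omega>) / sqrt (real n)\<bar> \<le> ?S \<omega>"
    by (intro AE_I2) (auto intro!: divide_right_mono sum_abs)
  have meas: "(\<lambda>\<omega>. (\<Sum>t=1..int n. R t \<omega>) / sqrt (real n)) \<in> borel_measurable M"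
    using int by (intro borel_measurable_divide borel_measurable_sum) auto
  show "integrable M (\<lambda>\<omega>. (\<Sum>t=1..int n. R t \<omega>) / sqrt (real n))"
    and "expectation (\<lambda>\<omega>. \<bar>(\<Sum>t=1..int n. R t \<omega>) / sqrt (real n)\<bar>) \<le> sqrt (real n) * e"
    using dominated_abs_expectation[OF meas S dom ES] by auto
qed

lemma Markov_strict:
  fixes f :: "'a \<Rightarrow> real"
  assumes [measurable]: "integrable M f" and nonneg: "\<And>\<omega>. 0 \<le> f \<omega>" and b: "expectation f \<le> b" and c: "0 < c"
  shows "measure M {\<omega> \<in> space M. f \<omega> > c} \<le> b / c"
proof -
  have "measure M {\<omega> \<in> space M. f \<omega> > c} \<le> measure M {\<omega> \<in> space M. f \<omega> \<ge> c}"
    by (rule finite_measure_mono) (auto intro: less_imp_le)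
  also have "\<dots> \<le> expectation f / c"
    by (rule integral_Markov_inequality_measure[where A = "{}"]) (use assms in auto)
  also have "\<dots> \<le> b / c" using b c by (simp add: divide_right_mono)
  finally show ?thesis .
qed

end

text \<open>The event \<open>A\<close> may be non-measurable, since non-measurable sets have measure 0 by convention. It allows
covering the event of the theorem by simpler ones without discussing its measurability.\<close>

lemma (in finite_measure) measure_le_of_AE_imp:
  assumes "B \<in> sets M" and "AE \<omega> in M. \<omega> \<in> A \<longrightarrow> \<omega> \<in> B"
  shows "measure M A \<le> measure M B"
proof (cases "A \<in> sets M")
  case True
  show ?thesis by (rule finite_measure_mono_AE) (use assms in auto)
next
  case False
  thus ?thesis by (simp add: measure_notin_sets)
qed

section \<open>The causal representation\<close>

lemma tendsto_trailing_window_sum: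
  fixes g :: "nat \<Rightarrow> real"
  assumes "g \<longlonglongrightarrow> 0"
  shows "(\<lambda>K. \<Sum>k\<in>{K-j..<K}. g k) \<longlonglongrightarrow> 0"
proof -
  have "(\<lambda>K. \<Sum>i=1..j. g (K - i)) \<longlonglongrightarrow> (\<Sum>i=1..j. 0)"
    by (intro tendsto_sum filterlim_compose[OF assms] filterlim_minus_const_nat_at_top)
  moreover have "\<forall>\<^sub>F K in sequentially. (\<Sum>i=1..j. g (K - i)) = (\<Sum>k\<in>{K-j..<K}. g k)"
    using eventually_ge_at_top[of j]
  proof eventually_elim
    case (elim K)
    show ?case
      by (rule sum.reindex_bij_witness[of _ "\<lambda>k. K - k" "\<lambda>i. K - i"]) (use elim in auto)
  qed
  ultimately show ?thesis by (simp add: tendsto_cong)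
qed

context contaminated_ar
begin

lemma
  shows eps_measurable [measurable]: "\<epsilon> t \<in> borel_measurable M"
    and z_measurable [measurable]: "z t \<in> borel_measurable M"
    and xi_measurable [measurable]: "\<xi> t \<in> borel_measurable M"
proof -
  have rv: "\<And>i. random_variable borel ((case_sum \<epsilon> (case_sum z \<xi>)) i)"
    using indep unfolding indep_vars_def by blast
  show "\<epsilon> t \<in> borel_measurable M" using rv[of "Inl t"] by simp
  show "z t \<in> borel_measurable M" using rv[of "Inr (Inl t)"] by simp
  show "\<xi> t \<in> borel_measurable M" using rv[of "Inr (Inr t)"] by simp
qed

declare ar_measurable [measurable]

lemma distr_eps: "distr M borel (\<epsilon> t) = distr M borel (\<epsilon> s)"
  by (rule cdf_unique) (auto simp: innovation_cdf)

lemma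
  shows eps_integrable: "integrable M (\<epsilon> t)"
    and eps_mean: "expectation (\<epsilon> t) = 0"
    and eps_square_integrable: "integrable M (\<lambda>\<omega>. (\<epsilon> t \<omega>)\<^sup>2)"
    and eps_second_moment: "expectation (\<lambda>\<omega>. (\<epsilon> t \<omega>)\<^sup>2) = expectation (\<lambda>\<omega>. (\<epsilon> 1 \<omega>)\<^sup>2)"
    and eps_first_abs_moment: "expectation (\<lambda>\<omega>. \<bar>\<epsilon> t \<omega>\<bar>) = expectation (\<lambda>\<omega>. \<bar>\<epsilon> 1 \<omega>\<bar>)"
proof -
  have int: "integrable M (\<lambda>\<omega>. f (\<epsilon> t \<omega>)) \<longleftrightarrow> integrable M (\<lambda>\<omega>. f (\<epsilon> 1 \<omega>))"
    and eq: "expectation (\<lambda>\<omega>. f (\<epsilon> t \<omega>)) = expectation (\<lambda>\<omega>. f (\<epsilon> 1 \<omega>))"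
    if [measurable]: "f \<in> borel_measurable borel" for f :: "real \<Rightarrow> real"
    using distr_eps[of t 1]
      integrable_distr_eq[of "\<epsilon> t" M borel f] integral_distr[of "\<epsilon> t" M borel f]
      integrable_distr_eq[of "\<epsilon> 1" M borel f] integral_distr[of "\<epsilon> 1" M borel f]
    by auto
  show "integrable M (\<epsilon> t)" using int[of "\<lambda>x. x"] innovation_integrable by simp
  show "expectation (\<epsilon> t) = 0" using eq[of "\<lambda>x. x"] innovation_mean by simp
  show "integrable M (\<lambda>\<omega>. (\<epsilon> t \<omega>)\<^sup>2)"
    using int[of "\<lambda>x. x\<^sup>2"] innovation_square_integrable by simp
  show "expectation (\<lambda>\<omega>. (\<epsilon> t \<omega>)\<^sup>2) = expectation (\<lambda>\<omega>. (\<epsilon> 1 \<omega>)\<^sup>2)"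
    using eq[of "\<lambda>x. x\<^sup>2"] by simp
  show "expectation (\<lambda>\<omega>. \<bar>\<epsilon> t \<omega>\<bar>) = expectation (\<lambda>\<omega>. \<bar>\<epsilon> 1 \<omega>\<bar>)"
    using eq[of "\<lambda>x. \<bar>x\<bar>"] by simp
qed

lemma expectation_of_stationary:
  fixes f :: "real \<Rightarrow> real"
  assumes [measurable]: "f \<in> borel_measurable borel"
  shows "expectation (\<lambda>\<omega>. f (v t \<omega>)) = expectation (\<lambda>\<omega>. f (v 0 \<omega>))"
proof -
  have [measurable]: "(\<lambda>\<omega> s. v (s + k) \<omega>) \<in> measurable M (\<Pi>\<^sub>M t\<in>UNIV. borel)" for k :: int
    by (intro measurable_PiM_single') (auto simp: space_PiM)
  have marg: "expectation (\<lambda>\<omega>. f (v k \<omega>))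
      = (\<integral>y. f (y 0) \<partial>distr M (\<Pi>\<^sub>M t\<in>UNIV. borel) (\<lambda>\<omega> s. v (s + k) \<omega>))" for k :: int
    by (subst integral_distr) auto
  show ?thesis
    using ar_stationary marg[of t] marg[of 0] unfolding strictly_stationary_def by simp
qed

end

locale stable_contaminated_ar = contaminated_ar +
  fixes \<mu> :: real and \<psi> :: "nat \<Rightarrow> real"
  assumes stable: "char_roots_in_unit_disc p \<beta>"
    and level: "\<nu> = (1 - (\<Sum>j=1..p. \<beta> j)) * \<mu>"
    and psi_0: "\<psi> 0 = 1"
    and psi_rec: "\<And>m. m > 0 \<Longrightarrow> \<psi> m = (\<Sum>j=1..p. if j \<le> m then \<beta> j * \<psi> (m - j) else 0)"
    and psi_summable: "summable (\<lambda>k. \<bar>\<psi> k\<bar>)"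
begin

text \<open>The causal moving average \<open>\<Sum>\<^sub>k \<psi>\<^sub>k \<epsilon>\<^sub>t\<^sub>-\<^sub>k\<close>. It agrees almost surely with \<open>v\<^sub>t - \<mu>\<close>, but unlike \<open>v\<^sub>t\<close> it
is a pointwise function of the innovations up to time \<open>t\<close>, hence measurable with respect to the
past of every later time.\<close>

definition V :: "int \<Rightarrow> 'a \<Rightarrow> real" where
  "V t \<omega> = (\<Sum>k. \<psi> k * \<epsilon> (t - int k) \<omega>)"

lemma V_measurable [measurable]: "V t \<in> borel_measurable M"
  unfolding V_def by measurable

lemma centred_recursion:
  "AE \<omega> in M. \<forall>t. v t \<omega> - \<mu> = (\<Sum>j=1..p. \<beta> j * (v (t - int j) \<omega> - \<mu>)) + \<epsilon> t \<omega>"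
proof -
  have "AE \<omega> in M. \<forall>t. v t \<omega> = (\<Sum>j=1..p. \<beta> j * v (t - int j) \<omega>) + \<nu> + \<epsilon> t \<omega>"
    using ar_recursion by (simp add: AE_all_countable)
  thus ?thesis
  proof eventually_elim
    case (elim \<omega>)
    show ?case
    proof
      fix t
      have "v t \<omega> = (\<Sum>j=1..p. \<beta> j * v (t - int j) \<omega>) + \<nu> + \<epsilon> t \<omega>" using elim by blast
      thus "v t \<omega> - \<mu> = (\<Sum>j=1..p. \<beta> j * (v (t - int j) \<omega> - \<mu>)) + \<epsilon> t \<omega>"
        by (simp add: level algebra_simps sum_subtractf sum_distrib_left)
    qed
  qed
qed

text \<open>Iterating the recursion \<open>K\<close> times. The remainder involves only the last \<open>p\<close> of the coefficients
\<open>\<psi>\<^sub>0, \<dots>, \<psi>\<^sub>K\<close>, so it fades as soon as \<open>\<psi>\<^sub>k \<longlonglongrightarrow> 0\<close>.\<close>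

lemma partial_ma_sum:
  fixes u e :: "int \<Rightarrow> real"
  assumes rec: "\<And>t. u t = (\<Sum>j=1..p. \<beta> j * u (t - int j)) + e t"
  shows "(\<Sum>k<Suc K. \<psi> k * e (t - int k))
     = u t - (\<Sum>j=1..p. \<Sum>k\<in>{Suc K-j..<Suc K}. \<beta> j * \<psi> k * u (t - int k - int j))"
proof (induction K)
  case 0
  have "{Suc 0 - j..<Suc 0} = {0}" if "j \<in> {1..p}" for j using that by auto
  hence "(\<Sum>j=1..p. \<Sum>k\<in>{Suc 0-j..<Suc 0}. \<beta> j * \<psi> k * u (t - int k - int j))
      = (\<Sum>j=1..p. \<beta> j * u (t - int j))"
    by (intro sum.cong refl) (simp add: psi_0)
  thus ?case using rec[of t] by (simp add: psi_0)
next
  case (Suc K)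
  let ?L = "Suc K"
  have shift: "(\<Sum>k\<in>{Suc ?L-j..<Suc ?L}. g k)
      = (\<Sum>k\<in>{?L-j..<?L}. g k) + g ?L - (if j \<le> ?L then g (?L - j) else 0)"
    if "j \<in> {1..p}" for j and g :: "nat \<Rightarrow> real"
  proof (cases "j \<le> ?L")
    case True
    have "insert (?L - j) {Suc ?L-j..<Suc ?L} = insert ?L {?L-j..<?L}"
      using that True by auto
    hence "sum g (insert (?L - j) {Suc ?L-j..<Suc ?L}) = sum g (insert ?L {?L-j..<?L})" by simp
    moreover have "?L - j \<notin> {Suc ?L-j..<Suc ?L}" using True by auto
    ultimately show ?thesis using True by simp
  next
    case False
    hence "{Suc ?L-j..<Suc ?L} = insert ?L {?L-j..<?L}" by auto
    thus ?thesis using False by simp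
  qed
  have "(\<Sum>j=1..p. \<Sum>k\<in>{Suc ?L-j..<Suc ?L}. \<beta> j * \<psi> k * u (t - int k - int j))
      = (\<Sum>j=1..p. (\<Sum>k\<in>{?L-j..<?L}. \<beta> j * \<psi> k * u (t - int k - int j))
           + \<psi> ?L * (\<beta> j * u (t - int ?L - int j))
           - (if j \<le> ?L then \<beta> j * \<psi> (?L - j) else 0) * u (t - int ?L))"
  proof (intro sum.cong refl)
    fix j assume j: "j \<in> {1..p}"
    have "t - int (?L - j) - int j = t - int ?L" if "j \<le> ?L" using that by simp
    thus "(\<Sum>k\<in>{Suc ?L-j..<Suc ?L}. \<beta> j * \<psi> k * u (t - int k - int j))
        = (\<Sum>k\<in>{?L-j..<?L}. \<beta> j * \<psi> k * u (t - int k - int j))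
           + \<psi> ?L * (\<beta> j * u (t - int ?L - int j))
           - (if j \<le> ?L then \<beta> j * \<psi> (?L - j) else 0) * u (t - int ?L)"
      unfolding shift[OF j] by (simp del: of_nat_Suc)
  qed
  also have "\<dots> = (\<Sum>j=1..p. \<Sum>k\<in>{?L-j..<?L}. \<beta> j * \<psi> k * u (t - int k - int j))
       + \<psi> ?L * (\<Sum>j=1..p. \<beta> j * u (t - int ?L - int j)) - \<psi> ?L * u (t - int ?L)"
    by (simp only: sum.distrib sum_subtractf sum_distrib_left flip: sum_distrib_right psi_rec[OF zero_less_Suc])
  also have "\<dots> = (\<Sum>j=1..p. \<Sum>k\<in>{?L-j..<?L}. \<beta> j * \<psi> k * u (t - int k - int j)) - \<psi> ?L * e (t - int ?L)"
    using rec[of "t - int ?L"] by (simp add: algebra_simps)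
  finally show ?case using Suc.IH by simp
qed

lemma ma_series_summable: "AE \<omega> in M. summable (\<lambda>k. \<psi> k * \<epsilon> (t - int k) \<omega>)"
proof -
  let ?e = "expectation (\<lambda>\<omega>. \<bar>\<epsilon> 1 \<omega>\<bar>)"
  have "(\<integral>\<^sup>+\<omega>. (\<Sum>k. ennreal \<bar>\<psi> k * \<epsilon> (t - int k) \<omega>\<bar>) \<partial>M)
      = (\<Sum>k. \<integral>\<^sup>+\<omega>. ennreal \<bar>\<psi> k * \<epsilon> (t - int k) \<omega>\<bar> \<partial>M)"
    by (rule nn_integral_suminf) simp
  also have "\<dots> = (\<Sum>k. ennreal (\<bar>\<psi> k\<bar> * ?e))"
  proof (intro suminf_cong)
    fix k
    have "(\<integral>\<^sup>+\<omega>. ennreal \<bar>\<psi> k * \<epsilon> (t - int k) \<omega>\<bar> \<partial>M)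
        = ennreal (expectation (\<lambda>\<omega>. \<bar>\<psi> k * \<epsilon> (t - int k) \<omega>\<bar>))"
      by (rule nn_integral_eq_integral) (auto intro!: eps_integrable)
    also have "\<dots> = ennreal (\<bar>\<psi> k\<bar> * ?e)" by (simp add: abs_mult eps_first_abs_moment[of "t - int k"])
    finally show "(\<integral>\<^sup>+\<omega>. ennreal \<bar>\<psi> k * \<epsilon> (t - int k) \<omega>\<bar> \<partial>M) = ennreal (\<bar>\<psi> k\<bar> * ?e)" .
  qed
  also have "\<dots> = ennreal (\<Sum>k. \<bar>\<psi> k\<bar> * ?e)"
    by (rule suminf_ennreal2) (auto intro!: summable_mult2 psi_summable)
  finally have "(\<integral>\<^sup>+\<omega>. (\<Sum>k. ennreal \<bar>\<psi> k * \<epsilon> (t - int k) \<omega>\<bar>) \<partial>M) \<noteq> \<infinity>" by simp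
  hence "AE \<omega> in M. (\<Sum>k. ennreal \<bar>\<psi> k * \<epsilon> (t - int k) \<omega>\<bar>) \<noteq> \<infinity>"
    by (intro nn_integral_PInf_AE) auto
  thus ?thesis
  proof eventually_elim
    case (elim \<omega>)
    have "summable (\<lambda>k. \<bar>\<psi> k * \<epsilon> (t - int k) \<omega>\<bar>)"
      by (rule summable_suminf_not_top) (use elim in auto)
    thus ?case by (rule summable_rabs_cancel)
  qed
qed

text \<open>By stationarity each variable \<open>u\<^sub>t\<^sub>-\<^sub>k\<^sub>-\<^sub>j\<close> in the remainder of the iterated recursion has the law of \<open>u\<^sub>0\<close>,
while its coefficient tends to 0; hence the remainder tends to 0 in probability. Nothing is known
about moments of \<open>v\<^sub>t\<close>, so convergence in probability is measured by the mean of \<open>min 1 \<bar>\<cdot>\<bar>\<close>.\<close>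

theorem causal_representation: "AE \<omega> in M. v t \<omega> - \<mu> = V t \<omega>"
proof -
  define u where "u s \<omega> = v s \<omega> - \<mu>" for s \<omega>
  define S where "S K \<omega> = (\<Sum>k<K. \<psi> k * \<epsilon> (t - int k) \<omega>)" for K \<omega>
  define m where "m c = expectation (\<lambda>\<omega>. min 1 (\<bar>c\<bar> * \<bar>u 0 \<omega>\<bar>))" for c
  have [measurable]: "u s \<in> borel_measurable M" "S K \<in> borel_measurable M" for s K
    unfolding u_def S_def by measurable
  have bdd: "integrable M (\<lambda>\<omega>. min 1 \<bar>f \<omega>\<bar>)" if [measurable]: "f \<in> borel_measurable M" for f :: "'a \<Rightarrow> real"
    by (rule integrable_const_bound[of _ 1]) auto
  have m_shift: "expectation (\<lambda>\<omega>. min 1 \<bar>c * u s \<omega>\<bar>) = m c" for c s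
    using expectation_of_stationary[of "\<lambda>x. min 1 \<bar>c * (x - \<mu>)\<bar>" s] by (simp add: m_def u_def abs_mult)
  have m_lim: "(\<lambda>k. m (c * \<psi> k)) \<longlonglongrightarrow> 0" for c
  proof -
    have "\<psi> \<longlonglongrightarrow> 0" by (rule summable_LIMSEQ_zero[OF summable_rabs_cancel[OF psi_summable]])
    hence lim: "(\<lambda>k. min 1 (\<bar>c * \<psi> k\<bar> * \<bar>u 0 \<omega>\<bar>)) \<longlonglongrightarrow> min 1 (\<bar>c * 0\<bar> * \<bar>u 0 \<omega>\<bar>)" for \<omega>
      by (intro tendsto_min tendsto_mult tendsto_rabs tendsto_const)
    have "(\<lambda>k. m (c * \<psi> k)) \<longlonglongrightarrow> expectation (\<lambda>\<omega>. min 1 (\<bar>c * 0\<bar> * \<bar>u 0 \<omega>\<bar>))"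
      unfolding m_def
      by (rule integral_dominated_convergence[where w = "\<lambda>_. 1"]) (use lim in auto)
    thus ?thesis by simp
  qed
  define r where "r K = (\<Sum>j=1..p. \<Sum>k\<in>{K-j..<K}. m (\<beta> j * \<psi> k))" for K
  have "r \<longlonglongrightarrow> (\<Sum>j=1..p. 0)"
    unfolding r_def by (intro tendsto_sum tendsto_trailing_window_sum m_lim)
  hence r_lim: "(\<lambda>K. r (Suc K)) \<longlonglongrightarrow> 0" by (simp add: LIMSEQ_Suc)
  \<comment> \<open>\<open>min 1 \<bar>\<cdot>\<bar>\<close> is subadditive, so it can stand in for a norm\<close>
  have min_add: "min 1 \<bar>a + b\<bar> \<le> min 1 \<bar>a\<bar> + min 1 \<bar>b\<bar>" for a b :: real by linarith
  have min_sum: "min 1 \<bar>\<Sum>i\<in>A. f i\<bar> \<le> (\<Sum>i\<in>A. min 1 \<bar>f i\<bar>)" if "finite A"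
    for A :: "nat set" and f :: "nat \<Rightarrow> real"
    using that
  proof (induction A rule: finite_induct)
    case (insert x A)
    thus ?case using min_add[of "f x" "sum f A"] by simp
  qed simp
  have remainder: "expectation (\<lambda>\<omega>. min 1 \<bar>u t \<omega> - S (Suc K) \<omega>\<bar>) \<le> r (Suc K)" for K
  proof -
    have "expectation (\<lambda>\<omega>. min 1 \<bar>u t \<omega> - S (Suc K) \<omega>\<bar>)
       \<le> expectation (\<lambda>\<omega>. \<Sum>j=1..p. \<Sum>k\<in>{Suc K-j..<Suc K}. min 1 \<bar>(\<beta> j * \<psi> k) * u (t - int k - int j) \<omega>\<bar>)"
    proof (rule integral_mono_AE)
      show "AE \<omega> in M. min 1 \<bar>u t \<omega> - S (Suc K) \<omega>\<bar>
        \<le> (\<Sum>j=1..p. \<Sum>k\<in>{Suc K-j..<Suc K}. min 1 \<bar>(\<beta> j * \<psi> k) * u (t - int k - int j) \<omega>\<bar>)"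
        using centred_recursion
      proof eventually_elim
        case (elim \<omega>)
        have rec: "u s \<omega> = (\<Sum>j=1..p. \<beta> j * u (s - int j) \<omega>) + \<epsilon> s \<omega>" for s
          using elim unfolding u_def by blast
        have "u t \<omega> - S (Suc K) \<omega>
           = (\<Sum>j=1..p. \<Sum>k\<in>{Suc K-j..<Suc K}. \<beta> j * \<psi> k * u (t - int k - int j) \<omega>)"
          unfolding S_def
          by (subst partial_ma_sum[of "\<lambda>s. u s \<omega>" "\<lambda>s. \<epsilon> s \<omega>", OF rec]) (simp only: diff_diff_eq2 add_diff_cancel_left')
        moreover have "min 1 \<bar>\<Sum>j=1..p. \<Sum>k\<in>{Suc K-j..<Suc K}. \<beta> j * \<psi> k * u (t - int k - int j) \<omega>\<bar>
           \<le> (\<Sum>j=1..p. min 1 \<bar>\<Sum>k\<in>{Suc K-j..<Suc K}. \<beta> j * \<psi> k * u (t - int k - int j) \<omega>\<bar>)"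
          by (rule min_sum) simp
        moreover have "\<dots> \<le> (\<Sum>j=1..p. \<Sum>k\<in>{Suc K-j..<Suc K}. min 1 \<bar>(\<beta> j * \<psi> k) * u (t - int k - int j) \<omega>\<bar>)"
          by (intro sum_mono min_sum) simp
        ultimately show ?case by linarith
      qed
    next
      show "integrable M (\<lambda>\<omega>. min 1 \<bar>u t \<omega> - S (Suc K) \<omega>\<bar>)" by (rule bdd) measurable
      show "integrable M (\<lambda>\<omega>. \<Sum>j=1..p. \<Sum>k\<in>{Suc K-j..<Suc K}. min 1 \<bar>(\<beta> j * \<psi> k) * u (t - int k - int j) \<omega>\<bar>)"
        by (intro Bochner_Integration.integrable_sum bdd) measurable
    qed
    also have "\<dots> = (\<Sum>j=1..p. \<Sum>k\<in>{Suc K-j..<Suc K}.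
        expectation (\<lambda>\<omega>. min 1 \<bar>(\<beta> j * \<psi> k) * u (t - int k - int j) \<omega>\<bar>))"
      by (subst Bochner_Integration.integral_sum;
          (intro Bochner_Integration.integrable_sum bdd sum.cong refl Bochner_Integration.integral_sum; measurable)?)
    also have "\<dots> = r (Suc K)"
      unfolding m_shift r_def ..
    finally show ?thesis .
  qed
  have tail_lim: "(\<lambda>K. expectation (\<lambda>\<omega>. min 1 \<bar>S (Suc K) \<omega> - V t \<omega>\<bar>)) \<longlonglongrightarrow> expectation (\<lambda>\<omega>. min 1 \<bar>0::real\<bar>)"
  proof (rule integral_dominated_convergence[where w = "\<lambda>_. 1"])
    show "AE \<omega> in M. (\<lambda>K. min 1 \<bar>S (Suc K) \<omega> - V t \<omega>\<bar>) \<longlonglongrightarrow> min 1 \<bar>0\<bar>"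
      using ma_series_summable[of t]
    proof eventually_elim
      case (elim \<omega>)
      hence "(\<lambda>K. S K \<omega>) \<longlonglongrightarrow> V t \<omega>" unfolding S_def V_def by (rule summable_LIMSEQ)
      hence "(\<lambda>K. S (Suc K) \<omega>) \<longlonglongrightarrow> V t \<omega>" by (rule LIMSEQ_Suc)
      hence "(\<lambda>K. S (Suc K) \<omega> - V t \<omega>) \<longlonglongrightarrow> 0" by (rule LIM_zero)
      thus ?case by (intro tendsto_min tendsto_const tendsto_rabs)
    qed
  qed auto
  have "expectation (\<lambda>\<omega>. min 1 \<bar>u t \<omega> - V t \<omega>\<bar>)
      \<le> r (Suc K) + expectation (\<lambda>\<omega>. min 1 \<bar>S (Suc K) \<omega> - V t \<omega>\<bar>)" for K
  proof -
    have "expectation (\<lambda>\<omega>. min 1 \<bar>u t \<omega> - V t \<omega>\<bar>)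
        \<le> expectation (\<lambda>\<omega>. min 1 \<bar>u t \<omega> - S (Suc K) \<omega>\<bar> + min 1 \<bar>S (Suc K) \<omega> - V t \<omega>\<bar>)"
    proof (rule integral_mono)
      show "min 1 \<bar>u t \<omega> - V t \<omega>\<bar> \<le> min 1 \<bar>u t \<omega> - S (Suc K) \<omega>\<bar> + min 1 \<bar>S (Suc K) \<omega> - V t \<omega>\<bar>" for \<omega>
        using min_add[of "u t \<omega> - S (Suc K) \<omega>" "S (Suc K) \<omega> - V t \<omega>"] by simp
    qed (auto intro!: bdd)
    also have "\<dots> = expectation (\<lambda>\<omega>. min 1 \<bar>u t \<omega> - S (Suc K) \<omega>\<bar>) + expectation (\<lambda>\<omega>. min 1 \<bar>S (Suc K) \<omega> - V t \<omega>\<bar>)"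
      by (intro Bochner_Integration.integral_add bdd) auto
    finally show ?thesis using remainder[of K] by linarith
  qed
  moreover have "(\<lambda>K. r (Suc K) + expectation (\<lambda>\<omega>. min 1 \<bar>S (Suc K) \<omega> - V t \<omega>\<bar>)) \<longlonglongrightarrow> 0 + 0"
    using tail_lim by (intro tendsto_add r_lim) simp
  ultimately have "expectation (\<lambda>\<omega>. min 1 \<bar>u t \<omega> - V t \<omega>\<bar>) \<le> 0"
    by (intro LIMSEQ_le_const) auto
  moreover have "expectation (\<lambda>\<omega>. min 1 \<bar>u t \<omega> - V t \<omega>\<bar>) \<ge> 0"
    by (intro integral_nonneg_AE) auto
  ultimately have "expectation (\<lambda>\<omega>. min 1 \<bar>u t \<omega> - V t \<omega>\<bar>) = 0" by linarith
  hence "AE \<omega> in M. min 1 \<bar>u t \<omega> - V t \<omega>\<bar> = 0"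
    by (subst (asm) integral_nonneg_eq_0_iff_AE) (auto intro!: bdd)
  thus ?thesis by eventually_elim (auto simp: u_def min_def split: if_splits)
qed

end

section \<open>Innovations are independent of the past\<close>

context contaminated_ar
begin

abbreviation (input) noise :: "int + int + int \<Rightarrow> 'a \<Rightarrow> real" where
  "noise \<equiv> case_sum \<epsilon> (case_sum z \<xi>)"

definition past_indices :: "int \<Rightarrow> (int + int + int) set" where
  "past_indices t = - (Inl ` {t..})"

text \<open>The information available before the innovation \<open>\<epsilon>\<^sub>t\<close> is drawn: all earlier innovations together with
the whole contamination, past and future.\<close>

definition past :: "int \<Rightarrow> 'a measure" where
  "past t = vimage_algebra (space M) (\<lambda>\<omega>. restrict (\<lambda>i. noise i \<omega>) (past_indices t))
              (PiM (past_indices t) (\<lambda>_. borel))"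

lemma noise_measurable: "noise i \<in> borel_measurable M"
  using indep unfolding indep_vars_def by blast

lemma noise_measurable_past:
  assumes "i \<in> past_indices t"
  shows "noise i \<in> borel_measurable (past t)"
proof -
  have "(\<lambda>\<omega>. restrict (\<lambda>i. noise i \<omega>) (past_indices t)) \<in> measurable (past t) (PiM (past_indices t) (\<lambda>_. borel))"
    unfolding past_def by (rule measurable_vimage_algebra1) (auto simp: space_PiM)
  from measurable_compose[OF this measurable_component_singleton[OF assms]]
  show ?thesis using assms by simp
qed

lemma
  shows eps_measurable_past [measurable]: "s < t \<Longrightarrow> \<epsilon> s \<in> borel_measurable (past t)"
    and z_measurable_past [measurable]: "z s \<in> borel_measurable (past t)"
    and xi_measurable_past [measurable]: "\<xi> s \<in> borel_measurable (past t)"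
  using noise_measurable_past[of "Inl s" t] noise_measurable_past[of "Inr (Inl s)" t]
    noise_measurable_past[of "Inr (Inr s)" t]
  by (auto simp: past_indices_def image_iff)

lemma space_past [simp]: "space (past t) = space M"
  by (simp add: past_def)

lemma measurable_past_mono:
  assumes "s \<le> t" "f \<in> measurable (past s) N"
  shows "f \<in> measurable (past t) N"
proof -
  have "(\<lambda>\<omega>. \<omega>) \<in> measurable (past t) (past s)"
    unfolding past_def[of s]
  proof (rule measurable_vimage_algebra2)
    show "(\<lambda>\<omega>. restrict (\<lambda>i. noise i \<omega>) (past_indices s)) \<in> measurable (past t) (PiM (past_indices s) (\<lambda>_. borel))"
      using assms(1) by (intro measurable_restrict noise_measurable_past) (auto simp: past_indices_def)
  qed simp
  from measurable_compose[OF this assms(2)] show ?thesis .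
qed

lemma measurable_past_imp_measurable:
  assumes "f \<in> measurable (past t) N"
  shows "f \<in> measurable M N"
proof -
  have "(\<lambda>\<omega>. \<omega>) \<in> measurable M (past t)"
    unfolding past_def
    by (intro measurable_vimage_algebra2 measurable_restrict noise_measurable) simp
  from measurable_compose[OF this assms] show ?thesis .
qed

text \<open>Pairs occur on both sides, with a dummy second component on the right, because \<open>indep_var\<close> relates
variables of one type and the left variable has to carry two past quantities.\<close>

lemma past_indep_eps:
  assumes Y: "Y \<in> measurable (past t) (borel \<Otimes>\<^sub>M borel)"
  shows "indep_var (borel \<Otimes>\<^sub>M borel) Y (borel \<Otimes>\<^sub>M borel) (\<lambda>\<omega>. (\<epsilon> t \<omega>, 0::real))"
proof (rule indep_var_of_generated)
  show "indep_var
      (PiM (past_indices t) (\<lambda>_. borel)) (\<lambda>\<omega>. restrict (\<lambda>i. noise i \<omega>) (past_indices t))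
      (PiM {Inl t} (\<lambda>_. borel)) (\<lambda>\<omega>. restrict (\<lambda>i. noise i \<omega>) {Inl t})"
    by (rule indep_var_restrict[OF indep]) (auto simp: past_indices_def)
  show "Y \<in> measurable (vimage_algebra (space M) (\<lambda>\<omega>. restrict (\<lambda>i. noise i \<omega>) (past_indices t))
              (PiM (past_indices t) (\<lambda>_. borel))) (borel \<Otimes>\<^sub>M borel)"
    using Y unfolding past_def .
  let ?F = "vimage_algebra (space M) (\<lambda>\<omega>. restrict (\<lambda>i. noise i \<omega>) {Inl t}) (PiM {Inl t} (\<lambda>_. borel))"
  have "(\<lambda>\<omega>. restrict (\<lambda>i. noise i \<omega>) {Inl t}) \<in> measurable ?F (PiM {Inl t} (\<lambda>_. borel))"
    by (rule measurable_vimage_algebra1) (auto simp: space_PiM)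
  from measurable_compose[OF this measurable_component_singleton[of "Inl t"]]
  have "\<epsilon> t \<in> borel_measurable ?F" by simp
  thus "(\<lambda>\<omega>. (\<epsilon> t \<omega>, 0)) \<in> measurable ?F (borel \<Otimes>\<^sub>M borel)" by simp
qed

text \<open>Freezing lemma: quantities known from the past may be held fixed while the expectation over \<open>\<epsilon>\<^sub>t\<close> is
taken, since the joint law is a product measure.\<close>

lemma expectation_freeze_past:
  fixes g :: "(real \<times> real) \<times> real \<Rightarrow> real"
  assumes W: "W \<in> borel_measurable (past t)" and T: "T \<in> borel_measurable (past t)"
    and g [measurable]: "g \<in> borel_measurable ((borel \<Otimes>\<^sub>M borel) \<Otimes>\<^sub>M borel)"
    and bdd: "\<And>y. \<bar>g y\<bar> \<le> C"
  shows "expectation (\<lambda>\<omega>. g ((W \<omega>, T \<omega>), \<epsilon> t \<omega>))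
       = expectation (\<lambda>\<omega>. \<integral>e. g ((W \<omega>, T \<omega>), e) \<partial>distr M borel (\<epsilon> t))"
proof -
  let ?Y = "\<lambda>\<omega>. (W \<omega>, T \<omega>)"
  let ?N = "borel \<Otimes>\<^sub>M borel :: (real \<times> real) measure"
  have Y: "?Y \<in> measurable (past t) ?N" using W T by simp
  have Y' [measurable]: "?Y \<in> measurable M ?N" by (rule measurable_past_imp_measurable[OF Y])
  let ?D = "distr M ?N ?Y" and ?E = "distr M ?N (\<lambda>\<omega>. (\<epsilon> t \<omega>, 0))"
  interpret D: prob_space ?D by (rule prob_space_distr) simp
  interpret E: prob_space ?E by (rule prob_space_distr) simp
  interpret DE: pair_prob_space ?D ?E ..
  have joint: "distr M (?N \<Otimes>\<^sub>M ?N) (\<lambda>\<omega>. (?Y \<omega>, (\<epsilon> t \<omega>, 0))) = ?D \<Otimes>\<^sub>M ?E"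
    using past_indep_eps[OF Y] unfolding indep_var_distribution_eq by simp
  define g' where "g' = (\<lambda>(y :: real \<times> real, e :: real \<times> real). g (y, fst e))"
  have [measurable]: "g' \<in> borel_measurable (?N \<Otimes>\<^sub>M ?N)" unfolding g'_def by measurable
  have int: "integrable (?D \<Otimes>\<^sub>M ?E) g'"
    by (rule DE.integrable_const_bound[of _ C]) (use bdd in \<open>auto simp: g'_def\<close>)
  have "expectation (\<lambda>\<omega>. g (?Y \<omega>, \<epsilon> t \<omega>))
      = (\<integral>y. g' y \<partial>distr M (?N \<Otimes>\<^sub>M ?N) (\<lambda>\<omega>. (?Y \<omega>, (\<epsilon> t \<omega>, 0))))"
    by (subst integral_distr) (auto simp: g'_def)
  also have "\<dots> = (\<integral>y. \<integral>e. g' (y, e) \<partial>?E \<partial>?D)"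
    unfolding joint by (rule DE.integral_fst'[symmetric, OF int])
  also have "\<dots> = expectation (\<lambda>\<omega>. \<integral>e. g' (?Y \<omega>, e) \<partial>?E)"
    by (rule integral_distr) (auto intro!: E.borel_measurable_lebesgue_integral)
  also have "\<dots> = expectation (\<lambda>\<omega>. \<integral>e. g (?Y \<omega>, e) \<partial>distr M borel (\<epsilon> t))"
  proof (intro Bochner_Integration.integral_cong refl)
    fix \<omega> assume [simp]: "\<omega> \<in> space M"
    have [measurable]: "(\<lambda>e. g' (?Y \<omega>, e)) \<in> borel_measurable ?N"
        "(\<lambda>e. g (?Y \<omega>, e)) \<in> borel_measurable borel"
      by (auto intro!: measurable_Pair1' measurable_compose[OF measurable_Pair1'[of "?Y \<omega>"]] simp: space_pair_measure)
    show "(\<integral>e. g' (?Y \<omega>, e) \<partial>?E) = (\<integral>e. g (?Y \<omega>, e) \<partial>distr M borel (\<epsilon> t))"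
      by (subst (1 2) integral_distr) (auto simp: g'_def)
  qed
  finally show ?thesis .
qed

lemma G_bounds: "0 \<le> G x" "G x \<le> 1" 
  and G_mono: "x \<le> y \<Longrightarrow> G x \<le> G y"
  and G_measurable [measurable]: "G \<in> borel_measurable borel"
proof -
  interpret E: real_distribution "distr M borel (\<epsilon> 1)" by simp
  have G: "G = cdf (distr M borel (\<epsilon> 1))" by (simp add: innovation_cdf)
  show "0 \<le> G x" "G x \<le> 1" and mono: "\<And>x y. x \<le> y \<Longrightarrow> G x \<le> G y"
    unfolding G by (auto intro: E.cdf_nonneg E.cdf_bounded_prob E.cdf_nondecreasing)
  show "G \<in> borel_measurable borel" by (rule borel_measurable_mono) (simp add: mono_def mono)
qed

lemma integral_indicator_eps:
  "(\<integral>e. of_bool (e \<le> a) \<partial>distr M borel (\<epsilon> t)) = G a"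
proof -
  interpret E: real_distribution "distr M borel (\<epsilon> t)" by simp
  have "(\<integral>e. of_bool (e \<le> a) \<partial>distr M borel (\<epsilon> t)) = (\<integral>e. indicator {..a} e \<partial>distr M borel (\<epsilon> t))"
    by (intro Bochner_Integration.integral_cong) (auto simp: indicator_def)
  also have "\<dots> = G a" by (simp add: cdf_def flip: innovation_cdf[of t])
  finally show ?thesis .
qed

text \<open>The change of the indicator caused by moving the threshold from \<open>x\<close> to \<open>x + T\<^sub>t\<close>, minus its conditional
expectation given the past.\<close>

definition compensated :: "real \<Rightarrow> (int \<Rightarrow> 'a \<Rightarrow> real) \<Rightarrow> int \<Rightarrow> 'a \<Rightarrow> real" where
  "compensated x T t \<omega> = (of_bool (\<epsilon> t \<omega> \<le> x + T t \<omega>) - of_bool (\<epsilon> t \<omega> \<le> x)) - (G (x + T t \<omega>) - G x)"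

lemma compensated_bound: "\<bar>compensated x T t \<omega>\<bar> \<le> 2"
  using G_bounds[of x] G_bounds[of "x + T t \<omega>"] unfolding compensated_def by (auto simp: of_bool_def)

lemma compensated_measurable_past:
  assumes T: "T s \<in> borel_measurable (past s)" and "s < t"
  shows "compensated x T s \<in> borel_measurable (past t)"
proof -
  have [measurable]: "T s \<in> borel_measurable (past t)"
    by (rule measurable_past_mono[OF _ T]) (use assms in simp)
  have [measurable]: "\<epsilon> s \<in> borel_measurable (past t)" using assms by simp
  show ?thesis unfolding compensated_def by measurable
qed

lemma compensated_measurable:
  assumes T: "T t \<in> borel_measurable (past t)"
  shows "compensated x T t \<in> borel_measurable M"
  by (rule measurable_past_imp_measurable[OF compensated_measurable_past[where T = T and s = t and t = "t + 1", OF T]]) simp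

lemma compensated_orthogonal_past:
  assumes T: "T t \<in> borel_measurable (past t)"
    and W: "W \<in> borel_measurable (past t)" and bdd: "\<And>\<omega>. \<bar>W \<omega>\<bar> \<le> C"
  shows "expectation (\<lambda>\<omega>. W \<omega> * compensated x T t \<omega>) = 0"
proof -
  interpret E: real_distribution "distr M borel (\<epsilon> t)" by simp
  define h where "h a e = (of_bool (e \<le> x + a) - of_bool (e \<le> x)) - (G (x + a) - G x)" for a e
  \<comment> \<open>clipping makes \<open>g\<close> bounded everywhere; on the range of \<open>W\<close> it changes nothing\<close>
  define g where "g y = max (- C) (min C (fst (fst y))) * h (snd (fst y)) (snd y)" for y
  have C: "C \<ge> 0" using bdd[of undefined] by linarith
  have h_bound: "\<bar>h a e\<bar> \<le> 2" for a e
    using G_bounds[of x] G_bounds[of "x + a"] unfolding h_def by (auto simp: of_bool_def)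
  have h0: "(\<integral>e. h a e \<partial>distr M borel (\<epsilon> t)) = 0" for a
  proof -
    have "integrable (distr M borel (\<epsilon> t)) (\<lambda>e. of_bool (e \<le> b) :: real)" for b
      by (rule E.integrable_const_bound[of _ 1]) auto
    thus ?thesis unfolding h_def by (simp add: integral_indicator_eps E.prob_space[simplified])
  qed
  have "expectation (\<lambda>\<omega>. g ((W \<omega>, T t \<omega>), \<epsilon> t \<omega>))
      = expectation (\<lambda>\<omega>. \<integral>e. g ((W \<omega>, T t \<omega>), e) \<partial>distr M borel (\<epsilon> t))"
  proof (rule expectation_freeze_past[where C = "C * 2", OF W T])
    show "g \<in> borel_measurable ((borel \<Otimes>\<^sub>M borel) \<Otimes>\<^sub>M borel)"
      unfolding g_def h_def by measurable
    show "\<bar>g y\<bar> \<le> C * 2" for y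
      using C h_bound by (auto simp: g_def abs_mult split: prod.split intro!: mult_mono)
  qed
  also have "\<dots> = 0" by (simp add: g_def h0)
  also have "(\<lambda>\<omega>. g ((W \<omega>, T t \<omega>), \<epsilon> t \<omega>)) = (\<lambda>\<omega>. W \<omega> * compensated x T t \<omega>)"
  proof
    fix \<omega>
    have "max (- C) (min C (W \<omega>)) = W \<omega>" using bdd[of \<omega>] by linarith
    thus "g ((W \<omega>, T t \<omega>), \<epsilon> t \<omega>) = W \<omega> * compensated x T t \<omega>"
      by (simp add: g_def h_def compensated_def)
  qed
  finally show ?thesis .
qed

text \<open>The conditional variance is at most the conditional second moment, and a difference of two nested
indicators equals its own square up to sign.\<close>

lemma compensated_second_moment:
  assumes T: "T t \<in> borel_measurable (past t)"
  shows "expectation (\<lambda>\<omega>. (compensated x T t \<omega>)\<^sup>2) \<le> expectation (\<lambda>\<omega>. \<bar>G (x + T t \<omega>) - G x\<bar>)"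
proof -
  interpret E: real_distribution "distr M borel (\<epsilon> t)" by simp
  let ?E = "distr M borel (\<epsilon> t)"
  have [measurable]: "T t \<in> borel_measurable M" by (rule measurable_past_imp_measurable[OF T])
  define I :: "real \<Rightarrow> real \<Rightarrow> real" where "I a e = of_bool (e \<le> x + a) - of_bool (e \<le> x)" for a e
  define g where "g y = (I (snd (fst y)) (snd y) - (G (x + snd (fst y)) - G x))\<^sup>2"
    for y :: "(real \<times> real) \<times> real"
  have ind: "integrable ?E (\<lambda>e. of_bool (e \<le> b) :: real)" for b
    by (rule E.integrable_const_bound[of _ 1]) auto
  have EI: "(\<integral>e. I a e \<partial>?E) = G (x + a) - G x" and intI: "integrable ?E (I a)" for a
    unfolding I_def by (simp_all add: ind integral_indicator_eps)
  have I2: "(I a e)\<^sup>2 = (if a \<ge> 0 then I a e else - I a e)" for a e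
    unfolding I_def by (auto simp: of_bool_def)
  have EI2: "(\<integral>e. (I a e)\<^sup>2 \<partial>?E) = \<bar>G (x + a) - G x\<bar>" and intI2: "integrable ?E (\<lambda>e. (I a e)\<^sup>2)" for a
    using G_mono[of x "x + a"] G_mono[of "x + a" x]
    by (cases "a \<ge> 0"; simp add: I2 EI intI)+
  have var: "(\<integral>e. g ((0, a), e) \<partial>?E) \<le> \<bar>G (x + a) - G x\<bar>" for a
  proof -
    have "(\<integral>e. g ((0, a), e) \<partial>?E) = (\<integral>e. (I a e)\<^sup>2 \<partial>?E) - (\<integral>e. I a e \<partial>?E)\<^sup>2"
      using E.variance_eq[OF intI intI2, of a] by (simp add: g_def EI)
    thus ?thesis by (simp add: EI2)
  qed
  have g_bound: "\<bar>g y\<bar> \<le> 4" for y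
  proof -
    obtain w a e where y: "y = ((w, a), e)" by (metis surj_pair)
    have "\<bar>I a e - (G (x + a) - G x)\<bar> \<le> 2"
      using G_bounds[of x] G_bounds[of "x + a"] unfolding I_def by (auto simp: of_bool_def)
    hence "\<bar>I a e - (G (x + a) - G x)\<bar>\<^sup>2 \<le> 2\<^sup>2" by (intro power_mono) auto
    thus ?thesis by (simp add: y g_def)
  qed
  have "expectation (\<lambda>\<omega>. (compensated x T t \<omega>)\<^sup>2) = expectation (\<lambda>\<omega>. g ((0, T t \<omega>), \<epsilon> t \<omega>))"
    by (simp add: g_def I_def compensated_def)
  also have "\<dots> = expectation (\<lambda>\<omega>. \<integral>e. g ((0, T t \<omega>), e) \<partial>?E)"
    by (rule expectation_freeze_past[where C = 4, OF _ T _ g_bound])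
       (unfold g_def I_def, measurable)
  also have "\<dots> \<le> expectation (\<lambda>\<omega>. \<bar>G (x + T t \<omega>) - G x\<bar>)"
  proof (rule integral_mono')
    show "integrable M (\<lambda>\<omega>. \<bar>G (x + T t \<omega>) - G x\<bar>)"
    proof (rule integrable_const_bound[of _ 1])
      show "AE \<omega> in M. norm \<bar>G (x + T t \<omega>) - G x\<bar> \<le> 1"
        using G_bounds by (intro AE_I2) (smt (verit) real_norm_def)
    qed measurable
  qed (use var in auto)
  finally show ?thesis .
qed

text \<open>The summands are bounded martingale differences: each earlier one is known from the past of the later
one, so they are orthogonal.\<close>

theorem compensated_sum_bound:
  assumes n: "n \<ge> 1"
    and T: "\<And>t. T t \<in> borel_measurable (past t)"
    and b: "\<And>t. t \<in> {1..int n} \<Longrightarrow> expectation (\<lambda>\<omega>. \<bar>G (x + T t \<omega>) - G x\<bar>) \<le> b"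
  shows "expectation (\<lambda>\<omega>. \<bar>(\<Sum>t=1..int n. compensated x T t \<omega>) / sqrt (real n)\<bar>) \<le> sqrt b"
proof (rule normalised_orthogonal_sum_bound[OF n])
  fix t
  show meas: "compensated x T t \<in> borel_measurable M" by (rule compensated_measurable[OF T])
  show "integrable M (\<lambda>\<omega>. (compensated x T t \<omega>)\<^sup>2)"
  proof (rule integrable_const_bound[of _ "2\<^sup>2"])
    show "AE \<omega> in M. norm ((compensated x T t \<omega>)\<^sup>2) \<le> 2\<^sup>2"
      using power_mono[OF compensated_bound[of x T t] abs_ge_zero, where n = 2] by (intro AE_I2) simp
    show "(\<lambda>\<omega>. (compensated x T t \<omega>)\<^sup>2) \<in> borel_measurable M" using meas by measurable
  qed
  show "expectation (\<lambda>\<omega>. (compensated x T t \<omega>)\<^sup>2) \<le> b" if "t \<in> {1..int n}"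
    using compensated_second_moment[where T = T and t = t, OF T] b[OF that] by (rule order_trans)
next
  fix s t :: int assume "s < t"
  thus "expectation (\<lambda>\<omega>. compensated x T s \<omega> * compensated x T t \<omega>) = 0"
    by (intro compensated_orthogonal_past[where C = 2] T compensated_measurable_past compensated_bound)
qed

end

section \<open>Moments and averages of the autoregression\<close>

lemma sum_shift_window:
  fixes g :: "int \<Rightarrow> real"
  shows "(\<Sum>t=1..int n. g (t - 1)) = (\<Sum>t=1..int n. g t) + g 0 - g (int n)"
proof (induction n)
  case (Suc n)
  have "{1..int (Suc n)} = insert (int (Suc n)) {1..int n}" by auto
  thus ?case using Suc by simp
qed simp

definition lagged_sum_constant :: "nat \<Rightarrow> (nat \<Rightarrow> real) \<Rightarrow> real \<Rightarrow> real \<Rightarrow> real" where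
  "lagged_sum_constant p \<beta> S K = 2 * real p * K
     + (sqrt S + (\<Sum>j=1..p. \<bar>\<beta> j\<bar>) * (2 * real p * K)) / \<bar>1 - (\<Sum>j=1..p. \<beta> j)\<bar>"

context stable_contaminated_ar
begin

lemma V_measurable_past [measurable]:
  assumes "s < t" shows "V s \<in> borel_measurable (past t)"
proof -
  have [measurable]: "\<epsilon> (s - int k) \<in> borel_measurable (past t)" for k
    using assms by (intro eps_measurable_past) simp
  show ?thesis unfolding V_def by measurable
qed

text \<open>Partial sums satisfy the bound by Cauchy--Schwarz with weights \<open>\<bar>\<psi>\<^sub>k\<bar>\<close>, and Fatou's lemma carries it
to the limit.\<close>

lemma V_second_moment_nn:
  "(\<integral>\<^sup>+\<omega>. ennreal ((V t \<omega>)\<^sup>2) \<partial>M) \<le> ennreal ((\<Sum>k. \<bar>\<psi> k\<bar>)\<^sup>2 * expectation (\<lambda>\<omega>. (\<epsilon> 1 \<omega>)\<^sup>2))"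
proof -
  define \<Psi> where "\<Psi> = (\<Sum>k. \<bar>\<psi> k\<bar>)"
  let ?s = "expectation (\<lambda>\<omega>. (\<epsilon> 1 \<omega>)\<^sup>2)"
  define S where "S K \<omega> = (\<Sum>k<K. \<psi> k * \<epsilon> (t - int k) \<omega>)" for K \<omega>
  have [measurable]: "S K \<in> borel_measurable M" for K unfolding S_def by measurable
  have partial: "(\<Sum>k<K. \<bar>\<psi> k\<bar>) \<le> \<Psi>" for K
    unfolding \<Psi>_def by (intro sum_le_suminf psi_summable) auto
  have \<Psi>0: "0 \<le> \<Psi>" using partial[of 0] by simp
  have cs: "(S K \<omega>)\<^sup>2 \<le> \<Psi> * (\<Sum>k<K. \<bar>\<psi> k\<bar> * (\<epsilon> (t - int k) \<omega>)\<^sup>2)" for K \<omega>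
  proof -
    have "\<bar>S K \<omega>\<bar> \<le> (\<Sum>k<K. \<bar>\<psi> k\<bar> * \<bar>\<epsilon> (t - int k) \<omega>\<bar>)"
      unfolding S_def by (rule order_trans[OF sum_abs]) (simp add: abs_mult)
    hence "\<bar>S K \<omega>\<bar>\<^sup>2 \<le> (\<Sum>k<K. \<bar>\<psi> k\<bar> * \<bar>\<epsilon> (t - int k) \<omega>\<bar>)\<^sup>2"
      by (intro power_mono) auto
    also have "\<dots> \<le> (\<Sum>k<K. \<bar>\<psi> k\<bar>) * (\<Sum>k<K. \<bar>\<psi> k\<bar> * \<bar>\<epsilon> (t - int k) \<omega>\<bar>\<^sup>2)"
      by (rule weighted_Cauchy_Schwarz) simp
    also have "\<dots> \<le> \<Psi> * (\<Sum>k<K. \<bar>\<psi> k\<bar> * (\<epsilon> (t - int k) \<omega>)\<^sup>2)"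
      unfolding power2_abs by (intro mult_right_mono partial sum_nonneg) auto
    finally show ?thesis by simp
  qed
  have bound: "(\<integral>\<^sup>+\<omega>. ennreal ((S K \<omega>)\<^sup>2) \<partial>M) \<le> ennreal (\<Psi>\<^sup>2 * ?s)" for K
  proof -
    have int: "integrable M (\<lambda>\<omega>. \<Psi> * (\<Sum>k<K. \<bar>\<psi> k\<bar> * (\<epsilon> (t - int k) \<omega>)\<^sup>2))"
      by (intro integrable_closure eps_square_integrable)
    have "(\<integral>\<^sup>+\<omega>. ennreal ((S K \<omega>)\<^sup>2) \<partial>M)
        \<le> (\<integral>\<^sup>+\<omega>. ennreal (\<Psi> * (\<Sum>k<K. \<bar>\<psi> k\<bar> * (\<epsilon> (t - int k) \<omega>)\<^sup>2)) \<partial>M)"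
      by (intro nn_integral_mono ennreal_leI cs)
    also have "\<dots> = ennreal (expectation (\<lambda>\<omega>. \<Psi> * (\<Sum>k<K. \<bar>\<psi> k\<bar> * (\<epsilon> (t - int k) \<omega>)\<^sup>2)))"
      by (rule nn_integral_eq_integral[OF int]) (auto intro!: mult_nonneg_nonneg \<Psi>0 sum_nonneg)
    also have "expectation (\<lambda>\<omega>. \<Psi> * (\<Sum>k<K. \<bar>\<psi> k\<bar> * (\<epsilon> (t - int k) \<omega>)\<^sup>2)) = \<Psi> * (\<Sum>k<K. \<bar>\<psi> k\<bar> * ?s)"
    proof -
      have "expectation (\<lambda>\<omega>. \<Sum>k<K. \<bar>\<psi> k\<bar> * (\<epsilon> (t - int k) \<omega>)\<^sup>2)
          = (\<Sum>k<K. expectation (\<lambda>\<omega>. \<bar>\<psi> k\<bar> * (\<epsilon> (t - int k) \<omega>)\<^sup>2))"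
        by (intro Bochner_Integration.integral_sum integrable_mult_right eps_square_integrable)
      also have "\<dots> = (\<Sum>k<K. \<bar>\<psi> k\<bar> * ?s)"
      proof (intro sum.cong refl)
        fix k
        show "expectation (\<lambda>\<omega>. \<bar>\<psi> k\<bar> * (\<epsilon> (t - int k) \<omega>)\<^sup>2) = \<bar>\<psi> k\<bar> * ?s"
          using eps_second_moment[of "t - int k"] by simp
      qed
      finally show ?thesis by simp
    qed
    also have "\<dots> \<le> \<Psi> * (\<Psi> * ?s)"
      unfolding sum_distrib_right[symmetric]
      by (intro mult_left_mono mult_right_mono partial \<Psi>0) auto
    finally show ?thesis by (simp add: power2_eq_square mult_ac ennreal_leI)
  qed
  have "(\<integral>\<^sup>+\<omega>. ennreal ((V t \<omega>)\<^sup>2) \<partial>M) = (\<integral>\<^sup>+\<omega>. liminf (\<lambda>K. ennreal ((S K \<omega>)\<^sup>2)) \<partial>M)"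
  proof (rule nn_integral_cong_AE)
    show "AE \<omega> in M. ennreal ((V t \<omega>)\<^sup>2) = liminf (\<lambda>K. ennreal ((S K \<omega>)\<^sup>2))"
      using ma_series_summable[of t]
    proof eventually_elim
      case (elim \<omega>)
      hence "(\<lambda>K. S K \<omega>) \<longlonglongrightarrow> V t \<omega>" unfolding S_def V_def by (rule summable_LIMSEQ)
      hence "(\<lambda>K. ennreal ((S K \<omega>)\<^sup>2)) \<longlonglongrightarrow> ennreal ((V t \<omega>)\<^sup>2)"
        by (intro tendsto_ennrealI tendsto_power)
      thus ?case by (intro lim_imp_Liminf[symmetric]) auto
    qed
  qed
  also have "\<dots> \<le> liminf (\<lambda>K. \<integral>\<^sup>+\<omega>. ennreal ((S K \<omega>)\<^sup>2) \<partial>M)"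
    by (rule nn_integral_liminf) simp
  also have "\<dots> \<le> ennreal (\<Psi>\<^sup>2 * ?s)"
    using Liminf_mono[of "\<lambda>K. \<integral>\<^sup>+\<omega>. ennreal ((S K \<omega>)\<^sup>2) \<partial>M" "\<lambda>_. ennreal (\<Psi>\<^sup>2 * ?s)" sequentially] bound
    by (simp add: Liminf_const)
  finally show ?thesis unfolding \<Psi>_def .
qed

lemma
  shows V_square_integrable: "integrable M (\<lambda>\<omega>. (V t \<omega>)\<^sup>2)"
    and V_second_moment: "expectation (\<lambda>\<omega>. (V t \<omega>)\<^sup>2) \<le> (\<Sum>k. \<bar>\<psi> k\<bar>)\<^sup>2 * expectation (\<lambda>\<omega>. (\<epsilon> 1 \<omega>)\<^sup>2)"
    and V_integrable: "integrable M (V t)"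
proof -
  show int: "integrable M (\<lambda>\<omega>. (V t \<omega>)\<^sup>2)"
    by (rule integrableI_bounded) (use V_second_moment_nn[of t] in \<open>auto intro: le_less_trans\<close>)
  show "expectation (\<lambda>\<omega>. (V t \<omega>)\<^sup>2) \<le> (\<Sum>k. \<bar>\<psi> k\<bar>)\<^sup>2 * expectation (\<lambda>\<omega>. (\<epsilon> 1 \<omega>)\<^sup>2)"
    using V_second_moment_nn[of t] innovation_nondegenerate
    by (subst (asm) nn_integral_eq_integral[OF int]) (auto simp: ennreal_le_iff)
  show "integrable M (V t)" by (rule square_integrable_imp_integrable[OF _ int]) simp
qed

lemma V_recursion: "AE \<omega> in M. \<forall>t. V t \<omega> = (\<Sum>j=1..p. \<beta> j * V (t - int j) \<omega>) + \<epsilon> t \<omega>"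
proof -
  have "AE \<omega> in M. \<forall>t. v t \<omega> - \<mu> = V t \<omega>"
    using causal_representation by (simp add: AE_all_countable)
  with centred_recursion show ?thesis
  proof eventually_elim
    case (elim \<omega>)
    show ?case using elim(1) unfolding elim(2)[rule_format] .
  qed
qed

text \<open>Otherwise 1 would be a characteristic root.\<close>

lemma sum_coefficients_neq_1: "(\<Sum>j=1..p. \<beta> j) \<noteq> 1"
proof
  assume "(\<Sum>j=1..p. \<beta> j) = 1"
  hence "(\<Sum>j=1..p. complex_of_real (\<beta> j)) = 1" by (simp flip: of_real_sum)
  hence "cmod 1 < 1" using stable unfolding char_roots_in_unit_disc_def by (metis (no_types, lifting) mult.right_neutral power_one sum.cong)
  thus False by simp
qed

lemma eps_orthogonal:
  assumes "s < t" shows "expectation (\<lambda>\<omega>. \<epsilon> s \<omega> * \<epsilon> t \<omega>) = 0"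
proof -
  have "indep_var borel ((\<lambda>f. f (Inl s)) \<circ> (\<lambda>\<omega>. restrict (\<lambda>i. noise i \<omega>) {Inl s}))
                  borel ((\<lambda>f. f (Inl t)) \<circ> (\<lambda>\<omega>. restrict (\<lambda>i. noise i \<omega>) {Inl t}))"
    by (rule indep_var_compose[OF indep_var_restrict[OF indep]]) (use assms in auto)
  hence "indep_var borel (\<epsilon> s) borel (\<epsilon> t)" by (simp add: comp_def)
  thus ?thesis by (simp add: indep_var_lebesgue_integral eps_integrable eps_mean)
qed

text \<open>Summing the recursion over \<open>t\<close> gives \<open>(1 - \<Sum> \<beta>\<^sub>j) \<Sum> V\<^sub>t = \<Sum> \<epsilon>\<^sub>t\<close> up to boundary terms, which come from
shifting the summation window by at most \<open>p\<close> and are bounded in mean. The sum of the innovations has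
mean modulus of order \<open>\<surd>n\<close>. This replaces a law of large numbers and gives a rate.\<close>

lemma lagged_sum_bound:
  assumes n: "n \<ge> 1" and j: "j \<le> p"
    and K: "\<And>t. expectation (\<lambda>\<omega>. \<bar>V t \<omega>\<bar>) \<le> K" and S: "expectation (\<lambda>\<omega>. (\<epsilon> 1 \<omega>)\<^sup>2) \<le> S"
  shows "expectation (\<lambda>\<omega>. \<bar>\<Sum>t=1..int n. V (t - int j) \<omega>\<bar>)
     \<le> sqrt (real n) * lagged_sum_constant p \<beta> S K"
proof -
  define a where "a j \<omega> = (\<Sum>t=1..int n. V (t - int j) \<omega>)" for j \<omega>
  define e where "e \<omega> = (\<Sum>t=1..int n. \<epsilon> t \<omega>)" for \<omega>
  let ?d = "\<bar>1 - (\<Sum>j=1..p. \<beta> j)\<bar>"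
  let ?b = "\<Sum>j=1..p. \<bar>\<beta> j\<bar>"
  have K0: "K \<ge> 0" using order_trans[OF _ K[of 0], of 0] by simp
  have d: "?d > 0" using sum_coefficients_neq_1 by simp
  have sn: "sqrt (real n) \<ge> 1" using n by simp
  have [simp]: "integrable M (a j)" "integrable M e" for j
    unfolding a_def e_def by (auto intro!: Bochner_Integration.integrable_sum V_integrable eps_integrable)
  have step: "a (Suc j) \<omega> - a j \<omega> = V (- int j) \<omega> - V (int n - int j) \<omega>" for j \<omega>
  proof -
    have "a (Suc j) \<omega> = (\<Sum>t=1..int n. V ((t - 1) - int j) \<omega>)"
      unfolding a_def by (simp add: algebra_simps)
    also have "\<dots> = a j \<omega> + V (0 - int j) \<omega> - V (int n - int j) \<omega>"
      unfolding a_def by (rule sum_shift_window[of "\<lambda>t. V (t - int j) \<omega>"])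
    finally show ?thesis by simp
  qed
  have shift: "expectation (\<lambda>\<omega>. \<bar>a j \<omega> - a 0 \<omega>\<bar>) \<le> 2 * real j * K" for j
  proof (induction j)
    case (Suc j)
    have "expectation (\<lambda>\<omega>. \<bar>a (Suc j) \<omega> - a 0 \<omega>\<bar>)
        \<le> expectation (\<lambda>\<omega>. \<bar>a j \<omega> - a 0 \<omega>\<bar> + \<bar>V (- int j) \<omega>\<bar> + \<bar>V (int n - int j) \<omega>\<bar>)"
    proof (rule integral_mono)
      show "\<bar>a (Suc j) \<omega> - a 0 \<omega>\<bar> \<le> \<bar>a j \<omega> - a 0 \<omega>\<bar> + \<bar>V (- int j) \<omega>\<bar> + \<bar>V (int n - int j) \<omega>\<bar>" for \<omega>
        using step[of j \<omega>] by linarith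
    qed (simp_all add: V_integrable)
    also have "\<dots> = expectation (\<lambda>\<omega>. \<bar>a j \<omega> - a 0 \<omega>\<bar>) + expectation (\<lambda>\<omega>. \<bar>V (- int j) \<omega>\<bar>)
        + expectation (\<lambda>\<omega>. \<bar>V (int n - int j) \<omega>\<bar>)"
      by (simp add: V_integrable)
    also have "\<dots> \<le> 2 * real (Suc j) * K"
      using Suc K[of "- int j"] K[of "int n - int j"] by (simp add: algebra_simps)
    finally show ?case .
  qed simp
  have e_bound: "expectation (\<lambda>\<omega>. \<bar>e \<omega>\<bar>) \<le> sqrt (real n) * sqrt S"
  proof -
    have "expectation (\<lambda>\<omega>. \<bar>e \<omega> / sqrt (real n)\<bar>) \<le> sqrt S"
      unfolding e_def
    proof (rule normalised_orthogonal_sum_bound[OF n])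
      fix t show "expectation (\<lambda>\<omega>. (\<epsilon> t \<omega>)\<^sup>2) \<le> S" using eps_second_moment[of t] S by linarith
    qed (auto intro!: eps_square_integrable eps_orthogonal)
    thus ?thesis using n by (simp add: field_simps)
  qed
  have "?d * expectation (\<lambda>\<omega>. \<bar>a 0 \<omega>\<bar>) \<le> expectation (\<lambda>\<omega>. \<bar>e \<omega>\<bar> + (\<Sum>j=1..p. \<bar>\<beta> j\<bar> * \<bar>a j \<omega> - a 0 \<omega>\<bar>))"
  proof -
    have "AE \<omega> in M. ?d * \<bar>a 0 \<omega>\<bar> \<le> \<bar>e \<omega>\<bar> + (\<Sum>j=1..p. \<bar>\<beta> j\<bar> * \<bar>a j \<omega> - a 0 \<omega>\<bar>)"
      using V_recursion
    proof eventually_elim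
      case (elim \<omega>)
      have "a 0 \<omega> = (\<Sum>t=1..int n. (\<Sum>j=1..p. \<beta> j * V (t - int j) \<omega>) + \<epsilon> t \<omega>)"
        unfolding a_def of_nat_0 diff_0_right by (intro sum.cong refl elim[rule_format])
      also have "\<dots> = (\<Sum>j=1..p. \<beta> j * a j \<omega>) + e \<omega>"
        unfolding a_def e_def sum.distrib sum_distrib_left by (subst sum.swap) simp
      finally have a0: "a 0 \<omega> = (\<Sum>j=1..p. \<beta> j * a j \<omega>) + e \<omega>" .
      have split: "(\<Sum>j=1..p. \<beta> j * (a j \<omega> - a 0 \<omega>)) = (\<Sum>j=1..p. \<beta> j * a j \<omega>) - (\<Sum>j=1..p. \<beta> j) * a 0 \<omega>"
        by (simp add: right_diff_distrib sum_subtractf sum_distrib_right)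
      have "(1 - (\<Sum>j=1..p. \<beta> j)) * a 0 \<omega> = e \<omega> + (\<Sum>j=1..p. \<beta> j * (a j \<omega> - a 0 \<omega>))"
        unfolding split left_diff_distrib using a0 by linarith
      hence "?d * \<bar>a 0 \<omega>\<bar> = \<bar>e \<omega> + (\<Sum>j=1..p. \<beta> j * (a j \<omega> - a 0 \<omega>))\<bar>"
        by (simp flip: abs_mult)
      also have "\<dots> \<le> \<bar>e \<omega>\<bar> + (\<Sum>j=1..p. \<bar>\<beta> j * (a j \<omega> - a 0 \<omega>)\<bar>)"
        by (intro order_trans[OF abs_triangle_ineq] add_left_mono sum_abs)
      finally show ?case by (simp add: abs_mult)
    qed
    hence "expectation (\<lambda>\<omega>. ?d * \<bar>a 0 \<omega>\<bar>) \<le> expectation (\<lambda>\<omega>. \<bar>e \<omega>\<bar> + (\<Sum>j=1..p. \<bar>\<beta> j\<bar> * \<bar>a j \<omega> - a 0 \<omega>\<bar>))"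
      by (intro integral_mono_AE) auto
    thus ?thesis by simp
  qed
  also have "\<dots> = expectation (\<lambda>\<omega>. \<bar>e \<omega>\<bar>) + (\<Sum>j=1..p. \<bar>\<beta> j\<bar> * expectation (\<lambda>\<omega>. \<bar>a j \<omega> - a 0 \<omega>\<bar>))"
    by (subst Bochner_Integration.integral_add) auto
  also have "\<dots> \<le> sqrt (real n) * sqrt S + (\<Sum>j=1..p. \<bar>\<beta> j\<bar> * (2 * real p * K))"
  proof (intro add_mono e_bound sum_mono mult_left_mono)
    fix j assume "j \<in> {1..p}"
    hence "2 * real j * K \<le> 2 * real p * K" using K0 by (intro mult_right_mono) auto
    thus "expectation (\<lambda>\<omega>. \<bar>a j \<omega> - a 0 \<omega>\<bar>) \<le> 2 * real p * K" using shift[of j] by linarith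
  qed auto
  also have "\<dots> \<le> sqrt (real n) * sqrt S + sqrt (real n) * (?b * (2 * real p * K))"
  proof -
    have "1 * (?b * (2 * real p * K)) \<le> sqrt (real n) * (?b * (2 * real p * K))"
      using sn K0 by (intro mult_right_mono mult_nonneg_nonneg sum_nonneg) auto
    thus ?thesis by (simp add: sum_distrib_right)
  qed
  finally have "expectation (\<lambda>\<omega>. \<bar>a 0 \<omega>\<bar>) \<le> sqrt (real n) * ((sqrt S + ?b * (2 * real p * K)) / ?d)"
    using d by (simp add: field_simps)
  moreover have "expectation (\<lambda>\<omega>. \<bar>a j \<omega>\<bar>) \<le> expectation (\<lambda>\<omega>. \<bar>a j \<omega> - a 0 \<omega>\<bar>) + expectation (\<lambda>\<omega>. \<bar>a 0 \<omega>\<bar>)"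
  proof -
    have "expectation (\<lambda>\<omega>. \<bar>a j \<omega>\<bar>) \<le> expectation (\<lambda>\<omega>. \<bar>a j \<omega> - a 0 \<omega>\<bar> + \<bar>a 0 \<omega>\<bar>)"
      by (rule integral_mono) auto
    thus ?thesis by simp
  qed
  moreover have "2 * real j * K \<le> sqrt (real n) * (2 * real p * K)"
  proof -
    have "2 * real j * K \<le> 1 * (2 * real p * K)" using j K0 by (simp add: mult_right_mono)
    also have "\<dots> \<le> sqrt (real n) * (2 * real p * K)" using sn K0 by (intro mult_right_mono) auto
    finally show ?thesis .
  qed
  ultimately have "expectation (\<lambda>\<omega>. \<bar>a j \<omega>\<bar>)
      \<le> sqrt (real n) * (2 * real p * K) + sqrt (real n) * ((sqrt S + ?b * (2 * real p * K)) / ?d)"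
    using shift[of j] by linarith
  thus ?thesis unfolding a_def lagged_sum_constant_def by (simp add: algebra_simps)
qed

end

section \<open>The contamination\<close>

context contaminated_ar
begin

definition outlier :: "int \<Rightarrow> 'a \<Rightarrow> real" where "outlier t \<omega> = z t \<omega> * \<xi> t \<omega>"

text \<open>The displacement of the threshold at time \<open>t\<close> that the outliers at times \<open>t - p, \<dots>, t\<close> cause on their
own, even if all parameters were known.\<close>

definition jump :: "int \<Rightarrow> 'a \<Rightarrow> real" where
  "jump t \<omega> = (\<Sum>j=0..p. (\<beta>(0 := -1)) j * outlier (t - int j) \<omega>)"

definition hit :: "int \<Rightarrow> 'a \<Rightarrow> real" where
  "hit t \<omega> = of_bool (\<exists>j\<in>{0..p}. z (t - int j) \<omega> \<noteq> 0)"

lemma outlier_measurable [measurable]: "outlier t \<in> borel_measurable M"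
  unfolding outlier_def by measurable

lemma w_measurable_past [measurable]: "outlier s \<in> borel_measurable (past t)"
  unfolding outlier_def by measurable

lemma jump_measurable [measurable]: "jump t \<in> borel_measurable M"
  unfolding jump_def by measurable

lemma jump_measurable_past [measurable]: "jump s \<in> borel_measurable (past t)"
  unfolding jump_def by measurable

lemma hit_measurable [measurable]: "hit t \<in> borel_measurable M"
  unfolding hit_def by measurable

lemma q_nonneg: "0 \<le> q"
  using bernoulli_prob[of 0] by (auto simp flip: bernoulli_prob[of 0])

lemma expectation_nonzero_z: "expectation (\<lambda>\<omega>. of_bool (z t \<omega> \<noteq> 0)) = q"
proof -
  have "expectation (\<lambda>\<omega>. of_bool (z t \<omega> \<noteq> 0)) = expectation (indicat_real {\<omega> \<in> space M. z t \<omega> = 1})"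
  proof (rule integral_cong_AE)
    show "AE \<omega> in M. of_bool (z t \<omega> \<noteq> 0) = indicat_real {\<omega> \<in> space M. z t \<omega> = 1} \<omega>"
      using bernoulli_values[of t] AE_space by eventually_elim (auto simp: indicator_def)
  qed auto
  also have "\<dots> = prob {\<omega> \<in> space M. z t \<omega> = 1}" by simp
  finally show ?thesis by (simp add: bernoulli_prob)
qed

lemma integrable_of_bool: "Measurable.pred M P \<Longrightarrow> integrable M (\<lambda>\<omega>. of_bool (P \<omega>) :: real)"
  by (rule integrable_const_bound[of _ 1]) auto

lemma hit_le: "hit t \<omega> \<le> (\<Sum>j=0..p. of_bool (z (t - int j) \<omega> \<noteq> 0))"
proof (cases "\<exists>j\<in>{0..p}. z (t - int j) \<omega> \<noteq> 0")
  case True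
  then obtain j where j: "j \<in> {0..p}" "z (t - int j) \<omega> \<noteq> 0" by blast
  have "(1::real) = of_bool (z (t - int j) \<omega> \<noteq> 0)" using j by simp
  also have "\<dots> \<le> (\<Sum>j=0..p. of_bool (z (t - int j) \<omega> \<noteq> 0))"
    by (rule member_le_sum[OF j(1)]) auto
  finally show ?thesis using True by (simp add: hit_def)
qed (simp add: hit_def)

lemma
  shows hit_integrable: "integrable M (hit t)"
    and expectation_hit: "expectation (hit t) \<le> real (p + 1) * q"
proof -
  show int: "integrable M (hit t)" unfolding hit_def by (rule integrable_of_bool) measurable
  have "expectation (hit t) \<le> expectation (\<lambda>\<omega>. \<Sum>j=0..p. of_bool (z (t - int j) \<omega> \<noteq> 0))"
    by (intro integral_mono int hit_le integrable_closure integrable_of_bool) measurable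
  also have "\<dots> = (\<Sum>j=0..p. q)"
    by (subst Bochner_Integration.integral_sum)
       (auto intro!: integrable_of_bool sum.cong simp: expectation_nonzero_z)
  finally show "expectation (hit t) \<le> real (p + 1) * q" by (simp add: algebra_simps)
qed

lemma integral_xi_law:
  fixes f :: "real \<Rightarrow> real"
  assumes "f \<in> borel_measurable borel"
  shows "expectation (\<lambda>\<omega>. f (\<xi> t \<omega>)) = (\<integral>u. f u \<partial>\<xi>_law)"
  unfolding outlier_law[of t, symmetric] by (intro integral_distr[symmetric] assms xi_measurable)

text \<open>Since \<open>f\<close> vanishes at 0, only the event \<open>z\<^sub>t = 1\<close> contributes.\<close>

lemma expectation_of_outlier:
  fixes f :: "real \<Rightarrow> real"
  assumes f [measurable]: "f \<in> borel_measurable borel" and bdd: "\<And>u. \<bar>f u\<bar> \<le> C" and f0: "f 0 = 0"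
  shows "expectation (\<lambda>\<omega>. f (outlier t \<omega>)) = q * (\<integral>u. f u \<partial>\<xi>_law)"
proof -
  let ?i = "Inr (Inl t) :: int + int + int" and ?k = "Inr (Inr t) :: int + int + int"
  have "indep_var borel ((\<lambda>y. of_bool (y ?i \<noteq> 0)) \<circ> (\<lambda>\<omega>. restrict (\<lambda>i. noise i \<omega>) {?i}))
                  borel ((\<lambda>y. f (y ?k)) \<circ> (\<lambda>\<omega>. restrict (\<lambda>i. noise i \<omega>) {?k}))"
    by (rule indep_var_compose[OF indep_var_restrict[OF indep]]) auto
  hence ind: "indep_var borel (\<lambda>\<omega>. of_bool (z t \<omega> \<noteq> 0)) borel (\<lambda>\<omega>. f (\<xi> t \<omega>))"
    by (simp add: comp_def)
  have "expectation (\<lambda>\<omega>. f (outlier t \<omega>)) = expectation (\<lambda>\<omega>. of_bool (z t \<omega> \<noteq> 0) * f (\<xi> t \<omega>))"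
  proof (rule integral_cong_AE)
    show "AE \<omega> in M. f (outlier t \<omega>) = of_bool (z t \<omega> \<noteq> 0) * f (\<xi> t \<omega>)"
      using bernoulli_values[of t] by eventually_elim (auto simp: outlier_def f0)
  qed auto
  also have "\<dots> = expectation (\<lambda>\<omega>. of_bool (z t \<omega> \<noteq> 0)) * expectation (\<lambda>\<omega>. f (\<xi> t \<omega>))"
    using bdd
    by (intro indep_var_lebesgue_integral[OF ind] integrable_of_bool integrable_const_bound[of _ C]) auto
  finally show ?thesis by (simp add: expectation_nonzero_z integral_xi_law)
qed

lemma expectation_product_of_outlier:
  fixes f g :: "real \<Rightarrow> real"
  assumes [measurable]: "f \<in> borel_measurable borel" and "\<And>u. \<bar>f u\<bar> \<le> C" and "s \<noteq> t"
  shows "expectation (\<lambda>\<omega>. f (outlier s \<omega>) * f (outlier t \<omega>)) = expectation (\<lambda>\<omega>. f (outlier s \<omega>)) * expectation (\<lambda>\<omega>. f (outlier t \<omega>))"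
proof -
  let ?i = "\<lambda>t. Inr (Inl t) :: int + int + int" and ?k = "\<lambda>t. Inr (Inr t) :: int + int + int"
  let ?F = "\<lambda>t y. f (y (?i t) * y (?k t))"
  have [measurable]: "?F t \<in> borel_measurable (PiM {?i t, ?k t} (\<lambda>_. borel))" for t by measurable
  have "indep_var borel (?F s \<circ> (\<lambda>\<omega>. restrict (\<lambda>i. noise i \<omega>) {?i s, ?k s}))
                  borel (?F t \<circ> (\<lambda>\<omega>. restrict (\<lambda>i. noise i \<omega>) {?i t, ?k t}))"
    by (rule indep_var_compose[OF indep_var_restrict[OF indep]]) (use \<open>s \<noteq> t\<close> in auto)
  hence ind: "indep_var borel (\<lambda>\<omega>. f (outlier s \<omega>)) borel (\<lambda>\<omega>. f (outlier t \<omega>))"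
    by (simp add: comp_def outlier_def)
  show ?thesis
    using assms(2) by (intro indep_var_lebesgue_integral[OF ind] integrable_const_bound[of _ C]) auto
qed

lemma expectation_double_hit:
  assumes "s \<noteq> t"
  shows "expectation (\<lambda>\<omega>. of_bool (z s \<omega> \<noteq> 0) * of_bool (z t \<omega> \<noteq> 0)) = q\<^sup>2"
proof -
  have "indep_var borel ((\<lambda>y. of_bool (y (Inr (Inl s)) \<noteq> 0)) \<circ> (\<lambda>\<omega>. restrict (\<lambda>i. noise i \<omega>) {Inr (Inl s)}))
                  borel ((\<lambda>y. of_bool (y (Inr (Inl t)) \<noteq> 0)) \<circ> (\<lambda>\<omega>. restrict (\<lambda>i. noise i \<omega>) {Inr (Inl t)}))"
    by (rule indep_var_compose[OF indep_var_restrict[OF indep]]) (use assms in auto)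
  hence ind: "indep_var borel (\<lambda>\<omega>. of_bool (z s \<omega> \<noteq> 0) :: real) borel (\<lambda>\<omega>. of_bool (z t \<omega> \<noteq> 0))"
    by (simp add: comp_def)
  have "expectation (\<lambda>\<omega>. of_bool (z s \<omega> \<noteq> 0) * of_bool (z t \<omega> \<noteq> 0) :: real)
      = expectation (\<lambda>\<omega>. of_bool (z s \<omega> \<noteq> 0)) * expectation (\<lambda>\<omega>. of_bool (z t \<omega> \<noteq> 0))"
    by (intro indep_var_lebesgue_integral[OF ind] integrable_of_bool) auto
  thus ?thesis by (simp add: expectation_nonzero_z power2_eq_square)
qed

text \<open>If at most one outlier falls into the window, the two terms of \<open>R\<close> are equal, because \<open>f\<close> vanishes at 0.
Two outliers in one window have probability \<open>q\<^sup>2\<close> for each pair of lags.\<close>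

lemma jump_linearisation:
  fixes f :: "real \<Rightarrow> real"
  assumes f [measurable]: "f \<in> borel_measurable borel" and bdd: "\<And>u. \<bar>f u\<bar> \<le> 1" and f0: "f 0 = 0"
  defines "R \<equiv> \<lambda>t \<omega>. f (jump t \<omega>) - (\<Sum>j=0..p. f ((\<beta>(0 := -1)) j * outlier (t - int j) \<omega>))"
  shows "integrable M (R t)" and "expectation (\<lambda>\<omega>. \<bar>R t \<omega>\<bar>) \<le> real (p + 2) * (real (p + 1))\<^sup>2 * q\<^sup>2"
proof -
  let ?b = "\<beta>(0 := -1)"
  define Q where "Q \<omega> = real (p + 2) * (\<Sum>i=0..p. \<Sum>j\<in>{0..p} - {i}.
     of_bool (z (t - int i) \<omega> \<noteq> 0) * of_bool (z (t - int j) \<omega> \<noteq> 0))" for \<omega>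
  have meas: "R t \<in> borel_measurable M" unfolding R_def by measurable
  have prod_int: "integrable M (\<lambda>\<omega>. of_bool (z a \<omega> \<noteq> 0) * of_bool (z b \<omega> \<noteq> 0) :: real)" for a b
    by (rule integrable_const_bound[of _ 1]) auto
  have Q: "integrable M Q" unfolding Q_def
    by (intro integrable_closure prod_int)
  have dom: "AE \<omega> in M. \<bar>R t \<omega>\<bar> \<le> Q \<omega>"
  proof (rule AE_I2)
    fix \<omega>
    have Q0: "Q \<omega> \<ge> 0" unfolding Q_def by (intro mult_nonneg_nonneg sum_nonneg) auto
    show "\<bar>R t \<omega>\<bar> \<le> Q \<omega>"
    proof (cases "\<exists>i\<in>{0..p}. \<exists>j\<in>{0..p} - {i}. z (t - int i) \<omega> \<noteq> 0 \<and> z (t - int j) \<omega> \<noteq> 0")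
      case True
      then obtain i j where ij: "i \<in> {0..p}" "j \<in> {0..p} - {i}"
        "z (t - int i) \<omega> \<noteq> 0" "z (t - int j) \<omega> \<noteq> 0" by blast
      have "(1::real) = of_bool (z (t - int i) \<omega> \<noteq> 0) * of_bool (z (t - int j) \<omega> \<noteq> 0)" using ij by simp
      also have "\<dots> \<le> (\<Sum>j\<in>{0..p} - {i}. of_bool (z (t - int i) \<omega> \<noteq> 0) * of_bool (z (t - int j) \<omega> \<noteq> 0))"
        by (rule member_le_sum[OF ij(2)]) auto
      also have "\<dots> \<le> (\<Sum>i=0..p. \<Sum>j\<in>{0..p} - {i}. of_bool (z (t - int i) \<omega> \<noteq> 0) * of_bool (z (t - int j) \<omega> \<noteq> 0))"
        by (rule member_le_sum[OF ij(1)]) (auto intro!: sum_nonneg)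
      finally have "real (p + 2) * 1 \<le> Q \<omega>" unfolding Q_def by (intro mult_left_mono) auto
      moreover have "\<bar>R t \<omega>\<bar> \<le> 1 + (\<Sum>j=0..p. 1)"
        unfolding R_def
        by (intro order_trans[OF abs_triangle_ineq4] add_mono order_trans[OF sum_abs] sum_mono bdd)
      ultimately show ?thesis by simp
    next
      case False
      have "R t \<omega> = 0"
      proof (cases "\<exists>i\<in>{0..p}. z (t - int i) \<omega> \<noteq> 0")
        case True
        then obtain i where i: "i \<in> {0..p}" "z (t - int i) \<omega> \<noteq> 0" by blast
        hence other: "outlier (t - int j) \<omega> = 0" if "j \<in> {0..p} - {i}" for j
          using False that by (auto simp: outlier_def)
        have "jump t \<omega> = ?b i * outlier (t - int i) \<omega>"
          unfolding jump_def using i(1) other by (subst sum.remove[of _ i]) auto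
        moreover have "(\<Sum>j=0..p. f (?b j * outlier (t - int j) \<omega>)) = f (?b i * outlier (t - int i) \<omega>)"
          using i(1) other by (subst sum.remove[of _ i]) (auto simp: f0)
        ultimately show ?thesis by (simp add: R_def)
      next
        case False
        hence "outlier (t - int j) \<omega> = 0" if "j \<in> {0..p}" for j using that by (auto simp: outlier_def)
        thus ?thesis by (simp add: R_def jump_def f0)
      qed
      thus ?thesis using Q0 by simp
    qed
  qed
  have "expectation Q = real (p + 2) * (\<Sum>i=0..p. \<Sum>j\<in>{0..p} - {i}. q\<^sup>2)"
  proof -
    have "expectation Q = real (p + 2) * (\<Sum>i=0..p. \<Sum>j\<in>{0..p} - {i}.
        expectation (\<lambda>\<omega>. of_bool (z (t - int i) \<omega> \<noteq> 0) * of_bool (z (t - int j) \<omega> \<noteq> 0)))"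
      unfolding Q_def integral_mult_right_zero
      by (subst Bochner_Integration.integral_sum)
         (intro Bochner_Integration.integrable_sum prod_int sum.cong refl arg_cong2[where f = "(*)"]
            Bochner_Integration.integral_sum)+
    also have "\<dots> = real (p + 2) * (\<Sum>i=0..p. \<Sum>j\<in>{0..p} - {i}. q\<^sup>2)"
      by (intro arg_cong2[where f = "(*)"] sum.cong refl expectation_double_hit) auto
    finally show ?thesis .
  qed
  also have "\<dots> \<le> real (p + 2) * (\<Sum>i=0..p. \<Sum>j\<in>{0..p}. q\<^sup>2)"
    by (intro mult_left_mono sum_mono sum_mono2) auto
  also have "\<dots> = real (p + 2) * (real (p + 1))\<^sup>2 * q\<^sup>2"
    by (simp add: power2_eq_square algebra_simps)
  finally have EQ: "expectation Q \<le> real (p + 2) * (real (p + 1))\<^sup>2 * q\<^sup>2" .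
  show "integrable M (R t)" and "expectation (\<lambda>\<omega>. \<bar>R t \<omega>\<bar>) \<le> real (p + 2) * (real (p + 1))\<^sup>2 * q\<^sup>2"
    using dominated_abs_expectation[OF meas Q dom EQ] by auto
qed

text \<open>For a fixed lag the summands are independent and centred, with variance at most the outlier
probability.\<close>

lemma single_jump_fluctuation:
  fixes f :: "real \<Rightarrow> real"
  assumes n: "n \<ge> 1" and f [measurable]: "f \<in> borel_measurable borel"
    and bdd: "\<And>u. \<bar>f u\<bar> \<le> 1" and f0: "f 0 = 0"
  shows "expectation (\<lambda>\<omega>. \<bar>(\<Sum>t=1..int n. f (outlier (t - j) \<omega>) - q * (\<integral>u. f u \<partial>\<xi>_law)) / sqrt (real n)\<bar>) \<le> sqrt q"
proof -
  define m where "m = q * (\<integral>u. f u \<partial>\<xi>_law)"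
  have mean: "expectation (\<lambda>\<omega>. f (outlier t \<omega>)) = m" for t
    unfolding m_def by (rule expectation_of_outlier[where C = 1]) (use bdd f0 in auto)
  have int: "integrable M (\<lambda>\<omega>. f (outlier t \<omega>))" for t
    by (rule integrable_const_bound[of _ 1]) (use bdd in auto)
  have int2: "integrable M (\<lambda>\<omega>. f (outlier s \<omega>) * f (outlier t \<omega>))" for s t
    by (rule integrable_const_bound[of _ 1])
       (use bdd in \<open>auto simp: abs_mult intro!: mult_le_one\<close>)
  have cross: "expectation (\<lambda>\<omega>. (f (outlier s \<omega>) - m) * (f (outlier t \<omega>) - m))
      = expectation (\<lambda>\<omega>. f (outlier s \<omega>) * f (outlier t \<omega>)) - m * m" for s t
  proof -
    have "expectation (\<lambda>\<omega>. (f (outlier s \<omega>) - m) * (f (outlier t \<omega>) - m))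
        = expectation (\<lambda>\<omega>. f (outlier s \<omega>) * f (outlier t \<omega>) - m * f (outlier s \<omega>) - m * f (outlier t \<omega>) + m * m)"
      by (intro Bochner_Integration.integral_cong) (auto simp: algebra_simps)
    also have "\<dots> = expectation (\<lambda>\<omega>. f (outlier s \<omega>) * f (outlier t \<omega>)) - m * m"
      by (simp add: int int2 mean prob_space)
    finally show ?thesis .
  qed
  have "expectation (\<lambda>\<omega>. \<bar>(\<Sum>t=1..int n. f (outlier (t - j) \<omega>) - m) / sqrt (real n)\<bar>) \<le> sqrt q"
  proof (rule normalised_orthogonal_sum_bound[OF n])
    fix t
    show "(\<lambda>\<omega>. f (outlier (t - j) \<omega>) - m) \<in> borel_measurable M" by measurable
    have sq: "(f (outlier (t - j) \<omega>) - m)\<^sup>2 = f (outlier (t - j) \<omega>) * f (outlier (t - j) \<omega>) - 2 * m * f (outlier (t - j) \<omega>) + m\<^sup>2" for \<omega>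
      by (simp add: power2_eq_square algebra_simps)
    show "integrable M (\<lambda>\<omega>. (f (outlier (t - j) \<omega>) - m)\<^sup>2)"
      unfolding sq using int int2 by auto
    have "expectation (\<lambda>\<omega>. (f (outlier (t - j) \<omega>) - m)\<^sup>2)
        = expectation (\<lambda>\<omega>. f (outlier (t - j) \<omega>) * f (outlier (t - j) \<omega>)) - m * m"
      unfolding power2_eq_square by (rule cross)
    also have "\<dots> \<le> expectation (\<lambda>\<omega>. f (outlier (t - j) \<omega>) * f (outlier (t - j) \<omega>))" by simp
    also have "\<dots> \<le> expectation (\<lambda>\<omega>. of_bool (z (t - j) \<omega> \<noteq> 0))"
    proof (rule integral_mono[OF int2])
      show "integrable M (\<lambda>\<omega>. of_bool (z (t - j) \<omega> \<noteq> 0) :: real)" by (rule integrable_of_bool) measurable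
      fix \<omega>
      have "f u * f u \<le> 1" for u
      proof -
        have "\<bar>f u\<bar> * \<bar>f u\<bar> \<le> 1" using bdd[of u] by (intro mult_le_one) auto
        thus ?thesis by simp
      qed
      thus "f (outlier (t - j) \<omega>) * f (outlier (t - j) \<omega>) \<le> of_bool (z (t - j) \<omega> \<noteq> 0)"
        by (auto simp: outlier_def f0)
    qed
    finally show "expectation (\<lambda>\<omega>. (f (outlier (t - j) \<omega>) - m)\<^sup>2) \<le> q" by (simp add: expectation_nonzero_z)
  next
    fix s t :: int assume st: "s < t"
    thus "expectation (\<lambda>\<omega>. (f (outlier (s - j) \<omega>) - m) * (f (outlier (t - j) \<omega>) - m)) = 0"
      using expectation_product_of_outlier[OF f bdd, of "s - j" "t - j"] by (simp add: cross mean)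
  qed
  thus ?thesis unfolding m_def .
qed

end

section \<open>Perturbed thresholds under the local alternative\<close>

text \<open>The smooth part of the threshold displacement. The term with \<open>\<eta>\<close> is the safety margin by which a grid
point has to be lowered or raised in order to dominate all \<open>\<tau>\<close> near it.\<close>

definition drift :: "nat \<Rightarrow> nat \<Rightarrow> (nat \<Rightarrow> real) \<Rightarrow> real \<Rightarrow> (nat \<Rightarrow> real) \<Rightarrow> real" where
  "drift p n \<tau> \<eta> y = (\<Sum>j=0..p. \<tau> j * y j + \<eta> * \<bar>y j\<bar>) / sqrt (real n)"

definition weight :: "nat \<Rightarrow> (nat \<Rightarrow> real) \<Rightarrow> real \<Rightarrow> real" where
  "weight p \<tau> \<eta> = (\<Sum>j=0..p. \<bar>\<tau> j\<bar> + \<bar>\<eta>\<bar>)"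

lemma weight_nonneg: "0 \<le> weight p \<tau> \<eta>"
  unfolding weight_def by (intro sum_nonneg) auto

lemma abs_drift_le: "\<bar>drift p n \<tau> \<eta> y\<bar> \<le> (\<Sum>j=0..p. (\<bar>\<tau> j\<bar> + \<bar>\<eta>\<bar>) * \<bar>y j\<bar>) / sqrt (real n)"
proof -
  have "\<bar>\<Sum>j=0..p. \<tau> j * y j + \<eta> * \<bar>y j\<bar>\<bar> \<le> (\<Sum>j=0..p. (\<bar>\<tau> j\<bar> + \<bar>\<eta>\<bar>) * \<bar>y j\<bar>)"
  proof (intro order_trans[OF sum_abs] sum_mono)
    fix j
    have "\<bar>\<tau> j * y j + \<eta> * \<bar>y j\<bar>\<bar> \<le> \<bar>\<tau> j * y j\<bar> + \<bar>\<eta> * \<bar>y j\<bar>\<bar>" by (rule abs_triangle_ineq)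
    thus "\<bar>\<tau> j * y j + \<eta> * \<bar>y j\<bar>\<bar> \<le> (\<bar>\<tau> j\<bar> + \<bar>\<eta>\<bar>) * \<bar>y j\<bar>" by (simp add: abs_mult algebra_simps)
  qed
  thus ?thesis unfolding drift_def by (simp add: divide_right_mono)
qed

lemma drift_square_le:
  "(drift p n \<tau> \<eta> y)\<^sup>2 \<le> weight p \<tau> \<eta> * (\<Sum>j=0..p. (\<bar>\<tau> j\<bar> + \<bar>\<eta>\<bar>) * (y j)\<^sup>2) / real n"
proof -
  have "(drift p n \<tau> \<eta> y)\<^sup>2 = \<bar>drift p n \<tau> \<eta> y\<bar>\<^sup>2" by simp
  also have "\<dots> \<le> ((\<Sum>j=0..p. (\<bar>\<tau> j\<bar> + \<bar>\<eta>\<bar>) * \<bar>y j\<bar>) / sqrt (real n))\<^sup>2"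
    by (intro power_mono abs_drift_le) simp
  also have "\<dots> = (\<Sum>j=0..p. (\<bar>\<tau> j\<bar> + \<bar>\<eta>\<bar>) * \<bar>y j\<bar>)\<^sup>2 / real n"
    by (simp add: power_divide)
  also have "\<dots> \<le> (weight p \<tau> \<eta> * (\<Sum>j=0..p. (\<bar>\<tau> j\<bar> + \<bar>\<eta>\<bar>) * \<bar>y j\<bar>\<^sup>2)) / real n"
    unfolding weight_def by (intro divide_right_mono weighted_Cauchy_Schwarz) auto
  finally show ?thesis by simp
qed

text \<open>Used for the error made when contaminated regressors are replaced by clean ones.\<close>

lemma drift_difference_le:
  "\<bar>drift p n \<tau> \<eta> y - drift p n \<tau> \<eta> y'\<bar> \<le> weight p \<tau> \<eta> * (\<Sum>j=0..p. \<bar>y j - y' j\<bar>) / sqrt (real n)"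
proof -
  have "drift p n \<tau> \<eta> y - drift p n \<tau> \<eta> y'
      = (\<Sum>j=0..p. \<tau> j * (y j - y' j) + \<eta> * (\<bar>y j\<bar> - \<bar>y' j\<bar>)) / sqrt (real n)"
    unfolding drift_def by (simp add: algebra_simps sum_subtractf sum.distrib flip: diff_divide_distrib)
  moreover have "\<bar>\<Sum>j=0..p. \<tau> j * (y j - y' j) + \<eta> * (\<bar>y j\<bar> - \<bar>y' j\<bar>)\<bar>
      \<le> (\<Sum>j=0..p. weight p \<tau> \<eta> * \<bar>y j - y' j\<bar>)"
  proof (intro order_trans[OF sum_abs] sum_mono)
    fix j assume j: "j \<in> {0..p}"
    have "\<bar>\<tau> j * (y j - y' j) + \<eta> * (\<bar>y j\<bar> - \<bar>y' j\<bar>)\<bar>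
        \<le> \<bar>\<tau> j\<bar> * \<bar>y j - y' j\<bar> + \<bar>\<eta>\<bar> * \<bar>\<bar>y j\<bar> - \<bar>y' j\<bar>\<bar>"
      by (rule order_trans[OF abs_triangle_ineq]) (simp add: abs_mult)
    also have "\<dots> \<le> \<bar>\<tau> j\<bar> * \<bar>y j - y' j\<bar> + \<bar>\<eta>\<bar> * \<bar>y j - y' j\<bar>"
      by (intro add_left_mono mult_left_mono) (simp_all add: abs_triangle_ineq3)
    also have "\<dots> = (\<bar>\<tau> j\<bar> + \<bar>\<eta>\<bar>) * \<bar>y j - y' j\<bar>" by (simp add: algebra_simps)
    also have "\<dots> \<le> weight p \<tau> \<eta> * \<bar>y j - y' j\<bar>"
      unfolding weight_def
      by (intro mult_right_mono member_le_sum[OF j, of "\<lambda>j. \<bar>\<tau> j\<bar> + \<bar>\<eta>\<bar>"]) auto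
    finally show "\<bar>\<tau> j * (y j - y' j) + \<eta> * (\<bar>y j\<bar> - \<bar>y' j\<bar>)\<bar> \<le> weight p \<tau> \<eta> * \<bar>y j - y' j\<bar>" .
  qed
  ultimately show ?thesis by (simp add: divide_right_mono sum_distrib_left)
qed

text \<open>The summand 1 accounts for the constant regressor and makes the second-moment bound dominate the first
absolute moment as well.\<close>

definition regressor_moment_bound :: "(nat \<Rightarrow> real) \<Rightarrow> real \<Rightarrow> real" where
  "regressor_moment_bound \<psi> S = 1 + (\<Sum>k. \<bar>\<psi> k\<bar>)\<^sup>2 * S"

text \<open>The outlier law may have no moments. Outliers enter the regressors multiplied by a factor \<open>a\<close> of order
\<open>n\<^sup>-\<^sup>1\<^sup>/\<^sup>2\<close>, and a difference of distribution functions never exceeds 1, so only this truncated mean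
is needed; it tends to 0 with \<open>a\<close>, without a rate.\<close>

definition truncated_outlier :: "real measure \<Rightarrow> real \<Rightarrow> real" where
  "truncated_outlier L a = (\<integral>u. min 1 (a * \<bar>u\<bar>) \<partial>L)"

lemma min_1_sum_le:
  fixes f :: "nat \<Rightarrow> real"
  assumes "finite A" and "\<And>i. i \<in> A \<Longrightarrow> 0 \<le> f i"
  shows "min 1 (\<Sum>i\<in>A. f i) \<le> (\<Sum>i\<in>A. min 1 (f i))"
  using assms
proof (induction A rule: finite_induct)
  case (insert i A)
  have "min 1 (f i + sum f A) \<le> min 1 (f i) + min 1 (sum f A)"
  proof -
    have "0 \<le> f i" "0 \<le> sum f A" using insert.prems by (auto intro: sum_nonneg)
    thus ?thesis by (auto simp: min_def)
  qed
  also have "min 1 (sum f A) \<le> (\<Sum>i\<in>A. min 1 (f i))" using insert by auto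
  finally show ?case using insert.hyps by simp
qed simp

text \<open>Here \<open>n\<close> is the sample size, \<open>r\<close> the weight \<open>\<rho>\<^sub>n\<close> of the alternative, and \<open>S\<close> bounds the innovation
variance. All bounds in this locale are non-asymptotic.\<close>

locale local_alternative_ar = stable_contaminated_ar +
  fixes n :: nat and \<theta> r S B :: real and H H' H'' :: "real \<Rightarrow> real"
  assumes n_pos: "n \<ge> 1" and \<theta>_pos: "\<theta> > 0" and r_nonneg: "0 \<le> r" and r_le_1: "r \<le> 1"
    and S: "expectation (\<lambda>\<omega>. (\<epsilon> 1 \<omega>)\<^sup>2) \<le> S"
    and G_mix: "\<And>x. G x = (1 - r) * std_normal_cdf (x / \<theta>) + r * H x"
    and H_bounds: "\<And>x. 0 \<le> H x" "\<And>x. H x \<le> 1"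
    and H_deriv: "\<And>x. (H has_real_derivative H' x) (at x)"
    and H'_deriv: "\<And>x. (H' has_real_derivative H'' x) (at x)"
    and H''_bound: "\<And>x. \<bar>H'' x\<bar> \<le> B"
begin

abbreviation G\<^sub>0 :: "real \<Rightarrow> real" where "G\<^sub>0 x \<equiv> std_normal_cdf (x / \<theta>)"
abbreviation g\<^sub>0 :: "real \<Rightarrow> real" where "g\<^sub>0 x \<equiv> std_normal_density (x / \<theta>) / \<theta>"

abbreviation K :: real where "K \<equiv> regressor_moment_bound \<psi> S"
abbreviation C :: real where "C \<equiv> lagged_sum_constant p \<beta> S K"

text \<open>Regressors without (\<open>clean\<close>) and with (\<open>dirty\<close>) contamination. Index 0 is the constant regressor, whose coefficient carries the error in \<open>\<mu>\<close>; this treats the errors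
in \<open>\<mu>\<close> and in \<open>\<beta>\<close> as one vector.\<close>

definition clean :: "int \<Rightarrow> 'a \<Rightarrow> nat \<Rightarrow> real" where
  "clean t \<omega> j = (if j = 0 then 1 else V (t - int j) \<omega>)"

definition dirty :: "int \<Rightarrow> 'a \<Rightarrow> nat \<Rightarrow> real" where
  "dirty t \<omega> j = (if j = 0 then 1 else V (t - int j) \<omega> + outlier (t - int j) \<omega>)"

definition shift :: "(nat \<Rightarrow> real) \<Rightarrow> real \<Rightarrow> int \<Rightarrow> 'a \<Rightarrow> real" where
  "shift \<tau> \<eta> t \<omega> = jump t \<omega> + drift p n \<tau> \<eta> (dirty t \<omega>)"

lemma S_nonneg: "0 \<le> S" using S innovation_nondegenerate by linarith
lemma K_ge_1: "1 \<le> K" unfolding regressor_moment_bound_def using S_nonneg by simp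

lemma C_nonneg: "0 \<le> C"
  unfolding lagged_sum_constant_def using K_ge_1 S_nonneg
  by (intro add_nonneg_nonneg divide_nonneg_nonneg mult_nonneg_nonneg sum_nonneg) auto

lemma B_nonneg: "0 \<le> B" using H''_bound[of 0] by linarith

lemma g\<^sub>0_nonneg: "0 \<le> g\<^sub>0 x" using \<theta>_pos by simp

lemma clean_measurable [measurable]: "(\<lambda>\<omega>. clean t \<omega> j) \<in> borel_measurable M"
  unfolding clean_def by measurable

lemma dirty_measurable [measurable]: "(\<lambda>\<omega>. dirty t \<omega> j) \<in> borel_measurable M"
  unfolding dirty_def by measurable

lemma drift_clean_measurable [measurable]: "(\<lambda>\<omega>. drift p n \<tau> \<eta> (clean t \<omega>)) \<in> borel_measurable M"
  unfolding drift_def by measurable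

lemma shift_measurable [measurable]: "shift \<tau> \<eta> t \<in> borel_measurable M"
  unfolding shift_def drift_def by measurable

lemma shift_measurable_past: "shift \<tau> \<eta> t \<in> borel_measurable (past t)"
proof -
  have "(\<lambda>\<omega>. dirty t \<omega> j) \<in> borel_measurable (past t)" for j
  proof (cases "j = 0")
    case False
    hence [measurable]: "V (t - int j) \<in> borel_measurable (past t)" by (intro V_measurable_past) simp
    show ?thesis using False unfolding dirty_def by simp
  qed (simp add: dirty_def)
  note [measurable] = this
  show ?thesis unfolding shift_def drift_def by measurable
qed

lemma
  shows clean_square_integrable: "integrable M (\<lambda>\<omega>. (clean t \<omega> j)\<^sup>2)"
    and clean_second_moment: "expectation (\<lambda>\<omega>. (clean t \<omega> j)\<^sup>2) \<le> K"
    and clean_integrable: "integrable M (\<lambda>\<omega>. clean t \<omega> j)"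
    and clean_abs_moment: "expectation (\<lambda>\<omega>. \<bar>clean t \<omega> j\<bar>) \<le> K"
proof -
  show int2: "integrable M (\<lambda>\<omega>. (clean t \<omega> j)\<^sup>2)"
    by (cases "j = 0") (simp_all add: clean_def V_square_integrable)
  have "expectation (\<lambda>\<omega>. (V s \<omega>)\<^sup>2) \<le> (\<Sum>k. \<bar>\<psi> k\<bar>)\<^sup>2 * S" for s
    using V_second_moment[of s] mult_left_mono[OF S, of "(\<Sum>k. \<bar>\<psi> k\<bar>)\<^sup>2"] by simp
  hence "expectation (\<lambda>\<omega>. (V s \<omega>)\<^sup>2) \<le> K" for s by (simp add: regressor_moment_bound_def add_increasing)
  thus bound: "expectation (\<lambda>\<omega>. (clean t \<omega> j)\<^sup>2) \<le> K"
    using K_ge_1 by (cases "j = 0") (simp_all add: clean_def prob_space)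
  show int: "integrable M (\<lambda>\<omega>. clean t \<omega> j)"
    by (rule square_integrable_imp_integrable[OF _ int2]) simp
  have "expectation (\<lambda>\<omega>. \<bar>clean t \<omega> j\<bar>) \<le> sqrt K"
    by (rule expectation_abs_le_sqrt[OF _ int2 bound]) simp
  also have "\<dots> \<le> K" using K_ge_1 by (simp add: real_sqrt_le_iff' sqrt_le_D real_le_lsqrt power2_eq_square)
  finally show "expectation (\<lambda>\<omega>. \<bar>clean t \<omega> j\<bar>) \<le> K" .
qed

lemma
  shows drift_integrable: "integrable M (\<lambda>\<omega>. drift p n \<tau> \<eta> (clean t \<omega>))"
    and drift_abs_moment: "expectation (\<lambda>\<omega>. \<bar>drift p n \<tau> \<eta> (clean t \<omega>)\<bar>) \<le> weight p \<tau> \<eta> * K / sqrt (real n)"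
    and drift_square_integrable: "integrable M (\<lambda>\<omega>. (drift p n \<tau> \<eta> (clean t \<omega>))\<^sup>2)"
    and drift_second_moment: "expectation (\<lambda>\<omega>. (drift p n \<tau> \<eta> (clean t \<omega>))\<^sup>2) \<le> (weight p \<tau> \<eta>)\<^sup>2 * K / real n"
proof -
  let ?a = "\<lambda>j. \<bar>\<tau> j\<bar> + \<bar>\<eta>\<bar>"
  define g1 where "g1 \<omega> = (\<Sum>j=0..p. ?a j * \<bar>clean t \<omega> j\<bar>) / sqrt (real n)" for \<omega>
  define g2 where "g2 \<omega> = weight p \<tau> \<eta> * (\<Sum>j=0..p. ?a j * (clean t \<omega> j)\<^sup>2) / real n" for \<omega>
  have g1: "integrable M g1" unfolding g1_def
    by (intro integrable_closure clean_integrable)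
  have g2: "integrable M g2" unfolding g2_def
    by (intro integrable_closure clean_square_integrable)
  have W: "(\<Sum>j=0..p. ?a j * K) = weight p \<tau> \<eta> * K"
    by (simp add: weight_def sum_distrib_right)
  have "expectation g1 = (\<Sum>j=0..p. ?a j * expectation (\<lambda>\<omega>. \<bar>clean t \<omega> j\<bar>)) / sqrt (real n)"
    unfolding g1_def by (simp add: clean_integrable)
  also have "\<dots> \<le> (\<Sum>j=0..p. ?a j * K) / sqrt (real n)"
    by (intro divide_right_mono sum_mono mult_left_mono clean_abs_moment) auto
  finally have E1: "expectation g1 \<le> weight p \<tau> \<eta> * K / sqrt (real n)"
    unfolding W .
  have "expectation g2 = weight p \<tau> \<eta> * (\<Sum>j=0..p. ?a j * expectation (\<lambda>\<omega>. (clean t \<omega> j)\<^sup>2)) / real n"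
    unfolding g2_def by (simp add: clean_square_integrable)
  also have "\<dots> \<le> weight p \<tau> \<eta> * (\<Sum>j=0..p. ?a j * K) / real n"
    by (intro divide_right_mono mult_left_mono sum_mono mult_left_mono clean_second_moment weight_nonneg) auto
  finally have E2: "expectation g2 \<le> (weight p \<tau> \<eta>)\<^sup>2 * K / real n"
    unfolding W by (simp add: power2_eq_square mult.assoc)
  show "integrable M (\<lambda>\<omega>. drift p n \<tau> \<eta> (clean t \<omega>))"
    and "expectation (\<lambda>\<omega>. \<bar>drift p n \<tau> \<eta> (clean t \<omega>)\<bar>) \<le> weight p \<tau> \<eta> * K / sqrt (real n)"
    using dominated_abs_expectation[OF drift_clean_measurable g1 _ E1] abs_drift_le
    by (auto simp: g1_def)
  have "AE \<omega> in M. \<bar>(drift p n \<tau> \<eta> (clean t \<omega>))\<^sup>2\<bar> \<le> g2 \<omega>"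
    using drift_square_le by (auto simp: g2_def)
  from dominated_abs_expectation[OF _ g2 this E2]
  show "integrable M (\<lambda>\<omega>. (drift p n \<tau> \<eta> (clean t \<omega>))\<^sup>2)"
    and "expectation (\<lambda>\<omega>. (drift p n \<tau> \<eta> (clean t \<omega>))\<^sup>2) \<le> (weight p \<tau> \<eta>)\<^sup>2 * K / real n"
    by auto
qed

lemma no_hit:
  assumes "hit t \<omega> = 0"
  shows "jump t \<omega> = 0" and "dirty t \<omega> j = clean t \<omega> j \<or> j > p"
proof -
  have w: "outlier (t - int j) \<omega> = 0" if "j \<le> p" for j
    using assms that by (auto simp: hit_def outlier_def)
  show "jump t \<omega> = 0" unfolding jump_def by (intro sum.neutral) (simp add: w)
  show "dirty t \<omega> j = clean t \<omega> j \<or> j > p"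
    using w[of j] by (cases "j \<le> p") (auto simp: dirty_def clean_def)
qed

lemma shift_no_hit:
  assumes "hit t \<omega> = 0" shows "shift \<tau> \<eta> t \<omega> = drift p n \<tau> \<eta> (clean t \<omega>)"
proof -
  have "dirty t \<omega> j = clean t \<omega> j" if "j \<in> {0..p}" for j
    using no_hit(2)[OF assms, of j] that by auto
  hence "drift p n \<tau> \<eta> (dirty t \<omega>) = drift p n \<tau> \<eta> (clean t \<omega>)"
    unfolding drift_def by (intro arg_cong2[where f = "(/)"] sum.cong) auto
  thus ?thesis using no_hit(1)[OF assms] by (simp add: shift_def)
qed

lemma G_near_normal: "\<bar>G x - G\<^sub>0 x\<bar> \<le> r"
proof -
  have "G x - G\<^sub>0 x = r * (H x - G\<^sub>0 x)" by (simp add: G_mix algebra_simps)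
  moreover have "\<bar>H x - G\<^sub>0 x\<bar> \<le> 1"
    using H_bounds[of x] std_normal_cdf_bounds[of "x / \<theta>"] by linarith
  ultimately show ?thesis using r_nonneg by (simp add: abs_mult mult_left_le)
qed

text \<open>Taylor's formula for the mixture, with the slope of the mixture replaced by the normal density; the
price is proportional to the mixing weight.\<close>

lemma G_linearisation:
  "\<bar>G (x + h) - G x - g\<^sub>0 x * h\<bar> \<le> (1 / \<theta>\<^sup>2 + B) * h\<^sup>2 + r * (g\<^sub>0 x + \<bar>H' x\<bar>) * \<bar>h\<bar>"
proof -
  define G' where "G' x = (1 - r) * g\<^sub>0 x + r * H' x" for x
  define G'' where "G'' x = (1 - r) * (- (x / \<theta>) * std_normal_density (x / \<theta>) / \<theta>\<^sup>2) + r * H'' x" for x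
  have "\<bar>G (x + h) - G x - G' x * h\<bar> \<le> (1 / \<theta>\<^sup>2 + B) * h\<^sup>2"
  proof (rule second_order_Taylor_bound)
    fix x
    have "((\<lambda>x. (1 - r) * G\<^sub>0 x + r * H x) has_real_derivative G' x) (at x)"
      unfolding G'_def
      by (intro DERIV_add DERIV_cmult scaled_normal_cdf_has_derivative \<theta>_pos H_deriv)
    thus "(G has_real_derivative G' x) (at x)" by (simp flip: G_mix)
    show "(G' has_real_derivative G'' x) (at x)"
      unfolding G'_def[abs_def] G''_def
      by (intro DERIV_add DERIV_cmult scaled_normal_density_has_derivative \<theta>_pos H'_deriv)
    have "\<bar>G'' x\<bar> \<le> \<bar>(1 - r) * (- (x / \<theta>) * std_normal_density (x / \<theta>) / \<theta>\<^sup>2)\<bar> + \<bar>r * H'' x\<bar>"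
      unfolding G''_def by (rule abs_triangle_ineq)
    also have "\<dots> = (1 - r) * (\<bar>(x / \<theta>) * std_normal_density (x / \<theta>)\<bar> / \<theta>\<^sup>2) + r * \<bar>H'' x\<bar>"
      using r_nonneg r_le_1 by (simp add: abs_mult)
    also have "\<dots> \<le> 1 * (1 / \<theta>\<^sup>2) + 1 * B"
      using r_nonneg r_le_1 B_nonneg
      by (intro add_mono mult_mono divide_right_mono abs_mult_std_normal_density_le_1 H''_bound) auto
    finally show "\<bar>G'' x\<bar> \<le> 1 / \<theta>\<^sup>2 + B" by simp
  qed
  moreover have "\<bar>(G' x - g\<^sub>0 x) * h\<bar> \<le> r * (g\<^sub>0 x + \<bar>H' x\<bar>) * \<bar>h\<bar>"
  proof -
    have "(1 - r) * a + r * b - a = r * (b - a)" for a b :: real by (simp add: algebra_simps)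
    hence "G' x - g\<^sub>0 x = r * (H' x - g\<^sub>0 x)" unfolding G'_def .
    moreover have "\<bar>H' x - g\<^sub>0 x\<bar> \<le> g\<^sub>0 x + \<bar>H' x\<bar>" using g\<^sub>0_nonneg[of x] by linarith
    ultimately show ?thesis using r_nonneg by (simp add: abs_mult mult_mono)
  qed
  moreover have "G (x + h) - G x - g\<^sub>0 x * h = (G (x + h) - G x - G' x * h) + (G' x - g\<^sub>0 x) * h"
    by (simp add: algebra_simps)
  ultimately show ?thesis by linarith
qed

definition smooth_error :: "real \<Rightarrow> real \<Rightarrow> real" where
  "smooth_error x W = (1 / \<theta>\<^sup>2 + B) * (W\<^sup>2 * K / real n) + r * (g\<^sub>0 x + \<bar>H' x\<bar>) * (W * K / sqrt (real n))"

lemma smooth_part: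
  fixes \<tau> :: "nat \<Rightarrow> real" and x \<eta> :: real
  defines "R \<equiv> \<lambda>t \<omega>. G (x + drift p n \<tau> \<eta> (clean t \<omega>)) - G x - g\<^sub>0 x * drift p n \<tau> \<eta> (clean t \<omega>)"
  shows "integrable M (R t)" and "expectation (\<lambda>\<omega>. \<bar>R t \<omega>\<bar>) \<le> smooth_error x (weight p \<tau> \<eta>)"
proof -
  let ?h = "\<lambda>\<omega>. drift p n \<tau> \<eta> (clean t \<omega>)" and ?c = "r * (g\<^sub>0 x + \<bar>H' x\<bar>)"
  define g where "g \<omega> = (1 / \<theta>\<^sup>2 + B) * (?h \<omega>)\<^sup>2 + ?c * \<bar>?h \<omega>\<bar>" for \<omega>
  have g: "integrable M g" unfolding g_def
    by (intro integrable_closure drift_integrable drift_square_integrable)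
  have "expectation g = (1 / \<theta>\<^sup>2 + B) * expectation (\<lambda>\<omega>. (?h \<omega>)\<^sup>2) + ?c * expectation (\<lambda>\<omega>. \<bar>?h \<omega>\<bar>)"
    unfolding g_def by (simp add: drift_integrable drift_square_integrable)
  also have "\<dots> \<le> smooth_error x (weight p \<tau> \<eta>)"
    unfolding smooth_error_def using r_nonneg g\<^sub>0_nonneg[of x] B_nonneg
    by (intro add_mono mult_left_mono drift_second_moment drift_abs_moment) auto
  finally have E: "expectation g \<le> smooth_error x (weight p \<tau> \<eta>)" .
  have meas: "R t \<in> borel_measurable M" unfolding R_def by measurable
  have dom: "AE \<omega> in M. \<bar>R t \<omega>\<bar> \<le> g \<omega>" using G_linearisation by (auto simp: R_def g_def)
  show "integrable M (R t)" and "expectation (\<lambda>\<omega>. \<bar>R t \<omega>\<bar>) \<le> smooth_error x (weight p \<tau> \<eta>)"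
    using dominated_abs_expectation[OF meas g dom E] by auto
qed

lemma shift_effect:
  "expectation (\<lambda>\<omega>. \<bar>G (x + shift \<tau> \<eta> t \<omega>) - G x\<bar>)
     \<le> real (p + 1) * q + smooth_error x (weight p \<tau> \<eta>) + g\<^sub>0 x * (weight p \<tau> \<eta> * K / sqrt (real n))"
proof -
  let ?h = "\<lambda>\<omega>. drift p n \<tau> \<eta> (clean t \<omega>)"
  let ?R = "\<lambda>\<omega>. G (x + ?h \<omega>) - G x - g\<^sub>0 x * ?h \<omega>"
  define g where "g \<omega> = hit t \<omega> + \<bar>?R \<omega>\<bar> + g\<^sub>0 x * \<bar>?h \<omega>\<bar>" for \<omega>
  have g: "integrable M g" unfolding g_def
    by (intro integrable_closure drift_integrable
        hit_integrable smooth_part)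
  have "expectation g = expectation (hit t) + expectation (\<lambda>\<omega>. \<bar>?R \<omega>\<bar>) + g\<^sub>0 x * expectation (\<lambda>\<omega>. \<bar>?h \<omega>\<bar>)"
    unfolding g_def using smooth_part(1)[of x \<tau> \<eta> t] by (simp add: drift_integrable hit_integrable)
  also have "\<dots> \<le> real (p + 1) * q + smooth_error x (weight p \<tau> \<eta>) + g\<^sub>0 x * (weight p \<tau> \<eta> * K / sqrt (real n))"
    by (intro add_mono expectation_hit smooth_part mult_left_mono drift_abs_moment g\<^sub>0_nonneg)
  finally have E: "expectation g \<le> \<dots>" .
  have dom: "AE \<omega> in M. \<bar>G (x + shift \<tau> \<eta> t \<omega>) - G x\<bar> \<le> g \<omega>"
  proof (rule AE_I2)
    fix \<omega>
    show "\<bar>G (x + shift \<tau> \<eta> t \<omega>) - G x\<bar> \<le> g \<omega>"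
    proof (cases "hit t \<omega> = 0")
      case True
      have "\<bar>G (x + ?h \<omega>) - G x\<bar> \<le> \<bar>?R \<omega>\<bar> + \<bar>g\<^sub>0 x * ?h \<omega>\<bar>" by linarith
      thus ?thesis using True \<theta>_pos by (simp add: shift_no_hit g_def abs_mult)
    next
      case False
      hence "hit t \<omega> = 1" by (auto simp: hit_def)
      moreover have "0 \<le> g\<^sub>0 x * \<bar>?h \<omega>\<bar>" using g\<^sub>0_nonneg[of x] by (intro mult_nonneg_nonneg) auto
      moreover have "\<bar>G (x + shift \<tau> \<eta> t \<omega>) - G x\<bar> \<le> 1"
        using G_bounds[of x] G_bounds[of "x + shift \<tau> \<eta> t \<omega>"] by linarith
      ultimately show ?thesis unfolding g_def by linarith
    qed
  qed
  show ?thesis using dominated_abs_expectation(2)[OF _ g dom E] by simp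
qed

section \<open>The perturbed empirical process for deterministic perturbations\<close>

text \<open>The failure of the jump and the smooth drift to act additively. It vanishes unless an outlier falls into
the window. The jump is evaluated under the normal distribution function rather than the true one.\<close>

definition interaction :: "real \<Rightarrow> (nat \<Rightarrow> real) \<Rightarrow> real \<Rightarrow> int \<Rightarrow> 'a \<Rightarrow> real" where
  "interaction x \<tau> \<eta> t \<omega> = (G (x + shift \<tau> \<eta> t \<omega>) - G x)
     - (G (x + drift p n \<tau> \<eta> (clean t \<omega>)) - G x) - (G\<^sub>0 (x + jump t \<omega>) - G\<^sub>0 x)"

text \<open>On a hit the true distribution function is replaced by the normal one at cost \<open>r\<close>, which is affordable
because hits have probability of order \<open>q\<close>. The contaminated drift is split into the clean drift and the
outliers in the regressors.\<close>

lemma interaction_pointwise: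
  fixes \<tau> \<eta>
  defines "a \<equiv> weight p \<tau> \<eta> / (\<theta> * sqrt (real n))"
  shows "\<bar>interaction x \<tau> \<eta> t \<omega>\<bar>
    \<le> 2 * r * hit t \<omega> + (2 / \<theta>) * (hit t \<omega> * \<bar>drift p n \<tau> \<eta> (clean t \<omega>)\<bar>)
       + (\<Sum>j=1..p. min 1 (a * \<bar>outlier (t - int j) \<omega>\<bar>))"
proof -
  let ?h = "drift p n \<tau> \<eta> (clean t \<omega>)" and ?k = "drift p n \<tau> \<eta> (dirty t \<omega>)"
  let ?s = "\<Sum>j=1..p. min 1 (a * \<bar>outlier (t - int j) \<omega>\<bar>)"
  have a0: "0 \<le> a" unfolding a_def using weight_nonneg \<theta>_pos by simp
  have s0: "0 \<le> ?s" using a0 by (intro sum_nonneg) auto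
  show ?thesis
  proof (cases "hit t \<omega> = 0")
    case True
    have "interaction x \<tau> \<eta> t \<omega> = 0"
      unfolding interaction_def shift_no_hit[OF True] no_hit(1)[OF True] by simp
    thus ?thesis using True s0 by simp
  next
    case False
    hence hit: "hit t \<omega> = 1" by (auto simp: hit_def)
    have diff: "\<bar>?k - ?h\<bar> / \<theta> \<le> (\<Sum>j=1..p. a * \<bar>outlier (t - int j) \<omega>\<bar>)"
    proof -
      have "(\<Sum>j=0..p. \<bar>dirty t \<omega> j - clean t \<omega> j\<bar>) = (\<Sum>j=1..p. \<bar>outlier (t - int j) \<omega>\<bar>)"
        by (intro sum.mono_neutral_cong_right) (auto simp: dirty_def clean_def)
      hence "\<bar>?k - ?h\<bar> \<le> weight p \<tau> \<eta> * (\<Sum>j=1..p. \<bar>outlier (t - int j) \<omega>\<bar>) / sqrt (real n)"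
        using drift_difference_le[of p n \<tau> \<eta> "dirty t \<omega>" "clean t \<omega>"] by simp
      hence "\<bar>?k - ?h\<bar> / \<theta> \<le> weight p \<tau> \<eta> * (\<Sum>j=1..p. \<bar>outlier (t - int j) \<omega>\<bar>) / sqrt (real n) / \<theta>"
        using \<theta>_pos by (intro divide_right_mono) auto
      also have "\<dots> = (\<Sum>j=1..p. a * \<bar>outlier (t - int j) \<omega>\<bar>)"
        by (simp add: a_def sum_distrib_left sum_divide_distrib mult.commute)
      finally show ?thesis .
    qed
    have "min 1 (\<bar>?k\<bar> / \<theta>) \<le> \<bar>?h\<bar> / \<theta> + min 1 (\<bar>?k - ?h\<bar> / \<theta>)"
    proof -
      have "\<bar>?k\<bar> / \<theta> \<le> (\<bar>?h\<bar> + \<bar>?k - ?h\<bar>) / \<theta>" using \<theta>_pos by (intro divide_right_mono) auto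
      hence "\<bar>?k\<bar> / \<theta> \<le> \<bar>?h\<bar> / \<theta> + \<bar>?k - ?h\<bar> / \<theta>" by (simp add: add_divide_distrib)
      moreover have "0 \<le> \<bar>?h\<bar> / \<theta>" using \<theta>_pos by simp
      ultimately show ?thesis by linarith
    qed
    also have "min 1 (\<bar>?k - ?h\<bar> / \<theta>) \<le> min 1 (\<Sum>j=1..p. a * \<bar>outlier (t - int j) \<omega>\<bar>)"
      using diff by (intro min.mono) auto
    also have "\<dots> \<le> ?s" using a0 by (intro min_1_sum_le) auto
    finally have k: "min 1 (\<bar>?k\<bar> / \<theta>) \<le> \<bar>?h\<bar> / \<theta> + ?s" by simp
    have "\<bar>G\<^sub>0 (x + jump t \<omega> + ?k) - G\<^sub>0 (x + jump t \<omega>)\<bar> \<le> min 1 (\<bar>?k\<bar> / \<theta>)"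
      using scaled_normal_cdf_Lipschitz[OF \<theta>_pos, of "x + jump t \<omega> + ?k" "x + jump t \<omega>"]
        std_normal_cdf_bounds[of "(x + jump t \<omega> + ?k) / \<theta>"] std_normal_cdf_bounds[of "(x + jump t \<omega>) / \<theta>"]
      by auto
    moreover have "\<bar>G\<^sub>0 (x + ?h) - G\<^sub>0 x\<bar> \<le> \<bar>?h\<bar> / \<theta>"
      using scaled_normal_cdf_Lipschitz[OF \<theta>_pos, of "x + ?h" x] by simp
    moreover have "\<bar>G (x + shift \<tau> \<eta> t \<omega>) - G\<^sub>0 (x + jump t \<omega> + ?k)\<bar> \<le> r"
      using G_near_normal[of "x + shift \<tau> \<eta> t \<omega>"] by (simp add: shift_def add.assoc)
    moreover have "\<bar>G (x + ?h) - G\<^sub>0 (x + ?h)\<bar> \<le> r" by (rule G_near_normal)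
    moreover have "\<bar>(s - g) - (h' - g) - (j - u)\<bar> \<le> \<bar>k' - j\<bar> + \<bar>h0 - u\<bar> + \<bar>s - k'\<bar> + \<bar>h' - h0\<bar>"
      for s g h' j u k' h0 :: real by linarith
    ultimately have "\<bar>interaction x \<tau> \<eta> t \<omega>\<bar> \<le> min 1 (\<bar>?k\<bar> / \<theta>) + \<bar>?h\<bar> / \<theta> + r + r"
      unfolding interaction_def by (smt (verit))
    hence "\<bar>interaction x \<tau> \<eta> t \<omega>\<bar> \<le> (\<bar>?h\<bar> / \<theta> + ?s) + \<bar>?h\<bar> / \<theta> + r + r" using k by linarith
    thus ?thesis by (simp add: hit)
  qed
qed

text \<open>The free parameter \<open>\<kappa>\<close> balances the hit probability against the second moment of the drift; it will be
\<open>n\<^sup>-\<^sup>1\<^sup>/\<^sup>4\<close>.\<close>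

definition interaction_error :: "real \<Rightarrow> real \<Rightarrow> real" where
  "interaction_error \<kappa> W = 2 * r * (real (p + 1) * q)
     + (1 / \<theta>) * (\<kappa> * (real (p + 1) * q) + W\<^sup>2 * K / real n / \<kappa>)
     + real p * (q * truncated_outlier \<xi>_law (W / (\<theta> * sqrt (real n))))"

lemma
  assumes \<kappa>: "\<kappa> > 0"
  shows interaction_integrable: "integrable M (interaction x \<tau> \<eta> t)"
    and interaction_bound: "expectation (\<lambda>\<omega>. \<bar>interaction x \<tau> \<eta> t \<omega>\<bar>) \<le> interaction_error \<kappa> (weight p \<tau> \<eta>)"
proof -
  let ?h = "\<lambda>\<omega>. drift p n \<tau> \<eta> (clean t \<omega>)"
  define a where "a = weight p \<tau> \<eta> / (\<theta> * sqrt (real n))"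
  have a0: "0 \<le> a" unfolding a_def using weight_nonneg \<theta>_pos by simp
  define g where "g \<omega> = 2 * r * hit t \<omega> + (1 / \<theta>) * (\<kappa> * hit t \<omega> + (?h \<omega>)\<^sup>2 / \<kappa>)
     + (\<Sum>j=1..p. min 1 (a * \<bar>outlier (t - int j) \<omega>\<bar>))" for \<omega>
  have min_int: "integrable M (\<lambda>\<omega>. min 1 (a * \<bar>outlier s \<omega>\<bar>))" for s
    by (rule integrable_const_bound[of _ 1]) (use a0 in auto)
  have g: "integrable M g" unfolding g_def
    by (intro integrable_closure min_int hit_integrable drift_square_integrable)
  have min_E: "expectation (\<lambda>\<omega>. min 1 (a * \<bar>outlier s \<omega>\<bar>)) = q * truncated_outlier \<xi>_law a" for s
    unfolding truncated_outlier_def by (rule expectation_of_outlier[where C = 1]) (use a0 in auto)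
  have "expectation g = 2 * r * expectation (hit t) + (1 / \<theta>) * (\<kappa> * expectation (hit t) + expectation (\<lambda>\<omega>. (?h \<omega>)\<^sup>2) / \<kappa>)
      + (\<Sum>j=1..p. expectation (\<lambda>\<omega>. min 1 (a * \<bar>outlier (t - int j) \<omega>\<bar>)))"
    unfolding g_def by (simp add: hit_integrable drift_square_integrable min_int)
  also have "\<dots> = 2 * r * expectation (hit t) + (1 / \<theta>) * (\<kappa> * expectation (hit t) + expectation (\<lambda>\<omega>. (?h \<omega>)\<^sup>2) / \<kappa>)
      + real p * (q * truncated_outlier \<xi>_law a)"
    by (simp add: min_E)
  also have "\<dots> \<le> interaction_error \<kappa> (weight p \<tau> \<eta>)"
    unfolding interaction_error_def a_def[symmetric]
    using r_nonneg \<kappa> \<theta>_pos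
    by (intro add_mono mult_left_mono divide_right_mono expectation_hit drift_second_moment order_refl) auto
  finally have E: "expectation g \<le> interaction_error \<kappa> (weight p \<tau> \<eta>)" .
  have meas: "interaction x \<tau> \<eta> t \<in> borel_measurable M" unfolding interaction_def by measurable
  have dom: "AE \<omega> in M. \<bar>interaction x \<tau> \<eta> t \<omega>\<bar> \<le> g \<omega>"
  proof (rule AE_I2)
    fix \<omega>
    \<comment> \<open>arithmetic-geometric mean inequality; \<open>hit\<close> is its own square\<close>
    have "2 * (hit t \<omega> * \<bar>?h \<omega>\<bar>) \<le> \<kappa> * hit t \<omega> + (?h \<omega>)\<^sup>2 / \<kappa>"
    proof (cases "hit t \<omega> = 0")
      case False
      hence hit: "hit t \<omega> = 1" by (auto simp: hit_def)
      have "2 * \<kappa> * \<bar>?h \<omega>\<bar> \<le> \<kappa>\<^sup>2 + (?h \<omega>)\<^sup>2" using sum_squares_bound[of \<kappa> "\<bar>?h \<omega>\<bar>"] by simp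
      hence "2 * \<kappa> * \<bar>?h \<omega>\<bar> / \<kappa> \<le> (\<kappa>\<^sup>2 + (?h \<omega>)\<^sup>2) / \<kappa>" using \<kappa> by (intro divide_right_mono) auto
      thus ?thesis using \<kappa> by (simp add: hit add_divide_distrib power2_eq_square)
    qed (use \<kappa> in simp)
    hence "(1 / \<theta>) * (2 * (hit t \<omega> * \<bar>?h \<omega>\<bar>)) \<le> (1 / \<theta>) * (\<kappa> * hit t \<omega> + (?h \<omega>)\<^sup>2 / \<kappa>)"
      using \<theta>_pos by (intro mult_left_mono) auto
    moreover have "(1 / \<theta>) * (2 * (hit t \<omega> * \<bar>?h \<omega>\<bar>)) = (2 / \<theta>) * (hit t \<omega> * \<bar>?h \<omega>\<bar>)" by simp
    ultimately show "\<bar>interaction x \<tau> \<eta> t \<omega>\<bar> \<le> g \<omega>"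
      using interaction_pointwise[of x \<tau> \<eta> t \<omega>] unfolding g_def a_def by linarith
  qed
  show "integrable M (interaction x \<tau> \<eta> t)"
    and "expectation (\<lambda>\<omega>. \<bar>interaction x \<tau> \<eta> t \<omega>\<bar>) \<le> interaction_error \<kappa> (weight p \<tau> \<eta>)"
    using dominated_abs_expectation[OF meas g dom E] by auto
qed

definition clean_average :: "'a \<Rightarrow> real" where
  "clean_average \<omega> = (\<Sum>t=1..int n. \<Sum>j=0..p. \<bar>clean t \<omega> j\<bar>) / real n"

lemma
  shows clean_average_integrable: "integrable M clean_average"
    and clean_average_nonneg: "0 \<le> clean_average \<omega>"
    and clean_average_bound: "expectation clean_average \<le> real (p + 1) * K"
proof -
  show "integrable M clean_average"
    unfolding clean_average_def
    by (intro integrable_closure clean_integrable)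
  show "0 \<le> clean_average \<omega>" unfolding clean_average_def by (intro divide_nonneg_nonneg sum_nonneg) auto
  have "expectation clean_average = (\<Sum>t=1..int n. \<Sum>j=0..p. expectation (\<lambda>\<omega>. \<bar>clean t \<omega> j\<bar>)) / real n"
    unfolding clean_average_def by (simp add: clean_integrable)
  also have "\<dots> \<le> (\<Sum>t=1..int n. \<Sum>j=0..p. K) / real n"
    by (intro divide_right_mono sum_mono clean_abs_moment) auto
  also have "\<dots> = real (p + 1) * K" using n_pos by (simp add: field_simps)
  finally show "expectation clean_average \<le> real (p + 1) * K" .
qed

text \<open>The constant regressor contributes \<open>\<tau>\<^sub>0\<close>; the lagged ones average out by \<open>lagged_sum_bound\<close>.\<close>

lemma drift_average:
  fixes \<tau> \<eta>
  defines "A \<equiv> \<lambda>\<omega>. (\<Sum>t=1..int n. drift p n \<tau> \<eta> (clean t \<omega>)) / sqrt (real n) - \<tau> 0 - \<eta> * clean_average \<omega>"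
  shows "integrable M A"
    and "expectation (\<lambda>\<omega>. \<bar>A \<omega>\<bar>) \<le> weight p \<tau> \<eta> * C / sqrt (real n)"
proof -
  define L where "L j \<omega> = (\<Sum>t=1..int n. V (t - int j) \<omega>)" for j \<omega>
  have nn: "sqrt (real n) * sqrt (real n) = real n" by simp
  have n0: "real n > 0" using n_pos by simp
  have L: "integrable M (L j)" for j unfolding L_def by (intro integrable_closure V_integrable)
  have A_eq: "A \<omega> = (\<Sum>j=1..p. \<tau> j * L j \<omega>) / real n" for \<omega>
  proof -
    have "(\<Sum>t=1..int n. drift p n \<tau> \<eta> (clean t \<omega>)) / sqrt (real n)
        = (\<Sum>t=1..int n. (\<Sum>j=0..p. \<tau> j * clean t \<omega> j) + \<eta> * (\<Sum>j=0..p. \<bar>clean t \<omega> j\<bar>)) / real n"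
      unfolding drift_def sum.distrib sum_distrib_left sum_divide_distrib[symmetric] divide_divide_eq_left nn ..
    also have "\<dots> = (\<Sum>t=1..int n. \<Sum>j=0..p. \<tau> j * clean t \<omega> j) / real n + \<eta> * clean_average \<omega>"
      unfolding clean_average_def sum.distrib by (simp add: add_divide_distrib sum_distrib_left)
    also have "(\<Sum>t=1..int n. \<Sum>j=0..p. \<tau> j * clean t \<omega> j) = (\<Sum>j=0..p. \<tau> j * (\<Sum>t=1..int n. clean t \<omega> j))"
      by (subst sum.swap) (simp add: sum_distrib_left)
    also have "\<dots> = \<tau> 0 * real n + (\<Sum>j=1..p. \<tau> j * L j \<omega>)"
      by (subst sum.atLeast_Suc_atMost) (auto simp: clean_def L_def intro!: sum.cong)
    finally show ?thesis using n0 unfolding A_def by (simp add: add_divide_distrib)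
  qed
  have EL: "expectation (\<lambda>\<omega>. \<bar>L j \<omega>\<bar>) \<le> sqrt (real n) * C" if "j \<in> {1..p}" for j
    unfolding L_def
  proof (rule lagged_sum_bound[OF n_pos _ _ S])
    show "expectation (\<lambda>\<omega>. \<bar>V t \<omega>\<bar>) \<le> K" for t
      using clean_abs_moment[of "t + 1" 1] by (simp add: clean_def)
  qed (use that in simp)
  define g where "g \<omega> = (\<Sum>j=1..p. \<bar>\<tau> j\<bar> * \<bar>L j \<omega>\<bar>) / real n" for \<omega>
  have g: "integrable M g" unfolding g_def
    by (intro integrable_closure L)
  have dom: "AE \<omega> in M. \<bar>A \<omega>\<bar> \<le> g \<omega>"
    using sum_abs[of "\<lambda>j. \<tau> j * L j _" "{1..p}"]
    by (intro AE_I2) (simp add: A_eq g_def abs_mult divide_right_mono)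
  have meas: "A \<in> borel_measurable M" unfolding A_eq using L by measurable
  have "expectation g = (\<Sum>j=1..p. \<bar>\<tau> j\<bar> * expectation (\<lambda>\<omega>. \<bar>L j \<omega>\<bar>)) / real n"
    unfolding g_def by (simp add: L)
  also have "\<dots> \<le> (\<Sum>j=1..p. \<bar>\<tau> j\<bar> * (sqrt (real n) * C)) / real n"
    by (intro divide_right_mono sum_mono mult_left_mono EL) auto
  also have "\<dots> = (\<Sum>j=1..p. \<bar>\<tau> j\<bar>) * C / sqrt (real n)"
  proof -
    have "sqrt (real n) / real n = 1 / sqrt (real n)" using n0 by (simp add: field_simps)
    moreover have "(\<Sum>j=1..p. \<bar>\<tau> j\<bar> * (sqrt (real n) * C)) / real n
        = (\<Sum>j=1..p. \<bar>\<tau> j\<bar>) * C * (sqrt (real n) / real n)"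
      unfolding sum_distrib_right[symmetric] by simp
    ultimately show ?thesis by simp
  qed
  also have "\<dots> \<le> weight p \<tau> \<eta> * C / sqrt (real n)"
  proof (intro divide_right_mono mult_right_mono C_nonneg)
    have "(\<Sum>j=1..p. \<bar>\<tau> j\<bar>) \<le> (\<Sum>j=0..p. \<bar>\<tau> j\<bar>)" by (intro sum_mono2) auto
    also have "\<dots> \<le> weight p \<tau> \<eta>" unfolding weight_def by (intro sum_mono) auto
    finally show "(\<Sum>j=1..p. \<bar>\<tau> j\<bar>) \<le> weight p \<tau> \<eta>" .
  qed simp
  finally have E: "expectation g \<le> weight p \<tau> \<eta> * C / sqrt (real n)" .
  show "integrable M A" and "expectation (\<lambda>\<omega>. \<bar>A \<omega>\<bar>) \<le> weight p \<tau> \<eta> * C / sqrt (real n)"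
    using dominated_abs_expectation[OF meas g dom E] by auto
qed

definition process :: "real \<Rightarrow> (nat \<Rightarrow> real) \<Rightarrow> real \<Rightarrow> 'a \<Rightarrow> real" where
  "process x \<tau> \<eta> \<omega> = (\<Sum>t=1..int n. of_bool (\<epsilon> t \<omega> \<le> x + shift \<tau> \<eta> t \<omega>) - of_bool (\<epsilon> t \<omega> \<le> x)) / sqrt (real n)"

lemma process_measurable [measurable]: "process x \<tau> \<eta> \<in> borel_measurable M"
  unfolding process_def by measurable

definition process_error :: "real \<Rightarrow> real \<Rightarrow> real \<Rightarrow> real" where
  "process_error x \<kappa> W =
     sqrt (real (p + 1) * q + smooth_error x W + g\<^sub>0 x * (W * K / sqrt (real n)))
     + sqrt (real n) * interaction_error \<kappa> W + sqrt (real n) * smooth_error x W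
     + g\<^sub>0 x * (W * C / sqrt (real n))
     + sqrt (real n) * (real (p + 2) * (real (p + 1))\<^sup>2 * q\<^sup>2)
     + real (p + 1) * sqrt q"

text \<open>The process minus its limit is the sum of a martingale, the interaction, the Taylor remainder, the
deviation of the average drift, the error of treating the jump as additive over the lags, and the
fluctuation of the single jumps. Each is small in mean. The term with \<open>clean_average\<close> stays explicit:
it is the same random variable for every \<open>\<tau>\<close>, so that controlling it does not compete with the size
of the grid.\<close>

theorem process_approximation:
  assumes \<kappa>: "\<kappa> > 0" and xi: "real_distribution \<xi>_law"
  shows "expectation (\<lambda>\<omega>. \<bar>process x \<tau> \<eta> \<omega> - g\<^sub>0 x * \<tau> 0 - sqrt (real n) * q * Delta0 p \<beta> \<theta> \<xi>_law x
        - g\<^sub>0 x * (\<eta> * clean_average \<omega>)\<bar>)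
     \<le> process_error x \<kappa> (weight p \<tau> \<eta>)"
proof -
  interpret xi: real_distribution \<xi>_law by fact
  let ?W = "weight p \<tau> \<eta>" and ?s = "sqrt (real n)"
  let ?h = "\<lambda>t \<omega>. drift p n \<tau> \<eta> (clean t \<omega>)"
  define f where "f u = G\<^sub>0 (x + u) - G\<^sub>0 x" for u
  have f_meas [measurable]: "f \<in> borel_measurable borel" unfolding f_def by measurable
  have f_bdd: "\<bar>f u\<bar> \<le> 1" for u
    using std_normal_cdf_bounds[of "(x + u) / \<theta>"] std_normal_cdf_bounds[of "x / \<theta>"] unfolding f_def by linarith
  have f0: "f 0 = 0" by (simp add: f_def)
  let ?b = "\<beta>(0 := -1)"
  define fj where "fj j u = f (?b j * u)" for j u
  have fj: "fj j \<in> borel_measurable borel" "\<bar>fj j u\<bar> \<le> 1" "fj j 0 = 0" for j u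
    unfolding fj_def by (measurable, auto simp: f_bdd f0)
  define \<Delta> where "\<Delta> j = (\<integral>u. fj j u \<partial>\<xi>_law)" for j
  have Delta: "Delta0 p \<beta> \<theta> \<xi>_law x = (\<Sum>j=0..p. \<Delta> j)"
    unfolding Delta0_def \<Delta>_def fj_def f_def
  proof (intro sum.cong refl)
    fix j
    have "integrable \<xi>_law (\<lambda>u. G\<^sub>0 (x + ?b j * u))"
      by (rule xi.integrable_const_bound[of _ 1]) (use std_normal_cdf_bounds in auto)
    thus "(\<integral>u. G\<^sub>0 (x + ?b j * u) \<partial>\<xi>_law) - G\<^sub>0 x = (\<integral>u. G\<^sub>0 (x + ?b j * u) - G\<^sub>0 x \<partial>\<xi>_law)"
      using xi.prob_space by simp
  qed
  define Q1 where "Q1 \<omega> = (\<Sum>t=1..int n. compensated x (shift \<tau> \<eta>) t \<omega>) / ?s" for \<omega>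
  define Q2 where "Q2 \<omega> = (\<Sum>t=1..int n. interaction x \<tau> \<eta> t \<omega>) / ?s" for \<omega>
  define Q3 where "Q3 \<omega> = (\<Sum>t=1..int n. G (x + ?h t \<omega>) - G x - g\<^sub>0 x * ?h t \<omega>) / ?s" for \<omega>
  define Q4 where "Q4 \<omega> = (\<Sum>t=1..int n. ?h t \<omega>) / ?s - \<tau> 0 - \<eta> * clean_average \<omega>" for \<omega>
  define Q5 where "Q5 \<omega> = (\<Sum>t=1..int n. f (jump t \<omega>) - (\<Sum>j=0..p. f (?b j * outlier (t - int j) \<omega>))) / ?s" for \<omega>
  define Q6 where "Q6 j \<omega> = (\<Sum>t=1..int n. fj j (outlier (t - int j) \<omega>) - q * \<Delta> j) / ?s" for j \<omega>
  have n0: "real n > 0" using n_pos by simp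
  have decomposition: "process x \<tau> \<eta> \<omega> - g\<^sub>0 x * \<tau> 0 - ?s * q * Delta0 p \<beta> \<theta> \<xi>_law x
        - g\<^sub>0 x * (\<eta> * clean_average \<omega>)
      = Q1 \<omega> + Q2 \<omega> + Q3 \<omega> + g\<^sub>0 x * Q4 \<omega> + Q5 \<omega> + (\<Sum>j=0..p. Q6 j \<omega>)" for \<omega>
  proof -
    have eq: "of_bool (\<epsilon> t \<omega> \<le> x + shift \<tau> \<eta> t \<omega>) - of_bool (\<epsilon> t \<omega> \<le> x)
       = compensated x (shift \<tau> \<eta>) t \<omega> + interaction x \<tau> \<eta> t \<omega>
         + (G (x + ?h t \<omega>) - G x - g\<^sub>0 x * ?h t \<omega>) + g\<^sub>0 x * ?h t \<omega>
         + (f (jump t \<omega>) - (\<Sum>j=0..p. f (?b j * outlier (t - int j) \<omega>)))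
         + (\<Sum>j=0..p. fj j (outlier (t - int j) \<omega>) - q * \<Delta> j) + q * (\<Sum>j=0..p. \<Delta> j)" for t
      unfolding compensated_def interaction_def f_def[of "jump t \<omega>"] fj_def
      by (simp add: sum_subtractf sum_distrib_left)
    have gen: "(\<Sum>t=1..int n. a t + b t + c t + g * h t + d t + e t + D) / ?s
        = (\<Sum>t=1..int n. a t) / ?s + (\<Sum>t=1..int n. b t) / ?s + (\<Sum>t=1..int n. c t) / ?s
          + g * ((\<Sum>t=1..int n. h t) / ?s) + (\<Sum>t=1..int n. d t) / ?s + (\<Sum>t=1..int n. e t) / ?s
          + real n * D / ?s" for a b c h d e :: "int \<Rightarrow> real" and g D
      by (simp add: sum.distrib add_divide_distrib sum_distrib_left)
    have "process x \<tau> \<eta> \<omega> = Q1 \<omega> + Q2 \<omega> + Q3 \<omega> + g\<^sub>0 x * ((\<Sum>t=1..int n. ?h t \<omega>) / ?s) + Q5 \<omega>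
        + (\<Sum>t=1..int n. \<Sum>j=0..p. fj j (outlier (t - int j) \<omega>) - q * \<Delta> j) / ?s + real n * (q * (\<Sum>j=0..p. \<Delta> j)) / ?s"
      unfolding process_def Q1_def Q2_def Q3_def Q5_def eq by (rule gen)
    also have "(\<Sum>t=1..int n. \<Sum>j=0..p. fj j (outlier (t - int j) \<omega>) - q * \<Delta> j) / ?s = (\<Sum>j=0..p. Q6 j \<omega>)"
      unfolding Q6_def by (subst sum.swap) (simp add: sum_divide_distrib)
    also have "real n * (q * (\<Sum>j=0..p. \<Delta> j)) / ?s = ?s * q * Delta0 p \<beta> \<theta> \<xi>_law x"
      unfolding Delta using n0 by (simp add: field_simps)
    finally show ?thesis unfolding Q4_def by (simp only: right_diff_distrib)
  qed
  have comp_int: "integrable M (compensated x (shift \<tau> \<eta>) t)" for t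
    by (rule integrable_const_bound[of _ 2])
       (use compensated_bound compensated_measurable[where T = "shift \<tau> \<eta>" and t = t, OF shift_measurable_past] in auto)
  have Q1: "integrable M Q1" unfolding Q1_def
    by (intro integrable_closure comp_int)
  have E1: "expectation (\<lambda>\<omega>. \<bar>Q1 \<omega>\<bar>) \<le> sqrt (real (p + 1) * q + smooth_error x ?W + g\<^sub>0 x * (?W * K / ?s))"
    unfolding Q1_def by (rule compensated_sum_bound[OF n_pos shift_measurable_past shift_effect])
  have Q2: "integrable M Q2" and E2: "expectation (\<lambda>\<omega>. \<bar>Q2 \<omega>\<bar>) \<le> ?s * interaction_error \<kappa> ?W"
    unfolding Q2_def
    by (rule normalised_sum_abs_expectation[OF n_pos interaction_integrable[OF \<kappa>] interaction_bound[OF \<kappa>]])+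
  have Q3: "integrable M Q3" and E3: "expectation (\<lambda>\<omega>. \<bar>Q3 \<omega>\<bar>) \<le> ?s * smooth_error x ?W"
    unfolding Q3_def by (rule normalised_sum_abs_expectation[OF n_pos smooth_part])+
  have Q4: "integrable M Q4" and E4: "expectation (\<lambda>\<omega>. \<bar>Q4 \<omega>\<bar>) \<le> ?W * C / ?s"
    unfolding Q4_def by (rule drift_average)+
  have Q5: "integrable M Q5" and E5: "expectation (\<lambda>\<omega>. \<bar>Q5 \<omega>\<bar>) \<le> ?s * (real (p + 2) * (real (p + 1))\<^sup>2 * q\<^sup>2)"
    unfolding Q5_def
    by (rule normalised_sum_abs_expectation[OF n_pos jump_linearisation[OF f_meas f_bdd f0]])+
  have Q6: "integrable M (Q6 j)" for j
  proof -
    have [measurable]: "fj j \<in> borel_measurable borel" by (rule fj)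
    have "integrable M (\<lambda>\<omega>. fj j (outlier s \<omega>))" for s
      by (rule integrable_const_bound[of _ 1]) (use fj(2) in auto)
    thus ?thesis unfolding Q6_def by auto
  qed
  have E6: "expectation (\<lambda>\<omega>. \<bar>Q6 j \<omega>\<bar>) \<le> sqrt q" for j
    unfolding Q6_def \<Delta>_def by (rule single_jump_fluctuation[OF n_pos fj])
  have "expectation (\<lambda>\<omega>. \<bar>process x \<tau> \<eta> \<omega> - g\<^sub>0 x * \<tau> 0 - ?s * q * Delta0 p \<beta> \<theta> \<xi>_law x
        - g\<^sub>0 x * (\<eta> * clean_average \<omega>)\<bar>)
      \<le> expectation (\<lambda>\<omega>. \<bar>Q1 \<omega>\<bar> + \<bar>Q2 \<omega>\<bar> + \<bar>Q3 \<omega>\<bar> + g\<^sub>0 x * \<bar>Q4 \<omega>\<bar> + \<bar>Q5 \<omega>\<bar> + (\<Sum>j=0..p. \<bar>Q6 j \<omega>\<bar>))"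
    unfolding decomposition
  proof (rule integral_mono)
    fix \<omega>
    have "\<bar>g\<^sub>0 x * Q4 \<omega>\<bar> = g\<^sub>0 x * \<bar>Q4 \<omega>\<bar>" using g\<^sub>0_nonneg[of x] by (simp only: abs_mult abs_of_nonneg)
    moreover have "\<bar>\<Sum>j=0..p. Q6 j \<omega>\<bar> \<le> (\<Sum>j=0..p. \<bar>Q6 j \<omega>\<bar>)" by (rule sum_abs)
    ultimately show "\<bar>Q1 \<omega> + Q2 \<omega> + Q3 \<omega> + g\<^sub>0 x * Q4 \<omega> + Q5 \<omega> + (\<Sum>j=0..p. Q6 j \<omega>)\<bar>
       \<le> \<bar>Q1 \<omega>\<bar> + \<bar>Q2 \<omega>\<bar> + \<bar>Q3 \<omega>\<bar> + g\<^sub>0 x * \<bar>Q4 \<omega>\<bar> + \<bar>Q5 \<omega>\<bar> + (\<Sum>j=0..p. \<bar>Q6 j \<omega>\<bar>)"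
      by linarith
  qed (intro integrable_closure Q1 Q2 Q3 Q4 Q5 Q6)+
  also have "\<dots> = expectation (\<lambda>\<omega>. \<bar>Q1 \<omega>\<bar>) + expectation (\<lambda>\<omega>. \<bar>Q2 \<omega>\<bar>) + expectation (\<lambda>\<omega>. \<bar>Q3 \<omega>\<bar>)
      + g\<^sub>0 x * expectation (\<lambda>\<omega>. \<bar>Q4 \<omega>\<bar>) + expectation (\<lambda>\<omega>. \<bar>Q5 \<omega>\<bar>) + (\<Sum>j=0..p. expectation (\<lambda>\<omega>. \<bar>Q6 j \<omega>\<bar>))"
    by (simp add: Q1 Q2 Q3 Q4 Q5 Q6)
  also have "\<dots> \<le> sqrt (real (p + 1) * q + smooth_error x ?W + g\<^sub>0 x * (?W * K / ?s))
      + ?s * interaction_error \<kappa> ?W + ?s * smooth_error x ?W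
      + g\<^sub>0 x * (?W * C / ?s) + ?s * (real (p + 2) * (real (p + 1))\<^sup>2 * q\<^sup>2)
      + (\<Sum>j=0..p. sqrt q)"
    by (intro add_mono mult_left_mono sum_mono E1 E2 E3 E4 E5 E6 g\<^sub>0_nonneg)
  also have "\<dots> = process_error x \<kappa> ?W"
    unfolding process_error_def by simp
  finally show ?thesis .
qed

end

section \<open>From deterministic perturbations to estimators\<close>

text \<open>The error of \<open>process_approximation\<close> in terms of \<open>k = n\<^sup>-\<^sup>1\<^sup>/\<^sup>4\<close>, with \<open>q\<close> and \<open>r\<close> replaced by their bounds
\<open>\<Gamma> k\<^sup>2\<close> and \<open>R k\<^sup>2\<close>, and with the truncated outlier mean as a separate argument \<open>m\<close>.\<close>

definition error_bound :: "real \<Rightarrow> real \<Rightarrow> real \<Rightarrow> real \<Rightarrow> real \<Rightarrow> real \<Rightarrow> real \<Rightarrow> real \<Rightarrow> real \<Rightarrow> real \<Rightarrow> real \<Rightarrow> real \<Rightarrow> real" where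
  "error_bound P \<theta> D K C R \<Gamma> g h W m k =
     sqrt ((P + 1) * \<Gamma> * k\<^sup>2 + (D * (W\<^sup>2 * K) + R * (g + h) * (W * K)) * k ^ 4 + g * (W * K * k\<^sup>2))
     + (2 * R * (P + 1) * \<Gamma> * k\<^sup>2 + (1 / \<theta>) * ((P + 1) * \<Gamma> * k + W\<^sup>2 * K * k) + P * \<Gamma> * m)
     + (D * (W\<^sup>2 * K) + R * (g + h) * (W * K)) * k\<^sup>2
     + g * (W * C * k\<^sup>2)
     + (P + 2) * (P + 1)\<^sup>2 * \<Gamma>\<^sup>2 * k\<^sup>2
     + (P + 1) * sqrt (\<Gamma> * k\<^sup>2)"

lemma error_bound_tendsto_0:
  assumes "\<theta> \<noteq> 0" and "(m \<longlongrightarrow> 0) F" and "(k \<longlongrightarrow> 0) F"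
  shows "((\<lambda>i. error_bound P \<theta> D K C R \<Gamma> g h W (m i) (k i)) \<longlongrightarrow> 0) F"
  unfolding error_bound_def using assms(1) by (auto intro!: tendsto_eq_intros assms(2,3))

lemma truncated_outlier_tendsto_0:
  assumes L: "real_distribution L" and a: "a \<longlonglongrightarrow> 0" and a0: "\<And>n. 0 \<le> a n"
  shows "(\<lambda>n. truncated_outlier L (a n)) \<longlonglongrightarrow> 0"
proof -
  interpret real_distribution L by fact
  have "(\<lambda>n. \<integral>u. min 1 (a n * \<bar>u\<bar>) \<partial>L) \<longlonglongrightarrow> (\<integral>u. min 1 (0 * \<bar>u\<bar>) \<partial>L)"
  proof (rule integral_dominated_convergence[where w = "\<lambda>_. 1"])
    show "AE u in L. (\<lambda>n. min 1 (a n * \<bar>u\<bar>)) \<longlonglongrightarrow> min 1 (0 * \<bar>u\<bar>)"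
      by (intro AE_I2 tendsto_min tendsto_mult a tendsto_const)
  qed (use a0 in auto)
  thus ?thesis by (simp add: truncated_outlier_def)
qed

text \<open>The coefficient vector \<open>\<tau>\<close> for which the residuals are innovations with displaced thresholds. In
component 0 the estimated coefficients appear, so that the representation is exact.\<close>

definition estimation_error :: "nat \<Rightarrow> nat \<Rightarrow> real \<Rightarrow> (nat \<Rightarrow> real) \<Rightarrow> real \<Rightarrow> (nat \<Rightarrow> real) \<Rightarrow> nat \<Rightarrow> real" where
  "estimation_error p n \<mu> \<beta> m b j =
     (if j = 0 then sqrt (real n) * (m - \<mu>) * (1 - (\<Sum>i=1..p. b i)) else sqrt (real n) * (b j - \<beta> j))"

context local_alternative_ar
begin

lemma process_error_le:
  assumes k: "k > 0" and sk: "sqrt (real n) = 1 / k\<^sup>2" and q: "q \<le> \<Gamma> * k\<^sup>2" and r: "r \<le> R * k\<^sup>2"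
    and W: "0 \<le> W" and xi: "real_distribution \<xi>_law"
  shows "process_error x k W
     \<le> error_bound (real p) \<theta> (1 / \<theta>\<^sup>2 + B) K C R \<Gamma> (g\<^sub>0 x) \<bar>H' x\<bar> W (truncated_outlier \<xi>_law (W * k\<^sup>2 / \<theta>)) k"
proof -
  interpret xi: real_distribution \<xi>_law by fact
  define m where "m = truncated_outlier \<xi>_law (W * k\<^sup>2 / \<theta>)"
  have m0: "0 \<le> m" unfolding m_def truncated_outlier_def
    using W \<theta>_pos by (intro integral_nonneg_AE AE_I2) auto
  have "real n = (sqrt (real n))\<^sup>2" by simp
  hence nk: "real n = 1 / k ^ 4" unfolding sk by (simp add: power_divide flip: power_mult)
  have K0: "0 \<le> K" using K_ge_1 by simp
  define g where "g = g\<^sub>0 x"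
  define h where "h = \<bar>H' x\<bar>"
  define D where "D = 1 / \<theta>\<^sup>2 + B"
  have nonneg: "0 \<le> g" "0 \<le> h" "0 \<le> D" "0 \<le> W * K" "0 \<le> q" "0 \<le> r"
    unfolding g_def h_def D_def using g\<^sub>0_nonneg[of x] B_nonneg W K0 q_nonneg r_nonneg by auto
  let ?S = "D * (W\<^sup>2 * K) + R * (g + h) * (W * K)"
  have smooth: "smooth_error x W \<le> ?S * k ^ 4"
  proof -
    have "smooth_error x W = D * (W\<^sup>2 * K) * k ^ 4 + r * ((g + h) * (W * K) * k\<^sup>2)"
      unfolding smooth_error_def sk g_def[symmetric] h_def[symmetric] D_def[symmetric]
      unfolding nk by simp
    also have "\<dots> \<le> D * (W\<^sup>2 * K) * k ^ 4 + (R * k\<^sup>2) * ((g + h) * (W * K) * k\<^sup>2)"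
      using r nonneg W K0 by (intro add_left_mono mult_right_mono mult_nonneg_nonneg) auto
    also have "\<dots> = ?S * k ^ 4" by (simp add: algebra_simps eval_nat_numeral)
    finally show ?thesis .
  qed
  have sk': "W / (\<theta> * sqrt (real n)) = W * k\<^sup>2 / \<theta>" unfolding sk by simp
  have inter: "sqrt (real n) * interaction_error k W
      \<le> 2 * R * (real p + 1) * \<Gamma> * k\<^sup>2 + (1 / \<theta>) * ((real p + 1) * \<Gamma> * k + W\<^sup>2 * K * k) + real p * \<Gamma> * m"
  proof -
    have "interaction_error k W
       = 2 * r * (real (p + 1) * q) + (1 / \<theta>) * (k * (real (p + 1) * q) + W\<^sup>2 * K * k ^ 4 / k) + real p * (q * m)"
      unfolding interaction_error_def sk' m_def[symmetric] unfolding nk by simp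
    also have "\<dots> \<le> 2 * (R * k\<^sup>2) * (real (p + 1) * (\<Gamma> * k\<^sup>2))
        + (1 / \<theta>) * (k * (real (p + 1) * (\<Gamma> * k\<^sup>2)) + W\<^sup>2 * K * k ^ 4 / k) + real p * ((\<Gamma> * k\<^sup>2) * m)"
    proof -
      have "2 * r * (real (p + 1) * q) \<le> 2 * (R * k\<^sup>2) * (real (p + 1) * (\<Gamma> * k\<^sup>2))"
        using q r nonneg by (intro mult_mono) auto
      moreover have "(1 / \<theta>) * (k * (real (p + 1) * q) + W\<^sup>2 * K * k ^ 4 / k)
          \<le> (1 / \<theta>) * (k * (real (p + 1) * (\<Gamma> * k\<^sup>2)) + W\<^sup>2 * K * k ^ 4 / k)"
        using q \<theta>_pos k by (intro mult_left_mono add_right_mono) auto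
      moreover have "real p * (q * m) \<le> real p * ((\<Gamma> * k\<^sup>2) * m)"
        using q m0 by (intro mult_left_mono mult_right_mono) auto
      ultimately show ?thesis by linarith
    qed
    also have "\<dots> = k\<^sup>2 * (2 * R * (real p + 1) * \<Gamma> * k\<^sup>2
        + (1 / \<theta>) * ((real p + 1) * \<Gamma> * k + W\<^sup>2 * K * k) + real p * \<Gamma> * m)"
      using k by (simp add: algebra_simps eval_nat_numeral)
    finally show ?thesis
      using k unfolding sk by (simp add: field_simps)
  qed
  have s_smooth: "sqrt (real n) * smooth_error x W \<le> ?S * k\<^sup>2"
  proof -
    have "sqrt (real n) * smooth_error x W \<le> (1 / k\<^sup>2) * (?S * k ^ 4)"
      unfolding sk using smooth by (intro mult_left_mono) auto
    thus ?thesis using k by (simp add: eval_nat_numeral)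
  qed
  have double: "sqrt (real n) * (real (p + 2) * (real (p + 1))\<^sup>2 * q\<^sup>2) \<le> (real p + 2) * (real p + 1)\<^sup>2 * \<Gamma>\<^sup>2 * k\<^sup>2"
  proof -
    have "q\<^sup>2 \<le> (\<Gamma> * k\<^sup>2)\<^sup>2" using q nonneg by (intro power_mono) auto
    hence "sqrt (real n) * (real (p + 2) * (real (p + 1))\<^sup>2 * q\<^sup>2)
        \<le> (1 / k\<^sup>2) * (real (p + 2) * (real (p + 1))\<^sup>2 * (\<Gamma> * k\<^sup>2)\<^sup>2)"
      unfolding sk by (intro mult_left_mono) auto
    also have "\<dots> = (real p + 2) * (real p + 1)\<^sup>2 * \<Gamma>\<^sup>2 * k\<^sup>2"
      using k by (simp add: eval_nat_numeral add.commute)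
    finally show ?thesis .
  qed
  have "sqrt (real (p + 1) * q + smooth_error x W + g * (W * K / sqrt (real n)))
      \<le> sqrt ((real p + 1) * \<Gamma> * k\<^sup>2 + ?S * k ^ 4 + g * (W * K * k\<^sup>2))"
  proof (intro real_sqrt_le_mono add_mono smooth)
    show "real (p + 1) * q \<le> (real p + 1) * \<Gamma> * k\<^sup>2"
      using mult_left_mono[OF q, of "real (p + 1)"] by (simp add: algebra_simps)
  qed (simp add: sk)
  moreover have "real (p + 1) * sqrt q \<le> (real p + 1) * sqrt (\<Gamma> * k\<^sup>2)"
    using q nonneg by (intro mult_mono) auto
  moreover have "g * (W * C / sqrt (real n)) = g * (W * C * k\<^sup>2)" by (simp add: sk)
  ultimately show ?thesis
    unfolding process_error_def error_bound_def m_def[symmetric] g_def[symmetric] h_def[symmetric] D_def[symmetric]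
    using inter s_smooth double by linarith
qed

text \<open>The null set is the same for all values of the estimators, which may therefore depend on the sample.\<close>

lemma residual_eq:
  "AE \<omega> in M. \<forall>m b t. residual p m b (contaminated_obs v z \<xi> \<omega>) t
      = \<epsilon> t \<omega> - shift (estimation_error p n \<mu> \<beta> m b) 0 t \<omega>"
proof -
  have "AE \<omega> in M. \<forall>t. v t \<omega> - \<mu> = V t \<omega>"
    using causal_representation by (simp add: AE_all_countable)
  with V_recursion show ?thesis
  proof eventually_elim
    case (elim \<omega>)
    show ?case
    proof (intro allI)
      fix m b t
      let ?u = "\<lambda>j. V (t - int j) \<omega>" and ?w = "\<lambda>j. outlier (t - int j) \<omega>"
      have s0: "sqrt (real n) > 0" using n_pos by simp
      have obs: "contaminated_obs v z \<xi> \<omega> s - m = V s \<omega> + outlier s \<omega> - (m - \<mu>)" for s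
        using elim(2)[rule_format, of s] by (simp add: contaminated_obs_def outlier_def)
      have eps: "\<epsilon> t \<omega> = V t \<omega> - (\<Sum>j=1..p. \<beta> j * ?u j)" using elim(1)[rule_format, of t] by linarith
      have jump: "jump t \<omega> = - outlier t \<omega> + (\<Sum>j=1..p. \<beta> j * ?w j)"
        unfolding jump_def by (subst sum.atLeast_Suc_atMost) (auto intro!: sum.cong)
      have drift: "drift p n (estimation_error p n \<mu> \<beta> m b) 0 (dirty t \<omega>)
          = (m - \<mu>) * (1 - (\<Sum>j=1..p. b j)) + (\<Sum>j=1..p. (b j - \<beta> j) * (?u j + ?w j))"
      proof -
        have "(\<Sum>j=0..p. estimation_error p n \<mu> \<beta> m b j * dirty t \<omega> j)
           = sqrt (real n) * ((m - \<mu>) * (1 - (\<Sum>j=1..p. b j))) + (\<Sum>j=1..p. sqrt (real n) * ((b j - \<beta> j) * (?u j + ?w j)))"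
          by (subst sum.atLeast_Suc_atMost)
             (auto simp: estimation_error_def dirty_def mult.assoc intro!: sum.cong)
        also have "\<dots> = sqrt (real n) * ((m - \<mu>) * (1 - (\<Sum>j=1..p. b j)) + (\<Sum>j=1..p. (b j - \<beta> j) * (?u j + ?w j)))"
          by (simp add: sum_distrib_left distrib_left)
        finally show ?thesis unfolding drift_def using s0 by simp
      qed
      have "(\<Sum>j=1..p. b j * (contaminated_obs v z \<xi> \<omega> (t - int j) - m))
          = (\<Sum>j=1..p. \<beta> j * ?u j + \<beta> j * ?w j + (b j - \<beta> j) * (?u j + ?w j) - (m - \<mu>) * b j)"
        unfolding obs by (intro sum.cong refl) (simp add: algebra_simps)
      also have "\<dots> = (\<Sum>j=1..p. \<beta> j * ?u j) + (\<Sum>j=1..p. \<beta> j * ?w j)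
          + (\<Sum>j=1..p. (b j - \<beta> j) * (?u j + ?w j)) - (m - \<mu>) * (\<Sum>j=1..p. b j)"
        by (simp only: sum.distrib sum_subtractf sum_distrib_left)
      finally have sum: "(\<Sum>j=1..p. b j * (contaminated_obs v z \<xi> \<omega> (t - int j) - m))
          = (\<Sum>j=1..p. \<beta> j * ?u j) + (\<Sum>j=1..p. \<beta> j * ?w j)
          + (\<Sum>j=1..p. (b j - \<beta> j) * (?u j + ?w j)) - (m - \<mu>) * (\<Sum>j=1..p. b j)" .
      have prod: "(m - \<mu>) * (1 - (\<Sum>j=1..p. b j)) = (m - \<mu>) - (m - \<mu>) * (\<Sum>j=1..p. b j)"
        by (simp add: right_diff_distrib)
      show "residual p m b (contaminated_obs v z \<xi> \<omega>) t
          = \<epsilon> t \<omega> - shift (estimation_error p n \<mu> \<beta> m b) 0 t \<omega>"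
        unfolding residual_def shift_def eps jump drift obs[of t] sum using prod by linarith
    qed
  qed
qed

lemma empirical_difference:
  assumes "\<forall>t. residual p m b (contaminated_obs v z \<xi> \<omega>) t = \<epsilon> t \<omega> - shift \<tau> 0 t \<omega>"
  shows "sqrt (real n) * (empirical_cdf n (residual p m b (contaminated_obs v z \<xi> \<omega>)) y
           - empirical_cdf n (\<lambda>t. \<epsilon> t \<omega>) y) = process y \<tau> 0 \<omega>"
proof -
  have "(residual p m b (contaminated_obs v z \<xi> \<omega>) t \<le> y) = (\<epsilon> t \<omega> \<le> y + shift \<tau> 0 t \<omega>)" for t
    using assms[rule_format, of t] by linarith
  moreover have "sqrt (real n) * (a / real n - b / real n) = (a - b) / sqrt (real n)" for a b
    using n_pos by (simp add: field_simps)
  ultimately show ?thesis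
    unfolding empirical_cdf_def process_def by (simp add: sum_subtractf)
qed

text \<open>Changing each coefficient by at most \<open>\<eta>\<close> changes the threshold by no more than the margin.\<close>

lemma process_mono:
  assumes "\<And>j. j \<le> p \<Longrightarrow> \<bar>\<tau> j - \<sigma> j\<bar> \<le> \<eta>"
  shows "process y \<sigma> (- \<eta>) \<omega> \<le> process y \<tau> 0 \<omega>" and "process y \<tau> 0 \<omega> \<le> process y \<sigma> \<eta> \<omega>"
proof -
  have coeff: "\<sigma> j * d + (- \<eta>) * \<bar>d\<bar> \<le> \<tau> j * d + 0 * \<bar>d\<bar> \<and> \<tau> j * d + 0 * \<bar>d\<bar> \<le> \<sigma> j * d + \<eta> * \<bar>d\<bar>"
    if "j \<le> p" for j d
  proof -
    have "\<bar>(\<tau> j - \<sigma> j) * d\<bar> \<le> \<eta> * \<bar>d\<bar>"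
      using assms[OF that] by (simp add: abs_mult mult_right_mono)
    moreover have "(\<tau> j - \<sigma> j) * d = \<tau> j * d - \<sigma> j * d" by (simp add: algebra_simps)
    ultimately show ?thesis by (simp add: abs_le_iff)
  qed
  have "shift \<sigma> (- \<eta>) t \<omega> \<le> shift \<tau> 0 t \<omega>" "shift \<tau> 0 t \<omega> \<le> shift \<sigma> \<eta> t \<omega>" for t
    unfolding shift_def drift_def by (intro add_left_mono divide_right_mono sum_mono; use coeff in simp)+
  hence "(of_bool (\<epsilon> t \<omega> \<le> y + shift \<sigma> (- \<eta>) t \<omega>) :: real) \<le> of_bool (\<epsilon> t \<omega> \<le> y + shift \<tau> 0 t \<omega>)"
    "(of_bool (\<epsilon> t \<omega> \<le> y + shift \<tau> 0 t \<omega>) :: real) \<le> of_bool (\<epsilon> t \<omega> \<le> y + shift \<sigma> \<eta> t \<omega>)" for t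
    by (smt (verit) of_bool_eq(1) of_bool_eq(2))+
  thus "process y \<sigma> (- \<eta>) \<omega> \<le> process y \<tau> 0 \<omega>" and "process y \<tau> 0 \<omega> \<le> process y \<sigma> \<eta> \<omega>"
    unfolding process_def by (intro divide_right_mono sum_mono diff_mono; simp)+
qed

end

lemma estimation_error_bound:
  assumes n: "n \<ge> 1" and m: "\<bar>sqrt (real n) * (m - \<mu>)\<bar> \<le> Cm"
    and b: "\<bar>sqrt (real n) * L2_set (\<lambda>j. b j - \<beta> j) {1..p}\<bar> \<le> Cb"
    and T: "Cb \<le> T" "Cm * (1 + (\<Sum>j=1..p. \<bar>\<beta> j\<bar>) + real p * Cb) \<le> T"
    and j: "j \<le> p"
  shows "\<bar>estimation_error p n \<mu> \<beta> m b j\<bar> \<le> T"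
proof -
  have s1: "1 \<le> sqrt (real n)" using n by simp
  have Cm0: "0 \<le> Cm" using m by linarith
  have comp: "sqrt (real n) * \<bar>b i - \<beta> i\<bar> \<le> Cb" if "i \<in> {1..p}" for i
  proof -
    have "\<bar>b i - \<beta> i\<bar> \<le> L2_set (\<lambda>j. \<bar>b j - \<beta> j\<bar>) {1..p}"
      using member_le_L2_set[OF _ that, of "\<lambda>j. \<bar>b j - \<beta> j\<bar>"] by simp
    also have "\<dots> = L2_set (\<lambda>j. b j - \<beta> j) {1..p}" unfolding L2_set_def by simp
    finally have "sqrt (real n) * \<bar>b i - \<beta> i\<bar> \<le> sqrt (real n) * L2_set (\<lambda>j. b j - \<beta> j) {1..p}"
      by (intro mult_left_mono) auto
    thus ?thesis using b by linarith
  qed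
  show ?thesis
  proof (cases "j = 0")
    case True
    have "\<bar>1 - (\<Sum>i=1..p. b i)\<bar> \<le> 1 + (\<Sum>i=1..p. \<bar>\<beta> i\<bar>) + real p * Cb"
    proof -
      have "\<bar>\<Sum>i=1..p. b i\<bar> \<le> (\<Sum>i=1..p. \<bar>\<beta> i\<bar> + Cb)"
      proof (intro order_trans[OF sum_abs] sum_mono)
        fix i assume i: "i \<in> {1..p}"
        have "1 * \<bar>b i - \<beta> i\<bar> \<le> sqrt (real n) * \<bar>b i - \<beta> i\<bar>" using s1 by (intro mult_right_mono) auto
        moreover have "\<bar>b i\<bar> \<le> \<bar>\<beta> i\<bar> + \<bar>b i - \<beta> i\<bar>" by linarith
        ultimately show "\<bar>b i\<bar> \<le> \<bar>\<beta> i\<bar> + Cb" using comp[OF i] by simp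
      qed
      also have "\<dots> = (\<Sum>i=1..p. \<bar>\<beta> i\<bar>) + real p * Cb" by (simp add: sum.distrib)
      finally show ?thesis by linarith
    qed
    hence "\<bar>sqrt (real n) * (m - \<mu>)\<bar> * \<bar>1 - (\<Sum>i=1..p. b i)\<bar> \<le> Cm * (1 + (\<Sum>i=1..p. \<bar>\<beta> i\<bar>) + real p * Cb)"
      using m Cm0 by (intro mult_mono) auto
    thus ?thesis using True T(2) by (simp add: estimation_error_def abs_mult)
  next
    case False
    thus ?thesis using comp[of j] j T(1) by (simp add: estimation_error_def abs_mult)
  qed
qed

lemma ex_finite_grid:
  fixes T \<eta> :: real
  assumes "\<eta> > 0"
  shows "\<exists>F :: (nat \<Rightarrow> real) set. finite F \<and>
      (\<forall>\<tau>. (\<forall>j\<le>p. \<bar>\<tau> j\<bar> \<le> T) \<longrightarrow> (\<exists>\<sigma>\<in>F. \<forall>j\<le>p. \<bar>\<tau> j - \<sigma> j\<bar> \<le> \<eta>))"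
proof -
  define N where "N = \<lceil>T / \<eta>\<rceil> + 1"
  define F where "F = ({..p} \<rightarrow>\<^sub>E (\<lambda>i. \<eta> * of_int i) ` {-N..N})"
  have "finite F" unfolding F_def by (intro finite_PiE) auto
  moreover have "\<exists>\<sigma>\<in>F. \<forall>j\<le>p. \<bar>\<tau> j - \<sigma> j\<bar> \<le> \<eta>" if \<tau>: "\<forall>j\<le>p. \<bar>\<tau> j\<bar> \<le> T" for \<tau>
  proof (intro bexI allI impI)
    let ?i = "\<lambda>j. \<lfloor>\<tau> j / \<eta>\<rfloor>"
    let ?\<sigma> = "restrict (\<lambda>j. \<eta> * of_int (?i j)) {..p}"
    show "?\<sigma> \<in> F" unfolding F_def
    proof (intro restrict_PiE_iff[THEN iffD2] ballI imageI)
      fix j assume "j \<in> {..p}"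
      hence "\<bar>\<tau> j\<bar> / \<eta> \<le> T / \<eta>" using \<tau> assms by (intro divide_right_mono) auto
      hence "\<bar>\<tau> j / \<eta>\<bar> \<le> T / \<eta>" using assms by simp
      hence "\<bar>\<tau> j / \<eta>\<bar> \<le> of_int (N - 1)" unfolding N_def using le_of_int_ceiling[of "T / \<eta>"] by linarith
      hence "\<tau> j / \<eta> \<le> of_int (N - 1)" "- of_int (N - 1) \<le> \<tau> j / \<eta>" by linarith+
      thus "?i j \<in> {-N..N}" by (simp, linarith)
    qed
    fix j assume "j \<le> p"
    have "\<eta> * of_int (?i j) \<le> \<eta> * (\<tau> j / \<eta>)" "\<eta> * (\<tau> j / \<eta>) \<le> \<eta> * (of_int (?i j) + 1)"
      using assms by (intro mult_left_mono; linarith)+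
    hence "\<eta> * of_int (?i j) \<le> \<tau> j" "\<tau> j \<le> \<eta> * of_int (?i j) + \<eta>"
      using assms by (simp_all add: distrib_left)
    thus "\<bar>\<tau> j - ?\<sigma> j\<bar> \<le> \<eta>" using \<open>j \<le> p\<close> by simp
  qed
  ultimately show ?thesis by blast
qed

context local_alternative_ar
begin

text \<open>Outside four kinds of exceptional events (large error in \<open>\<mu>\<close>, large error in \<open>\<beta>\<close>, large average of
the clean regressors, failure of the expansion at some grid point) the process at the actual
estimation error is within \<open>\<delta>/2\<close> of its expansion at both \<open>x\<close> and \<open>-x\<close>. The terms \<open>g\<^sub>0(\<plusminus>x) \<tau>\<^sub>0\<close> are
equal and cancel.\<close>

lemma symmetrized_deviation:
  fixes mh :: "'a \<Rightarrow> real" and bh :: "nat \<Rightarrow> 'a \<Rightarrow> real" and x \<delta> A \<eta> \<kappa> :: real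
  defines "I \<equiv> \<lambda>F. F \<times> {\<eta>, - \<eta>} \<times> {x, - x}"
  assumes mh [measurable]: "mh \<in> borel_measurable M"
    and bh: "\<And>j. j \<in> {1..p} \<Longrightarrow> bh j \<in> borel_measurable M"
    and xi: "real_distribution \<xi>_law" and \<kappa>: "\<kappa> > 0" and \<delta>: "\<delta> > 0" and A: "A > 0" and \<eta>: "\<eta> > 0"
    and small: "g\<^sub>0 x * (\<eta> * (1 + A)) \<le> \<delta> / 4"
    and T: "Cb \<le> T" "Cm * (1 + (\<Sum>j=1..p. \<bar>\<beta> j\<bar>) + real p * Cb) \<le> T"
    and F: "finite F"
    and cover: "\<And>\<tau>. \<forall>j\<le>p. \<bar>\<tau> j\<bar> \<le> T \<Longrightarrow> \<exists>\<sigma>\<in>F. \<forall>j\<le>p. \<bar>\<tau> j - \<sigma> j\<bar> \<le> \<eta>"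
  shows "measure M {\<omega> \<in> space M.
      \<bar>sqrt (real n) *
         (symmetrize (empirical_cdf n (residual p (mh \<omega>) (\<lambda>j. bh j \<omega>) (contaminated_obs v z \<xi> \<omega>))) x
          - symmetrize (empirical_cdf n (\<lambda>t. \<epsilon> t \<omega>)) x)
       - sqrt (real n) * q * DeltaS p \<beta> \<theta> \<xi>_law x\<bar> > \<delta>}
    \<le> measure M {\<omega> \<in> space M. \<bar>sqrt (real n) * (mh \<omega> - \<mu>)\<bar> > Cm}
      + measure M {\<omega> \<in> space M. \<bar>sqrt (real n) * L2_set (\<lambda>j. bh j \<omega> - \<beta> j) {1..p}\<bar> > Cb}
      + real (p + 1) * K / A
      + (\<Sum>(\<sigma>, s, y)\<in>I F. process_error y \<kappa> (weight p \<sigma> s) / (\<delta> / 4))"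
    (is "measure M ?Ev \<le> measure M ?B1 + measure M ?B2 + _ + _")
proof -
  define dev where "dev = (\<lambda>(\<sigma>, s, y) \<omega>. \<bar>process y \<sigma> s \<omega> - g\<^sub>0 y * \<sigma> 0
      - sqrt (real n) * q * Delta0 p \<beta> \<theta> \<xi>_law y - g\<^sub>0 y * (s * clean_average \<omega>)\<bar>)"
  define B3 where "B3 = {\<omega> \<in> space M. clean_average \<omega> > A}"
  define B4 where "B4 i = {\<omega> \<in> space M. dev i \<omega> > \<delta> / 4}" for i
  have [measurable]: "clean_average \<in> borel_measurable M" using clean_average_integrable by auto
  have dev_meas [measurable]: "dev i \<in> borel_measurable M" for i
    unfolding dev_def by (cases i) simp
  have B1: "?B1 \<in> sets M" by measurable
  have [measurable]: "(\<lambda>\<omega>. L2_set (\<lambda>j. bh j \<omega> - \<beta> j) {1..p}) \<in> borel_measurable M"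
  proof -
    have [measurable]: "(\<lambda>\<omega>. \<Sum>j=1..p. (bh j \<omega> - \<beta> j)\<^sup>2) \<in> borel_measurable M"
      by (intro borel_measurable_sum borel_measurable_power borel_measurable_diff bh) auto
    show ?thesis unfolding L2_set_def by measurable
  qed
  have B2: "?B2 \<in> sets M" by measurable
  have B3: "B3 \<in> sets M" unfolding B3_def by measurable
  have B4: "B4 i \<in> sets M" for i unfolding B4_def by measurable
  have finI: "finite (I F)" unfolding I_def using F by simp
  have even: "g\<^sub>0 (- x) = g\<^sub>0 x" by (simp add: std_normal_density_def)
  have dev_int: "integrable M (dev i)" for i
  proof -
    obtain \<sigma> s y where i: "i = (\<sigma>, s, y)" by (cases i)
    have "integrable M (process y \<sigma> s)" unfolding process_def
      by (intro integrable_closure integrable_of_bool) measurable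
    thus ?thesis unfolding dev_def i by (simp add: clean_average_integrable)
  qed
  have sub: "AE \<omega> in M. \<omega> \<in> ?Ev \<longrightarrow> \<omega> \<in> ?B1 \<union> ?B2 \<union> B3 \<union> (\<Union>i\<in>I F. B4 i)"
    using residual_eq
  proof eventually_elim
    case (elim \<omega>)
    show ?case
    proof (rule impI, rule ccontr)
      assume Ev: "\<omega> \<in> ?Ev" and out: "\<omega> \<notin> ?B1 \<union> ?B2 \<union> B3 \<union> (\<Union>i\<in>I F. B4 i)"
      have sp: "\<omega> \<in> space M" using Ev by simp
      define \<tau> where "\<tau> = estimation_error p n \<mu> \<beta> (mh \<omega>) (\<lambda>j. bh j \<omega>)"
      have "\<forall>j\<le>p. \<bar>\<tau> j\<bar> \<le> T"
        unfolding \<tau>_def using out sp by (auto intro!: estimation_error_bound[OF n_pos _ _ T])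
      then obtain \<sigma> where \<sigma>: "\<sigma> \<in> F" "\<And>j. j \<le> p \<Longrightarrow> \<bar>\<tau> j - \<sigma> j\<bar> \<le> \<eta>" using cover by blast
      have avg: "clean_average \<omega> \<le> A" using out sp by (auto simp: B3_def)
      have close: "\<bar>process y \<tau> 0 \<omega> - (g\<^sub>0 x * \<tau> 0 + sqrt (real n) * q * Delta0 p \<beta> \<theta> \<xi>_law y)\<bar> \<le> \<delta> / 2"
        if y: "y \<in> {x, - x}" for y
      proof -
        define c where "c = sqrt (real n) * q * Delta0 p \<beta> \<theta> \<xi>_law y"
        have gy: "g\<^sub>0 y = g\<^sub>0 x" using y even by auto
        have dev: "dev (\<sigma>, s, y) \<omega> \<le> \<delta> / 4" if "s \<in> {\<eta>, - \<eta>}" for s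
        proof -
          have "(\<sigma>, s, y) \<in> I F" using \<sigma>(1) y that unfolding I_def by (intro SigmaI) auto
          hence "\<omega> \<notin> B4 (\<sigma>, s, y)" using out by blast
          thus ?thesis using sp by (simp add: B4_def)
        qed
        have up: "\<bar>process y \<sigma> \<eta> \<omega> - g\<^sub>0 x * \<sigma> 0 - c - g\<^sub>0 x * (\<eta> * clean_average \<omega>)\<bar> \<le> \<delta> / 4"
          and lo: "\<bar>process y \<sigma> (- \<eta>) \<omega> - g\<^sub>0 x * \<sigma> 0 - c - g\<^sub>0 x * (- \<eta> * clean_average \<omega>)\<bar> \<le> \<delta> / 4"
          using dev[of \<eta>] dev[of "- \<eta>"] unfolding dev_def c_def prod.case gy by simp_all
        have "g\<^sub>0 x * \<bar>\<tau> 0 - \<sigma> 0\<bar> \<le> g\<^sub>0 x * \<eta>" using \<sigma>(2)[of 0] g\<^sub>0_nonneg by (intro mult_left_mono) auto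
        hence "\<bar>g\<^sub>0 x * (\<tau> 0 - \<sigma> 0)\<bar> \<le> g\<^sub>0 x * \<eta>" using g\<^sub>0_nonneg[of x] by (simp only: abs_mult abs_of_nonneg)
        hence level: "\<bar>g\<^sub>0 x * \<tau> 0 - g\<^sub>0 x * \<sigma> 0\<bar> \<le> g\<^sub>0 x * \<eta>" by (simp only: right_diff_distrib)
        have "g\<^sub>0 x * (\<eta> * clean_average \<omega>) \<le> g\<^sub>0 x * (\<eta> * A)"
          using avg \<eta> g\<^sub>0_nonneg by (intro mult_left_mono) auto
        hence "g\<^sub>0 x * \<eta> + g\<^sub>0 x * (\<eta> * clean_average \<omega>) \<le> g\<^sub>0 x * \<eta> + g\<^sub>0 x * (\<eta> * A)" by simp
        also have "\<dots> = g\<^sub>0 x * (\<eta> * (1 + A))" by (simp only: distrib_left mult_1_right)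
        finally have sm: "g\<^sub>0 x * \<eta> + g\<^sub>0 x * (\<eta> * clean_average \<omega>) \<le> \<delta> / 4" using small by linarith
        have neg: "g\<^sub>0 x * (- \<eta> * clean_average \<omega>) = - (g\<^sub>0 x * (\<eta> * clean_average \<omega>))" by simp
        have "process y \<sigma> (- \<eta>) \<omega> \<le> process y \<tau> 0 \<omega>" "process y \<tau> 0 \<omega> \<le> process y \<sigma> \<eta> \<omega>"
          using process_mono[of \<tau> \<sigma> \<eta>, OF \<sigma>(2)] by auto
        thus ?thesis using up lo[unfolded neg] level sm unfolding c_def[symmetric] by linarith
      qed
      let ?E = "empirical_cdf n (residual p (mh \<omega>) (\<lambda>j. bh j \<omega>) (contaminated_obs v z \<xi> \<omega>))"
      let ?e = "empirical_cdf n (\<lambda>t. \<epsilon> t \<omega>)"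
      have emp: "sqrt (real n) * (?E y - ?e y) = process y \<tau> 0 \<omega>" for y
        using empirical_difference elim[rule_format] unfolding \<tau>_def by blast
      have "sqrt (real n) * (symmetrize ?E x - symmetrize ?e x)
          = (sqrt (real n) * (?E x - ?e x) - sqrt (real n) * (?E (- x) - ?e (- x))) / 2"
        unfolding symmetrize_def by (simp add: field_simps)
      hence "sqrt (real n) * (symmetrize ?E x - symmetrize ?e x) = (process x \<tau> 0 \<omega> - process (- x) \<tau> 0 \<omega>) / 2"
        unfolding emp .
      moreover have "sqrt (real n) * q * DeltaS p \<beta> \<theta> \<xi>_law x
          = (sqrt (real n) * q * Delta0 p \<beta> \<theta> \<xi>_law x - sqrt (real n) * q * Delta0 p \<beta> \<theta> \<xi>_law (- x)) / 2"
        unfolding DeltaS_def by (simp add: algebra_simps)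
      ultimately have "\<bar>sqrt (real n) * (symmetrize ?E x - symmetrize ?e x) - sqrt (real n) * q * DeltaS p \<beta> \<theta> \<xi>_law x\<bar> \<le> \<delta>"
        using close[of x] close[of "- x"] \<delta> by simp (smt (verit) field_sum_of_halves)
      thus False using Ev by simp
    qed
  qed
  have "measure M ?Ev \<le> measure M (?B1 \<union> ?B2 \<union> B3 \<union> (\<Union>i\<in>I F. B4 i))"
    by (rule measure_le_of_AE_imp[OF _ sub]) (intro sets.Un B1 B2 B3 sets.finite_UN finI B4)
  also have "\<dots> \<le> measure M ?B1 + measure M ?B2 + measure M B3 + (\<Sum>i\<in>I F. measure M (B4 i))"
  proof -
    have U: "(\<Union>i\<in>I F. B4 i) \<in> sets M" by (intro sets.finite_UN finI B4)
    have "measure M (\<Union>i\<in>I F. B4 i) \<le> (\<Sum>i\<in>I F. measure M (B4 i))"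
      by (rule finite_measure_subadditive_finite[OF finI]) (use B4 in auto)
    thus ?thesis
      using measure_Un_le[OF sets.Un[OF sets.Un[OF B1 B2] B3] U]
        measure_Un_le[OF sets.Un[OF B1 B2] B3] measure_Un_le[OF B1 B2] by linarith
  qed
  also have "measure M B3 \<le> real (p + 1) * K / A"
    unfolding B3_def
    by (rule Markov_strict[OF clean_average_integrable clean_average_nonneg clean_average_bound A])
  also have "(\<Sum>i\<in>I F. measure M (B4 i)) \<le> (\<Sum>(\<sigma>, s, y)\<in>I F. process_error y \<kappa> (weight p \<sigma> s) / (\<delta> / 4))"
  proof (intro sum_mono)
    fix i :: "(nat \<Rightarrow> real) \<times> real \<times> real"
    obtain \<sigma> s y where i: "i = (\<sigma>, s, y)" by (cases i)
    have "measure M (B4 i) \<le> process_error y \<kappa> (weight p \<sigma> s) / (\<delta> / 4)"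
      unfolding B4_def
    proof (rule Markov_strict[OF dev_int])
      show "expectation (dev i) \<le> process_error y \<kappa> (weight p \<sigma> s)"
        using process_approximation[OF \<kappa> xi, of y \<sigma> s] by (simp add: dev_def i)
      show "0 \<le> dev i \<omega>" for \<omega> by (simp add: dev_def i)
    qed (use \<delta> in simp)
    thus "measure M (B4 i) \<le> (case i of (\<sigma>, s, y) \<Rightarrow> process_error y \<kappa> (weight p \<sigma> s) / (\<delta> / 4))"
      by (simp add: i)
  qed
  finally show ?thesis by simp
qed

end

section \<open>Symmetrised empirical distribution functions under the local alternative\<close>

theorem corollary2p1:
  fixes p :: nat and \<beta> :: "nat \<Rightarrow> real" and \<nu> \<mu> \<theta>\<^sub>0 :: real
    and H H' H'' :: "real \<Rightarrow> real" and H_law \<xi>_law :: "real measure"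
    and M :: "nat \<Rightarrow> real \<Rightarrow> real \<Rightarrow> 'a measure"
    and \<epsilon> v z \<xi> :: "nat \<Rightarrow> real \<Rightarrow> real \<Rightarrow> int \<Rightarrow> 'a \<Rightarrow> real"
    and \<mu>hat :: "nat \<Rightarrow> real \<Rightarrow> real \<Rightarrow> 'a \<Rightarrow> real"
    and \<beta>hat :: "nat \<Rightarrow> real \<Rightarrow> real \<Rightarrow> nat \<Rightarrow> 'a \<Rightarrow> real"
  assumes "1 \<le> p"
    and "char_roots_in_unit_disc p \<beta>"
    and "\<nu> = (1 - (\<Sum>j=1..p. \<beta> j)) * \<mu>"
    and "\<theta>\<^sub>0 > 0"
    and "real_distribution \<xi>_law"
    and "real_distribution H_law" and "H = cdf H_law"
    and "integrable H_law (\<lambda>x. x)" and "(\<integral>x. x \<partial>H_law) = 0"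
    and "integrable H_law (\<lambda>x. x\<^sup>2)"
    and "\<And>x. (H has_real_derivative H' x) (at x)"
    and "\<And>x. (H' has_real_derivative H'' x) (at x)"
    and "bounded (range H'')"
    and model: "\<And>n \<rho> \<gamma>. n \<ge> 1 \<Longrightarrow> \<rho> \<ge> 0 \<Longrightarrow> \<gamma> \<ge> 0 \<Longrightarrow>
      contaminated_ar (M n \<rho> \<gamma>) p \<beta> \<nu> (local_alternative_cdf \<theta>\<^sub>0 H \<rho> n) (root_n_rate n \<gamma>) \<xi>_law
        (\<epsilon> n \<rho> \<gamma>) (v n \<rho> \<gamma>) (z n \<rho> \<gamma>) (\<xi> n \<rho> \<gamma>)"
    and "\<And>n \<rho> \<gamma>. n \<ge> 1 \<Longrightarrow> \<rho> \<ge> 0 \<Longrightarrow> \<gamma> \<ge> 0 \<Longrightarrow>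
      \<mu>hat n \<rho> \<gamma> \<in> borel_measurable (M n \<rho> \<gamma>)"
    and "\<And>n \<rho> \<gamma> j. n \<ge> 1 \<Longrightarrow> \<rho> \<ge> 0 \<Longrightarrow> \<gamma> \<ge> 0 \<Longrightarrow> j \<in> {1..p} \<Longrightarrow>
      \<beta>hat n \<rho> \<gamma> j \<in> borel_measurable (M n \<rho> \<gamma>)"
    and "\<And>R \<Gamma>. R \<ge> 0 \<Longrightarrow> \<Gamma> \<ge> 0 \<Longrightarrow>
      uniform_OP1 M R \<Gamma> (\<lambda>n \<rho> \<gamma> \<omega>. sqrt (real n) * (\<mu>hat n \<rho> \<gamma> \<omega> - \<mu>))"
    and "\<And>R \<Gamma>. R \<ge> 0 \<Longrightarrow> \<Gamma> \<ge> 0 \<Longrightarrow>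
      uniform_OP1 M R \<Gamma>
        (\<lambda>n \<rho> \<gamma> \<omega>. sqrt (real n) * L2_set (\<lambda>j. \<beta>hat n \<rho> \<gamma> j \<omega> - \<beta> j) {1..p})"
  shows "\<forall>R\<ge>0. \<forall>\<Gamma>\<ge>0. \<forall>x. \<forall>\<delta>>0.
    (\<lambda>n. SUP (\<rho>, \<gamma>)\<in>{0..R} \<times> {0..\<Gamma>}.
       measure (M n \<rho> \<gamma>) {\<omega> \<in> space (M n \<rho> \<gamma>).
         \<bar>sqrt (real n) *
            (symmetrize (empirical_cdf n
               (residual p (\<mu>hat n \<rho> \<gamma> \<omega>) (\<lambda>j. \<beta>hat n \<rho> \<gamma> j \<omega>)
                  (contaminated_obs (v n \<rho> \<gamma>) (z n \<rho> \<gamma>) (\<xi> n \<rho> \<gamma>) \<omega>))) x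
             - symmetrize (empirical_cdf n (\<lambda>t. \<epsilon> n \<rho> \<gamma> t \<omega>)) x)
          - \<gamma> * DeltaS p \<beta> \<theta>\<^sub>0 \<xi>_law x\<bar> > \<delta>})
    \<longlonglongrightarrow> 0"
proof (intro allI impI)
  fix R \<Gamma> x \<delta> :: real
  assume R: "0 \<le> R" and \<Gamma>: "0 \<le> \<Gamma>" and \<delta>: "0 < \<delta>"
  note \<theta> = \<open>\<theta>\<^sub>0 > 0\<close>
  obtain \<psi> :: "nat \<Rightarrow> real" where \<psi>: "\<psi> 0 = 1"
    "\<And>m. m > 0 \<Longrightarrow> \<psi> m = (\<Sum>j=1..p. if j \<le> m then \<beta> j * \<psi> (m - j) else 0)"
    "summable (\<lambda>k. \<bar>\<psi> k\<bar>)"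
    using ex_summable_ma_coefficients[OF \<open>char_roots_in_unit_disc p \<beta>\<close>] by blast
  obtain B where B: "\<And>x. \<bar>H'' x\<bar> \<le> B"
    using \<open>bounded (range H'')\<close> unfolding bounded_iff by auto
  define S where "S = \<theta>\<^sub>0\<^sup>2 + (\<integral>x. x\<^sup>2 \<partial>H_law)"
  define K where "K = regressor_moment_bound \<psi> S"
  define C where "C = lagged_sum_constant p \<beta> S K"
  define g where "g x = std_normal_density (x / \<theta>\<^sub>0) / \<theta>\<^sub>0" for x
  interpret H: real_distribution H_law by fact
  have rate: "0 \<le> root_n_rate n a" "root_n_rate n a \<le> 1" "root_n_rate n a \<le> a / sqrt (real n)"
    if "0 \<le> a" for n a using that by (auto simp: root_n_rate_def)
  have alternative: "local_alternative_ar (M n \<rho> \<gamma>) p \<beta> \<nu> (local_alternative_cdf \<theta>\<^sub>0 H \<rho> n) (root_n_rate n \<gamma>) \<xi>_law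
      (\<epsilon> n \<rho> \<gamma>) (v n \<rho> \<gamma>) (z n \<rho> \<gamma>) (\<xi> n \<rho> \<gamma>) \<mu> \<psi> n \<theta>\<^sub>0 (root_n_rate n \<rho>) S B H H' H''"
    if n: "n \<ge> 1" and \<rho>: "\<rho> \<ge> 0" and \<gamma>: "\<gamma> \<ge> 0" for n \<rho> \<gamma>
  proof -
    interpret contaminated_ar "M n \<rho> \<gamma>" p \<beta> \<nu> "local_alternative_cdf \<theta>\<^sub>0 H \<rho> n" "root_n_rate n \<gamma>" \<xi>_law
      "\<epsilon> n \<rho> \<gamma>" "v n \<rho> \<gamma>" "z n \<rho> \<gamma>" "\<xi> n \<rho> \<gamma>"
      by (rule model[OF n \<rho> \<gamma>])
    let ?L = "distr (M n \<rho> \<gamma>) borel (\<epsilon> n \<rho> \<gamma> 1)"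
    have "ennreal (expectation (\<lambda>\<omega>. (\<epsilon> n \<rho> \<gamma> 1 \<omega>)\<^sup>2)) = (\<integral>\<^sup>+\<omega>. ennreal ((\<epsilon> n \<rho> \<gamma> 1 \<omega>)\<^sup>2) \<partial>M n \<rho> \<gamma>)"
      by (rule nn_integral_eq_integral[symmetric, OF innovation_square_integrable]) simp
    also have "\<dots> = (\<integral>\<^sup>+x. ennreal (x\<^sup>2) \<partial>?L)" by (subst nn_integral_distr) auto
    also have "\<dots> \<le> ennreal S" unfolding S_def
    proof (rule second_moment_local_alternative_le[OF _ \<open>real_distribution H_law\<close> rate(1,2)[OF \<rho>] \<theta>])
      show "cdf ?L x = (1 - root_n_rate n \<rho>) * std_normal_cdf (x / \<theta>\<^sub>0) + root_n_rate n \<rho> * cdf H_law x" for x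
        by (simp add: innovation_cdf local_alternative_cdf_def \<open>H = cdf H_law\<close>)
    qed (use \<open>integrable H_law (\<lambda>x. x\<^sup>2)\<close> in auto)
    finally have S: "expectation (\<lambda>\<omega>. (\<epsilon> n \<rho> \<gamma> 1 \<omega>)\<^sup>2) \<le> S"
      by (subst (asm) ennreal_le_iff) (auto simp: S_def intro!: add_nonneg_nonneg integral_nonneg_AE)
    show ?thesis
    proof (intro local_alternative_ar.intro stable_contaminated_ar.intro
        stable_contaminated_ar_axioms.intro local_alternative_ar_axioms.intro)
      show "0 \<le> H x" "H x \<le> 1" for x
        unfolding \<open>H = cdf H_law\<close> by (rule H.cdf_nonneg, rule H.cdf_bounded_prob)
      show "local_alternative_cdf \<theta>\<^sub>0 H \<rho> n x
          = (1 - root_n_rate n \<rho>) * std_normal_cdf (x / \<theta>\<^sub>0) + root_n_rate n \<rho> * H x" for x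
        by (rule local_alternative_cdf_def)
    qed (fact model[OF n \<rho> \<gamma>] assms(2,3) \<psi> n \<theta> rate(1,2)[OF \<rho>] S assms(11,12) B)+
  qed
  define P where "P n \<rho> \<gamma> = measure (M n \<rho> \<gamma>) {\<omega> \<in> space (M n \<rho> \<gamma>).
         \<bar>sqrt (real n) *
            (symmetrize (empirical_cdf n
               (residual p (\<mu>hat n \<rho> \<gamma> \<omega>) (\<lambda>j. \<beta>hat n \<rho> \<gamma> j \<omega>)
                  (contaminated_obs (v n \<rho> \<gamma>) (z n \<rho> \<gamma>) (\<xi> n \<rho> \<gamma>) \<omega>))) x
             - symmetrize (empirical_cdf n (\<lambda>t. \<epsilon> n \<rho> \<gamma> t \<omega>)) x)
          - \<gamma> * DeltaS p \<beta> \<theta>\<^sub>0 \<xi>_law x\<bar> > \<delta>}" for n \<rho> \<gamma>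
  have uniform: "\<forall>\<^sub>F n in sequentially. \<forall>\<rho>\<in>{0..R}. \<forall>\<gamma>\<in>{0..\<Gamma>}. P n \<rho> \<gamma> \<le> 4 * e" if e: "e > 0" for e
  proof -
    obtain Cm where Cm: "\<forall>\<^sub>F n in sequentially. \<forall>\<rho>\<in>{0..R}. \<forall>\<gamma>\<in>{0..\<Gamma>}.
        measure (M n \<rho> \<gamma>) {\<omega> \<in> space (M n \<rho> \<gamma>). \<bar>sqrt (real n) * (\<mu>hat n \<rho> \<gamma> \<omega> - \<mu>)\<bar> > Cm} \<le> e"
      using assms(17)[OF R \<Gamma>] e unfolding uniform_OP1_def by blast
    obtain Cb where Cb: "\<forall>\<^sub>F n in sequentially. \<forall>\<rho>\<in>{0..R}. \<forall>\<gamma>\<in>{0..\<Gamma>}.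
        measure (M n \<rho> \<gamma>) {\<omega> \<in> space (M n \<rho> \<gamma>).
          \<bar>sqrt (real n) * L2_set (\<lambda>j. \<beta>hat n \<rho> \<gamma> j \<omega> - \<beta> j) {1..p}\<bar> > Cb} \<le> e"
      using assms(18)[OF R \<Gamma>] e unfolding uniform_OP1_def by blast
    define T where "T = max Cb (Cm * (1 + (\<Sum>j=1..p. \<bar>\<beta> j\<bar>) + real p * Cb))"
    have "0 \<le> S" unfolding S_def by (intro add_nonneg_nonneg integral_nonneg_AE) auto
    hence K: "1 \<le> K" unfolding K_def regressor_moment_bound_def by simp
    \<comment> \<open>The order of choices matters: first the bound \<open>A\<close> for the average regressor, then the grid width
      \<open>\<eta>\<close> that makes the margins harmless below \<open>A\<close>, then the finite grid, and only then \<open>n\<close>.\<close>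
    define A where "A = real (p + 1) * K / e"
    have A: "A > 0" unfolding A_def using K e by simp
    have gx: "g x > 0" unfolding g_def using \<theta> by (simp add: normal_density_pos)
    define \<eta> where "\<eta> = \<delta> / 4 / (g x * (1 + A))"
    have \<eta>: "\<eta> > 0" unfolding \<eta>_def using \<delta> A gx by simp
    have small: "g x * (\<eta> * (1 + A)) \<le> \<delta> / 4"
      using gx A unfolding \<eta>_def by simp
    obtain F :: "(nat \<Rightarrow> real) set" where F: "finite F"
      and cover: "\<And>\<tau>. \<forall>j\<le>p. \<bar>\<tau> j\<bar> \<le> T \<Longrightarrow> \<exists>\<sigma>\<in>F. \<forall>j\<le>p. \<bar>\<tau> j - \<sigma> j\<bar> \<le> \<eta>"
      using ex_finite_grid[OF \<eta>, of p T] by blast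
    define k where "k n = 1 / sqrt (sqrt (real n))" for n :: nat
    define err where "err y W n = error_bound (real p) \<theta>\<^sub>0 (1 / \<theta>\<^sub>0\<^sup>2 + B) K C R \<Gamma> (g y) \<bar>H' y\<bar> W
        (truncated_outlier \<xi>_law (W * (k n)\<^sup>2 / \<theta>\<^sub>0)) (k n)" for y W n
    have k0: "k \<longlonglongrightarrow> 0" unfolding k_def by real_asymp
    have err0: "err y W \<longlonglongrightarrow> 0" if "0 \<le> W" for y W
      unfolding err_def[abs_def]
    proof (rule error_bound_tendsto_0[OF _ truncated_outlier_tendsto_0[OF \<open>real_distribution \<xi>_law\<close>] k0])
      show "(\<lambda>n. W * (k n)\<^sup>2 / \<theta>\<^sub>0) \<longlonglongrightarrow> 0" using \<theta> by (auto intro!: tendsto_eq_intros k0)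
    qed (use \<theta> that in auto)
    have "(\<lambda>n. \<Sum>(\<sigma>, s, y)\<in>F \<times> {\<eta>, - \<eta>} \<times> {x, - x}. err y (weight p \<sigma> s) n / (\<delta> / 4)) \<longlonglongrightarrow>
        (\<Sum>(\<sigma>, s, y)\<in>F \<times> {\<eta>, - \<eta>} \<times> {x, - x}. 0 / (\<delta> / 4))"
      using \<delta> unfolding case_prod_beta
      by (intro tendsto_sum tendsto_divide err0 weight_nonneg tendsto_const) auto
    hence "\<forall>\<^sub>F n in sequentially. (\<Sum>(\<sigma>, s, y)\<in>F \<times> {\<eta>, - \<eta>} \<times> {x, - x}. err y (weight p \<sigma> s) n / (\<delta> / 4)) < e"
      using e by (intro order_tendstoD(2)) (auto simp: case_prod_beta)
    moreover have "\<forall>\<^sub>F n in sequentially. real n \<ge> \<Gamma>\<^sup>2"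
      by (rule eventually_compose_filterlim[OF eventually_ge_at_top filterlim_real_sequentially])
    ultimately show ?thesis
      using Cm Cb eventually_ge_at_top[of 1]
    proof eventually_elim
      case (elim n)
      show ?case
      proof (intro ballI)
        fix \<rho> \<gamma> assume \<rho>: "\<rho> \<in> {0..R}" and \<gamma>: "\<gamma> \<in> {0..\<Gamma>}"
        have n: "n \<ge> 1" using elim by simp
        have nonneg: "0 \<le> \<rho>" "0 \<le> \<gamma>" using \<rho> \<gamma> by auto
        interpret A: local_alternative_ar "M n \<rho> \<gamma>" p \<beta> \<nu> "local_alternative_cdf \<theta>\<^sub>0 H \<rho> n" "root_n_rate n \<gamma>" \<xi>_law
          "\<epsilon> n \<rho> \<gamma>" "v n \<rho> \<gamma>" "z n \<rho> \<gamma>" "\<xi> n \<rho> \<gamma>" \<mu> \<psi> n \<theta>\<^sub>0 "root_n_rate n \<rho>" S B H H' H''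
          by (rule alternative[OF n nonneg])
        have kn: "k n > 0" unfolding k_def using n by simp
        have sk: "sqrt (real n) = 1 / (k n)\<^sup>2" unfolding k_def by (simp add: power_divide)
        have rates: "root_n_rate n \<gamma> \<le> \<Gamma> * (k n)\<^sup>2" "root_n_rate n \<rho> \<le> R * (k n)\<^sup>2"
        proof -
          have "a / sqrt (real n) \<le> b * (k n)\<^sup>2" if "a \<le> b" for a b
            using that kn unfolding sk by (simp add: mult_right_mono)
          thus "root_n_rate n \<gamma> \<le> \<Gamma> * (k n)\<^sup>2" "root_n_rate n \<rho> \<le> R * (k n)\<^sup>2"
            using rate(3)[OF nonneg(1), of n] rate(3)[OF nonneg(2), of n] \<rho> \<gamma> by fastforce+
        qed
        have "\<gamma> \<le> sqrt (real n)" using \<gamma> \<Gamma> elim(2) real_le_rsqrt[of \<Gamma> "real n"] by simp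
        hence \<gamma>_eq: "sqrt (real n) * root_n_rate n \<gamma> = \<gamma>"
          using n by (simp add: root_n_rate_def min_def field_simps)
        have errors: "A.process_error y (k n) (weight p \<sigma> s) \<le> err y (weight p \<sigma> s) n" for y \<sigma> s
          unfolding err_def g_def K_def C_def
          by (rule A.process_error_le[OF kn sk rates weight_nonneg \<open>real_distribution \<xi>_law\<close>])
        have "P n \<rho> \<gamma> \<le> measure (M n \<rho> \<gamma>) {\<omega> \<in> space (M n \<rho> \<gamma>). \<bar>sqrt (real n) * (\<mu>hat n \<rho> \<gamma> \<omega> - \<mu>)\<bar> > Cm}
            + measure (M n \<rho> \<gamma>) {\<omega> \<in> space (M n \<rho> \<gamma>). \<bar>sqrt (real n) * L2_set (\<lambda>j. \<beta>hat n \<rho> \<gamma> j \<omega> - \<beta> j) {1..p}\<bar> > Cb}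
            + real (p + 1) * K / A
            + (\<Sum>(\<sigma>, s, y)\<in>F \<times> {\<eta>, - \<eta>} \<times> {x, - x}. A.process_error y (k n) (weight p \<sigma> s) / (\<delta> / 4))"
          unfolding P_def K_def
          using A.symmetrized_deviation[where mh = "\<mu>hat n \<rho> \<gamma>" and bh = "\<beta>hat n \<rho> \<gamma>" and T = T and F = F,
              OF assms(15)[OF n nonneg] assms(16)[OF n nonneg] \<open>real_distribution \<xi>_law\<close> kn \<delta> A \<eta>
                small[unfolded g_def] _ _ F cover, of Cb Cm]
          unfolding \<gamma>_eq by (simp add: T_def)
        also have "\<dots> \<le> e + e + e + (\<Sum>(\<sigma>, s, y)\<in>F \<times> {\<eta>, - \<eta>} \<times> {x, - x}. err y (weight p \<sigma> s) n / (\<delta> / 4))"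
          using \<delta> errors elim(3,4) \<rho> \<gamma> K e unfolding case_prod_beta
          by (intro add_mono sum_mono divide_right_mono) (auto simp: A_def)
        also have "\<dots> \<le> 4 * e" using elim(1) by linarith
        finally show "P n \<rho> \<gamma> \<le> 4 * e" .
      qed
    qed
  qed
  have "(\<lambda>n. SUP (\<rho>, \<gamma>)\<in>{0..R} \<times> {0..\<Gamma>}. P n \<rho> \<gamma>) \<longlonglongrightarrow> 0"
  proof (rule tendstoI)
    fix e :: real assume "e > 0"
    hence "\<forall>\<^sub>F n in sequentially. \<forall>\<rho>\<in>{0..R}. \<forall>\<gamma>\<in>{0..\<Gamma>}. P n \<rho> \<gamma> \<le> 4 * (e / 5)" by (intro uniform) simp
    thus "\<forall>\<^sub>F n in sequentially. dist (SUP (\<rho>, \<gamma>)\<in>{0..R} \<times> {0..\<Gamma>}. P n \<rho> \<gamma>) 0 < e"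
    proof eventually_elim
      case (elim n)
      have ne: "(0, 0) \<in> {0..R} \<times> {0..\<Gamma>}" using R \<Gamma> by simp
      have "(SUP (\<rho>, \<gamma>)\<in>{0..R} \<times> {0..\<Gamma>}. P n \<rho> \<gamma>) \<le> 4 * (e / 5)"
        by (rule cSUP_least) (use ne elim in auto)
      moreover have "0 \<le> (SUP (\<rho>, \<gamma>)\<in>{0..R} \<times> {0..\<Gamma>}. P n \<rho> \<gamma>)"
      proof (rule cSUP_upper2[OF _ ne])
        show "bdd_above ((\<lambda>(\<rho>, \<gamma>). P n \<rho> \<gamma>) ` ({0..R} \<times> {0..\<Gamma>}))"
          using elim by (intro bdd_aboveI2[of _ _ "4 * (e / 5)"]) auto
      qed (simp add: P_def)
      ultimately show ?case using \<open>e > 0\<close> by (simp add: dist_real_def)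
    qed
  qed
  thus "(\<lambda>n. SUP (\<rho>, \<gamma>)\<in>{0..R} \<times> {0..\<Gamma>}.
       measure (M n \<rho> \<gamma>) {\<omega> \<in> space (M n \<rho> \<gamma>).
         \<bar>sqrt (real n) *
            (symmetrize (empirical_cdf n
               (residual p (\<mu>hat n \<rho> \<gamma> \<omega>) (\<lambda>j. \<beta>hat n \<rho> \<gamma> j \<omega>)
                  (contaminated_obs (v n \<rho> \<gamma>) (z n \<rho> \<gamma>) (\<xi> n \<rho> \<gamma>) \<omega>))) x
             - symmetrize (empirical_cdf n (\<lambda>t. \<epsilon> n \<rho> \<gamma> t \<omega>)) x)
          - \<gamma> * DeltaS p \<beta> \<theta>\<^sub>0 \<xi>_law x\<bar> > \<delta>}) \<longlonglongrightarrow> 0"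
    unfolding P_def .
qed

end
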